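(* Restricted to ONE-ONE-LQ instances that admit at least one feasible, envy-free matching, MAXEFM (given $(G,k)$, decide whether $G$ has a feasible envy-free matching of size $k$) admits a polynomial kernel with respect to the combined parameter $(s,t)$. Restricted to ONE-ONE-LQ instances in which a stable matching is feasible, MAXRSM (given $(G,k)$, decide whether $G$ has a feasible relaxed stable matching of size $k$) admits a polynomial kernel with respect to the parameter $s$.
   Context: A ONE-ONE-LQ instance consists of a bipartite graph $G=(\mathcal{A}\cup\mathcal{B},E)$ of agents $\mathcal{A}$ and resources $\mathcal{B}$; every vertex has a strict preference order over its neighbours ($v\succ_u w$: $u$ prefers $v$ to $w$). Every resource has upper-quota $1$ and lower-quota $q^-(b)\in\{0,1\}$; $b$ is an LQ resource if $q^-(b)=1$. A matching $M\subseteq E$ has every vertex in at most one edge; $M(v)$ is the partner of $v$ or $\bot$ (least preferred) if unmatched. $M$ is feasible if every LQ resource is matched. $(a,b)\in E\setminus M$ is a blocking pair if $b\succ_a M(a)$ and $a\succ_b M(b)$; $M$ is stable if it has none (all stable matchings have the same size). $a$ envies a matched agent $a'$ with $M(a')=b$ if $(a,b)\in E$, $b\succ_a M(a)$, $a\succ_b a'$; $M$ is envy-free if there is no such pair. $M$ is relaxed stable if every agent in a blocking pair is matched and matched to an LQ resource. Parameters: $s$ = size of a stable matching; $t$ = maximum over pairs of agents of the number of non-LQ resources common to both agents' preference lists. A polynomial kernel is a polynomial-time algorithm mapping an instance $(G,k)$ to an equivalent instance $(G',k')$ whose size is bounded by a polynomial in the parameter. *)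

theory Defs
  imports
    "HOL-Computational_Algebra.Polynomial"
    "HOL-Library.Discrete_Functions"
begin

section \<open>Polynomial-time computation\<close>

text \<open>
  The model of computation is a random access machine in structured form: finitely many registers
  and finitely many one-dimensional arrays of natural numbers (indirect addressing), constants,
  addition, truncated subtraction, comparisons, branching and loops, every elementary command
  costing one step. There is deliberately no multiplication: with addition and subtraction only,
  \<open>T\<close> unit-cost steps lengthen the binary representation of a value by \<open>O(T)\<close> bits, so that
  polynomial time here coincides with polynomial time on Turing machines.
\<close>

datatype aexp =
    Const nat
  | Reg nat
  | Cell nat aexp
  | Plus aexp aexp
  | Minus aexp aexp

datatype bexp =
    Less aexp aexp
  | Equal aexp aexp
  | Neg bexp
  | Conj bexp bexp

datatype com =
    Skip
  | SetReg nat aexp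
  | SetCell nat aexp aexp
  | Seq com com
  | Cond bexp com com
  | Loop bexp com

record ram_state =
  reg :: "nat \<Rightarrow> nat"
  arr :: "nat \<Rightarrow> nat \<Rightarrow> nat"

fun aval :: "aexp \<Rightarrow> ram_state \<Rightarrow> nat" where
  "aval (Const n) \<sigma> = n"
| "aval (Reg x) \<sigma> = reg \<sigma> x"
| "aval (Cell A e) \<sigma> = arr \<sigma> A (aval e \<sigma>)"
| "aval (Plus e f) \<sigma> = aval e \<sigma> + aval f \<sigma>"
| "aval (Minus e f) \<sigma> = aval e \<sigma> - aval f \<sigma>"

fun bval :: "bexp \<Rightarrow> ram_state \<Rightarrow> bool" where
  "bval (Less e f) \<sigma> \<longleftrightarrow> aval e \<sigma> < aval f \<sigma>"
| "bval (Equal e f) \<sigma> \<longleftrightarrow> aval e \<sigma> = aval f \<sigma>"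
| "bval (Neg b) \<sigma> \<longleftrightarrow> \<not> bval b \<sigma>"
| "bval (Conj b c) \<sigma> \<longleftrightarrow> bval b \<sigma> \<and> bval c \<sigma>"

text \<open>\<open>exec c \<sigma> n \<tau>\<close>: started in \<open>\<sigma>\<close>, the program \<open>c\<close> halts after \<open>n\<close> steps in \<open>\<tau>\<close>.\<close>

inductive exec :: "com \<Rightarrow> ram_state \<Rightarrow> nat \<Rightarrow> ram_state \<Rightarrow> bool" where
  exec_Skip: "exec Skip \<sigma> 1 \<sigma>"
| exec_SetReg: "exec (SetReg x e) \<sigma> 1 (\<sigma>\<lparr>reg := (reg \<sigma>)(x := aval e \<sigma>)\<rparr>)"
| exec_SetCell: "exec (SetCell A e f) \<sigma> 1
    (\<sigma>\<lparr>arr := (arr \<sigma>)(A := (arr \<sigma> A)(aval e \<sigma> := aval f \<sigma>))\<rparr>)"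
| exec_Seq: "exec c \<sigma> m \<sigma>' \<Longrightarrow> exec d \<sigma>' n \<sigma>'' \<Longrightarrow> exec (Seq c d) \<sigma> (m + n) \<sigma>''"
| exec_CondTrue: "bval b \<sigma> \<Longrightarrow> exec c \<sigma> n \<sigma>' \<Longrightarrow> exec (Cond b c d) \<sigma> (n + 1) \<sigma>'"
| exec_CondFalse: "\<not> bval b \<sigma> \<Longrightarrow> exec d \<sigma> n \<sigma>' \<Longrightarrow> exec (Cond b c d) \<sigma> (n + 1) \<sigma>'"
| exec_LoopTrue: "bval b \<sigma> \<Longrightarrow> exec c \<sigma> m \<sigma>' \<Longrightarrow> exec (Loop b c) \<sigma>' n \<sigma>'' \<Longrightarrow>
    exec (Loop b c) \<sigma> (m + n + 1) \<sigma>''"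
| exec_LoopFalse: "\<not> bval b \<sigma> \<Longrightarrow> exec (Loop b c) \<sigma> 1 \<sigma>"

lemma exec_deterministic:
  "exec c \<sigma> n \<tau> \<Longrightarrow> exec c \<sigma> n' \<tau>' \<Longrightarrow> n' = n \<and> \<tau>' = \<tau>"
proof (induction arbitrary: n' \<tau>' rule: exec.induct)
  case (exec_Skip \<sigma>)
  then show ?case by (auto elim: exec.cases)
next
  case (exec_SetReg x e \<sigma>)
  then show ?case by (auto elim: exec.cases)
next
  case (exec_SetCell A e f \<sigma>)
  then show ?case by (auto elim: exec.cases)
next
  case (exec_Seq c \<sigma> m \<sigma>' d n \<sigma>'')
  from exec_Seq.prems show ?case
    by cases (use exec_Seq.IH in blast)
next
  case (exec_CondTrue b \<sigma> c n \<sigma>' d)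
  from exec_CondTrue.prems show ?case
    by cases (use exec_CondTrue in blast)+
next
  case (exec_CondFalse b \<sigma> d n \<sigma>' c)
  from exec_CondFalse.prems show ?case
    by cases (use exec_CondFalse in blast)+
next
  case (exec_LoopTrue b \<sigma> c m \<sigma>' n \<sigma>'')
  from exec_LoopTrue.prems show ?case
    by cases (use exec_LoopTrue in blast)+
next
  case (exec_LoopFalse b \<sigma> c)
  then show ?case by (auto elim: exec.cases)
qed

text \<open>
  Input and output words are held in array 0, their length in register 0; all other memory is
  initially zero. The letters of a word are natural numbers, and the size of a word is its length
  in bits when they are written in binary (\<open>floor_log x + 1\<close> is the number of binary digits of \<open>x\<close>).
\<close>

definition initial :: "nat list \<Rightarrow> ram_state" where
  "initial w = \<lparr>reg = (\<lambda>x. if x = 0 then length w else 0),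
     arr = (\<lambda>A i. if A = 0 \<and> i < length w then w ! i else 0)\<rparr>"

definition output_word :: "ram_state \<Rightarrow> nat list" where
  "output_word \<sigma> = map (arr \<sigma> 0) [0..<reg \<sigma> 0]"

definition word_size :: "nat list \<Rightarrow> nat" where
  "word_size w = (\<Sum>x\<leftarrow>w. floor_log x + 1)"

definition poly_time_on :: "('i \<Rightarrow> nat list) \<Rightarrow> 'i set \<Rightarrow> ('i \<Rightarrow> 'i) \<Rightarrow> bool" where
  "poly_time_on enc I f \<longleftrightarrow>
     (\<exists>(c :: com) (q :: nat poly). \<forall>x\<in>I. \<exists>n \<tau>.
        exec c (initial (enc x)) n \<tau> \<and> output_word \<tau> = enc (f x) \<and>
        n \<le> poly q (word_size (enc x)))"

text \<open>
  The problem with instance set \<open>I\<close> and set \<open>Y\<close> of yes-instances, parameterized by \<open>\<kappa>\<close>: as usual,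
  a kernelization maps instances of the (restricted) problem to instances of the same problem.
  A combined parameter \<open>(s, t)\<close> is represented by \<open>s + t\<close>: on natural numbers, being bounded by a
  polynomial in \<open>s\<close> and \<open>t\<close> is the same as being bounded by a polynomial in \<open>s + t\<close>.
\<close>

definition admits_poly_kernel ::
    "('i \<Rightarrow> nat list) \<Rightarrow> 'i set \<Rightarrow> 'i set \<Rightarrow> ('i \<Rightarrow> nat) \<Rightarrow> bool" where
  "admits_poly_kernel enc I Y \<kappa> \<longleftrightarrow>
     (\<exists>f. poly_time_on enc I f \<and>
          (\<forall>x\<in>I. f x \<in> I \<and> (f x \<in> Y \<longleftrightarrow> x \<in> Y)) \<and>
          (\<exists>p :: nat poly. \<forall>x\<in>I. word_size (enc (f x)) \<le> poly p (\<kappa> x)))"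


section \<open>Instances\<close>

text \<open>
  The agents are \<open>0, \<dots>, length (apref G) - 1\<close>, the resources \<open>0, \<dots>, length (bpref G) - 1\<close>. The
  preference list of a vertex enumerates its neighbours, the most preferred one first, so the
  lists determine the edges; \<open>lq G ! b\<close> states that the lower quota of \<open>b\<close> is 1.
\<close>

record lq_instance =
  apref :: "nat list list"
  bpref :: "nat list list"
  lq :: "bool list"

definition agents :: "lq_instance \<Rightarrow> nat set" where
  "agents G = {..<length (apref G)}"

definition resources :: "lq_instance \<Rightarrow> nat set" where
  "resources G = {..<length (bpref G)}"

definition is_lq :: "lq_instance \<Rightarrow> nat \<Rightarrow> bool" where
  "is_lq G b \<longleftrightarrow> b \<in> resources G \<and> lq G ! b"

definition edges :: "lq_instance \<Rightarrow> (nat \<times> nat) set" where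
  "edges G = {(a, b). a \<in> agents G \<and> b \<in> set (apref G ! a)}"

definition wf_instance :: "lq_instance \<Rightarrow> bool" where
  "wf_instance G \<longleftrightarrow>
     length (lq G) = length (bpref G) \<and>
     (\<forall>a\<in>agents G. distinct (apref G ! a) \<and> set (apref G ! a) \<subseteq> resources G) \<and>
     (\<forall>b\<in>resources G. distinct (bpref G ! b) \<and> set (bpref G ! b) \<subseteq> agents G) \<and>
     (\<forall>a\<in>agents G. \<forall>b\<in>resources G. b \<in> set (apref G ! a) \<longleftrightarrow> a \<in> set (bpref G ! b))"

definition precedes :: "nat list \<Rightarrow> nat \<Rightarrow> nat \<Rightarrow> bool" where
  "precedes xs v w \<longleftrightarrow> (\<exists>i j. i < j \<and> j < length xs \<and> xs ! i = v \<and> xs ! j = w)"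

text \<open>\<open>None\<close> stands for \<open>\<bottom>\<close>, being unmatched, which is worse than every neighbour.\<close>

fun precedes_opt :: "nat list \<Rightarrow> nat \<Rightarrow> nat option \<Rightarrow> bool" where
  "precedes_opt xs v None \<longleftrightarrow> v \<in> set xs"
| "precedes_opt xs v (Some w) \<longleftrightarrow> precedes xs v w"


section \<open>Matchings\<close>

definition matching :: "lq_instance \<Rightarrow> (nat \<times> nat) set \<Rightarrow> bool" where
  "matching G M \<longleftrightarrow> M \<subseteq> edges G \<and>
     (\<forall>a b b'. (a, b) \<in> M \<and> (a, b') \<in> M \<longrightarrow> b = b') \<and>
     (\<forall>a a' b. (a, b) \<in> M \<and> (a', b) \<in> M \<longrightarrow> a = a')"

definition apartner :: "(nat \<times> nat) set \<Rightarrow> nat \<Rightarrow> nat option" where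
  "apartner M a = (if \<exists>b. (a, b) \<in> M then Some (THE b. (a, b) \<in> M) else None)"

definition bpartner :: "(nat \<times> nat) set \<Rightarrow> nat \<Rightarrow> nat option" where
  "bpartner M b = (if \<exists>a. (a, b) \<in> M then Some (THE a. (a, b) \<in> M) else None)"

definition feasible :: "lq_instance \<Rightarrow> (nat \<times> nat) set \<Rightarrow> bool" where
  "feasible G M \<longleftrightarrow> (\<forall>b. is_lq G b \<longrightarrow> bpartner M b \<noteq> None)"

definition blocking_pair :: "lq_instance \<Rightarrow> (nat \<times> nat) set \<Rightarrow> nat \<Rightarrow> nat \<Rightarrow> bool" where
  "blocking_pair G M a b \<longleftrightarrow> (a, b) \<in> edges G - M \<and>
     precedes_opt (apref G ! a) b (apartner M a) \<and>
     precedes_opt (bpref G ! b) a (bpartner M b)"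

definition stable :: "lq_instance \<Rightarrow> (nat \<times> nat) set \<Rightarrow> bool" where
  "stable G M \<longleftrightarrow> matching G M \<and> (\<forall>a b. \<not> blocking_pair G M a b)"

definition envies :: "lq_instance \<Rightarrow> (nat \<times> nat) set \<Rightarrow> nat \<Rightarrow> nat \<Rightarrow> bool" where
  "envies G M a a' \<longleftrightarrow> (\<exists>b. apartner M a' = Some b \<and> (a, b) \<in> edges G \<and>
     precedes_opt (apref G ! a) b (apartner M a) \<and> precedes (bpref G ! b) a a')"

definition envy_free :: "lq_instance \<Rightarrow> (nat \<times> nat) set \<Rightarrow> bool" where
  "envy_free G M \<longleftrightarrow> matching G M \<and> (\<forall>a a'. \<not> envies G M a a')"

definition relaxed_stable :: "lq_instance \<Rightarrow> (nat \<times> nat) set \<Rightarrow> bool" where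
  "relaxed_stable G M \<longleftrightarrow> matching G M \<and>
     (\<forall>a b. blocking_pair G M a b \<longrightarrow> (\<exists>b'. apartner M a = Some b' \<and> is_lq G b'))"


section \<open>The parameters and the two problems\<close>

text \<open>All stable matchings have the same size.\<close>

definition stable_size :: "lq_instance \<Rightarrow> nat" where
  "stable_size G = (THE n. \<exists>M. stable G M \<and> card M = n)"

text \<open>The maximum is 0 if there are fewer than two agents.\<close>

definition max_common :: "lq_instance \<Rightarrow> nat" where
  "max_common G = Max (insert 0
     {card {b \<in> resources G. \<not> is_lq G b \<and> b \<in> set (apref G ! a) \<and> b \<in> set (apref G ! a')}
       | a a'. a \<in> agents G \<and> a' \<in> agents G \<and> a \<noteq> a'})"

definition encode_lists :: "nat list list \<Rightarrow> nat list" where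
  "encode_lists xss = concat (map (\<lambda>xs. length xs # xs) xss)"

definition encode :: "lq_instance \<times> nat \<Rightarrow> nat list" where
  "encode = (\<lambda>(G, k). [k, length (apref G), length (bpref G)] @ map of_bool (lq G) @
     encode_lists (apref G) @ encode_lists (bpref G))"

lemma encode_lists_inj:
  assumes "length xss = length yss" and "encode_lists xss @ us = encode_lists yss @ vs"
  shows "xss = yss \<and> us = vs"
  using assms by (induction xss yss rule: list_induct2) (auto simp: encode_lists_def)

lemma encode_inj: "inj_on encode {(G, k). wf_instance G}"
proof (rule inj_onI, clarify)
  fix G k H l
  assume wf: "wf_instance G" "wf_instance H" and eq: "encode (G, k) = encode (H, l)"
  from eq have k: "k = l" and la: "length (apref G) = length (apref H)"
    and lb: "length (bpref G) = length (bpref H)"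
    and rest: "map of_bool (lq G) @ encode_lists (apref G) @ encode_lists (bpref G) =
      (map of_bool (lq H) :: nat list) @ encode_lists (apref H) @ encode_lists (bpref H)"
    by (auto simp: encode_def)
  have "length (lq G) = length (lq H)"
    using wf lb by (simp add: wf_instance_def)
  with rest have m: "map of_bool (lq G) = (map of_bool (lq H) :: nat list)"
    and rest': "encode_lists (apref G) @ encode_lists (bpref G) =
      encode_lists (apref H) @ encode_lists (bpref H)"
    by auto
  have "inj (of_bool :: bool \<Rightarrow> nat)"
    by (simp add: inj_def)
  with m have q: "lq G = lq H"
    by (simp add: inj_map_eq_map)
  from encode_lists_inj[OF la rest'] have "apref G = apref H"
    and "encode_lists (bpref G) = encode_lists (bpref H)" by auto
  moreover from this(2) have "bpref G = bpref H"
    using encode_lists_inj[OF lb, of "[]" "[]"] by simp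
  ultimately show "G = H \<and> k = l"
    using q k by simp
qed

definition maxefm_yes :: "(lq_instance \<times> nat) set" where
  "maxefm_yes = {(G, k). \<exists>M. feasible G M \<and> envy_free G M \<and> card M = k}"

definition maxrsm_yes :: "(lq_instance \<times> nat) set" where
  "maxrsm_yes = {(G, k). \<exists>M. feasible G M \<and> relaxed_stable G M \<and> card M = k}"

definition efm_instances :: "(lq_instance \<times> nat) set" where
  "efm_instances = {(G, k). wf_instance G \<and> (\<exists>M. feasible G M \<and> envy_free G M)}"

definition stable_feasible_instances :: "(lq_instance \<times> nat) set" where
  "stable_feasible_instances = {(G, k). wf_instance G \<and> (\<exists>M. stable G M \<and> feasible G M)}"

end

theory Submission
  imports Defs "HOL-Library.Indicator_Function"
begin

text \<open>
  Let \<open>X\<close> consist of the LQ resources and the endpoints of a greedy maximal matching. Every edge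
  meets \<open>X\<close>, and \<open>|X| \<le> 6 s\<close>, since every matching has at most \<open>2 s\<close> edges. For every vertex of
  \<open>X\<close> keep its \<open>|X| + 1\<close> most preferred neighbours outside \<open>X\<close>. In any matching at most \<open>|X|\<close>
  vertices outside \<open>X\<close> are matched, so if a deleted vertex \<open>u\<close> is adjacent to \<open>v \<in> X\<close>, then \<open>v\<close>
  prefers some unmatched kept neighbour to \<open>u\<close>. Hence a relaxed stable matching cannot use \<open>u\<close>, and
  a blocking pair \<open>{u, v}\<close> yields one among kept vertices; the same holds for agents and envy.

  An unmatched resource causes no envy, so for envy-free matchings the resources are treated
  differently: outside \<open>X\<close> those with at least two neighbours are all kept (their number is bounded
  through \<open>t\<close>), and an agent matched to a deleted resource can move to a better kept one that has no
  other neighbour.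
\<close>

section \<open>Running programs\<close>

notation Seq (infixr ";;" 60)

abbreviation When :: "bexp \<Rightarrow> com \<Rightarrow> com" where
  "When b c \<equiv> Cond b c Skip"

definition set_reg :: "nat \<Rightarrow> nat \<Rightarrow> ram_state \<Rightarrow> ram_state" where
  "set_reg r v \<sigma> = \<sigma>\<lparr>reg := (reg \<sigma>)(r := v)\<rparr>"

definition set_cell :: "nat \<Rightarrow> nat \<Rightarrow> nat \<Rightarrow> ram_state \<Rightarrow> ram_state" where
  "set_cell A i v \<sigma> = \<sigma>\<lparr>arr := (arr \<sigma>)(A := (arr \<sigma> A)(i := v))\<rparr>"

lemma set_reg_simps [simp]:
  "reg (set_reg r v \<sigma>) = (reg \<sigma>)(r := v)" "arr (set_reg r v \<sigma>) = arr \<sigma>"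
  by (simp_all add: set_reg_def)

lemma set_cell_simps [simp]:
  "reg (set_cell A i v \<sigma>) = reg \<sigma>" "arr (set_cell A i v \<sigma>) = (arr \<sigma>)(A := (arr \<sigma> A)(i := v))"
  by (simp_all add: set_cell_def)

lemma set_reg_set_reg [simp]: "set_reg r u (set_reg r v \<sigma>) = set_reg r u \<sigma>"
  by (simp add: set_reg_def)

definition run :: "com \<Rightarrow> ram_state \<Rightarrow> (nat \<Rightarrow> ram_state \<Rightarrow> bool) \<Rightarrow> bool" where
  "run c \<sigma> Q \<longleftrightarrow> (\<exists>n \<tau>. exec c \<sigma> n \<tau> \<and> Q n \<tau>)"

lemma run_Skip: "run Skip \<sigma> Q \<longleftrightarrow> Q 1 \<sigma>"
  unfolding run_def by (subst exec.simps) auto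

lemma run_SetReg: "run (SetReg r e) \<sigma> Q \<longleftrightarrow> Q 1 (set_reg r (aval e \<sigma>) \<sigma>)"
  unfolding run_def set_reg_def by (subst exec.simps) auto

lemma run_SetCell: "run (SetCell A e f) \<sigma> Q \<longleftrightarrow> Q 1 (set_cell A (aval e \<sigma>) (aval f \<sigma>) \<sigma>)"
  unfolding run_def set_cell_def by (subst exec.simps) auto

lemma run_Seq: "run (c ;; d) \<sigma> Q \<longleftrightarrow> run c \<sigma> (\<lambda>m \<tau>. run d \<tau> (\<lambda>n. Q (m + n)))"
  unfolding run_def by (subst exec.simps) (simp, blast)

lemma run_Seq_assoc: "run ((c ;; d) ;; e) \<sigma> Q \<longleftrightarrow> run (c ;; d ;; e) \<sigma> Q"
  by (simp add: run_Seq add.assoc)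

lemma run_Cond:
  "run (Cond b c d) \<sigma> Q \<longleftrightarrow>
     (if bval b \<sigma> then run c \<sigma> (\<lambda>n. Q (n + 1)) else run d \<sigma> (\<lambda>n. Q (n + 1)))"
  unfolding run_def by (subst exec.simps) auto

lemma run_Loop:
  "run (Loop b c) \<sigma> Q \<longleftrightarrow>
     (if bval b \<sigma> then run (c ;; Loop b c) \<sigma> (\<lambda>n. Q (n + 1)) else Q 1 \<sigma>)"
  unfolding run_Seq unfolding run_def by (subst exec.simps) (simp, blast)

lemmas run_simps = run_Skip run_SetReg run_SetCell run_Seq run_Cond

lemma run_mono: "run c \<sigma> Q \<Longrightarrow> (\<And>n \<tau>. Q n \<tau> \<Longrightarrow> Q' n \<tau>) \<Longrightarrow> run c \<sigma> Q'"
  unfolding run_def by blast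

abbreviation run_within :: "com \<Rightarrow> ram_state \<Rightarrow> nat \<Rightarrow> (ram_state \<Rightarrow> bool) \<Rightarrow> bool" where
  "run_within c \<sigma> t Q \<equiv> run c \<sigma> (\<lambda>n \<tau>. n \<le> t \<and> Q \<tau>)"

lemma run_within_weaken:
  "run_within c \<sigma> t P \<Longrightarrow> t \<le> t' \<Longrightarrow> (\<And>\<tau>. P \<tau> \<Longrightarrow> Q \<tau>) \<Longrightarrow> run_within c \<sigma> t' Q"
  by (erule run_mono) auto

lemma run_within_Seq:
  assumes "run_within c \<sigma> s P"
    and "\<And>\<tau>. P \<tau> \<Longrightarrow> run_within d \<tau> t Q"
  shows "run_within (c ;; d) \<sigma> (s + t) Q"
  unfolding run_Seq by (rule run_mono[OF assms(1)]) (force intro: run_mono[OF assms(2)])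

lemma run_within_Loop:
  assumes guard: "\<And>i \<tau>. I i \<tau> \<Longrightarrow> i \<le> K \<Longrightarrow> bval b \<tau> \<longleftrightarrow> i < K"
    and body: "\<And>i \<tau>. i < K \<Longrightarrow> I i \<tau> \<Longrightarrow> run_within c \<tau> t (I (Suc i))"
    and "I i \<sigma>" "i + d = K"
  shows "run_within (Loop b c) \<sigma> (d * (t + 1) + 1) (I K)"
  using assms(3,4)
proof (induction d arbitrary: i \<sigma>)
  case 0
  then show ?case
    using guard[of i \<sigma>] by (subst run_Loop) simp
next
  case (Suc d)
  have "run_within (c ;; Loop b c) \<sigma> (t + (d * (t + 1) + 1)) (I K)"
    using Suc by (intro run_within_Seq[OF body]) auto
  then have "run (c ;; Loop b c) \<sigma> (\<lambda>n \<tau>. n + 1 \<le> Suc d * (t + 1) + 1 \<and> I K \<tau>)"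
    by (simp add: ac_simps)
  then show ?case
    using guard[of i \<sigma>] Suc.prems by (subst run_Loop) simp
qed

definition For :: "nat \<Rightarrow> aexp \<Rightarrow> com \<Rightarrow> com" where
  "For r e c = SetReg r (Const 0) ;;
     Loop (Less (Reg r) e) (c ;; SetReg r (Plus (Reg r) (Const 1)))"

lemma run_within_For:
  assumes init: "I 0 \<sigma>"
    and frame: "\<And>i \<tau> v. I i \<tau> \<Longrightarrow> I i (set_reg r v \<tau>)"
    and bound: "\<And>i \<tau>. I i \<tau> \<Longrightarrow> aval e \<tau> = K"
    and body: "\<And>i \<tau>. i < K \<Longrightarrow> I i \<tau> \<Longrightarrow> reg \<tau> r = i \<Longrightarrow>
      run_within c \<tau> t (\<lambda>\<tau>'. reg \<tau>' r = i \<and> I (Suc i) \<tau>')"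
  shows "run_within (For r e c) \<sigma> (K * (t + 2) + 2) (I K)"
proof -
  let ?J = "\<lambda>i \<tau>. reg \<tau> r = i \<and> I i \<tau>"
  let ?inc = "SetReg r (Plus (Reg r) (Const 1))"
  have "run_within (c ;; ?inc) \<tau> (t + 1) (?J (Suc i))" if "i < K" "?J i \<tau>" for i \<tau>
    by (rule run_within_Seq[OF body]) (use that frame in \<open>auto simp: run_SetReg\<close>)
  then have "run_within (Loop (Less (Reg r) e) (c ;; ?inc)) \<tau> (K * (t + 1 + 1) + 1) (?J K)"
    if "?J 0 \<tau>" for \<tau>
    using that bound by (intro run_within_Loop[where i = 0]) auto
  moreover have "run_within (SetReg r (Const 0)) \<sigma> 1 (?J 0)"
    using init frame by (simp add: run_SetReg)
  ultimately have "run_within (For r e c) \<sigma> (1 + (K * (t + 1 + 1) + 1)) (?J K)"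
    unfolding For_def by (intro run_within_Seq)
  then show ?thesis
    by (rule run_within_weaken) auto
qed

section \<open>Stable and envy-free matchings in bipartite graphs with preferences\<close>

definition matching_in :: "('a \<times> 'b) set \<Rightarrow> ('a \<times> 'b) set \<Rightarrow> bool" where
  "matching_in E M \<longleftrightarrow> M \<subseteq> E \<and> inj_on fst M \<and> inj_on snd M"

lemma matching_in_subset: "matching_in E M \<Longrightarrow> M \<subseteq> E"
  by (simp add: matching_in_def)

lemma matching_in_mono: "matching_in E M \<Longrightarrow> M \<subseteq> E' \<Longrightarrow> matching_in E' M"
  by (simp add: matching_in_def)

lemma matching_in_iff:
  "matching_in E M \<longleftrightarrow> M \<subseteq> E \<and> (\<forall>a b b'. (a, b) \<in> M \<and> (a, b') \<in> M \<longrightarrow> b = b') \<and>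
     (\<forall>a a' b. (a, b) \<in> M \<and> (a', b) \<in> M \<longrightarrow> a = a')"
  unfolding matching_in_def inj_on_def by (simp add: Ball_def) blast

lemma matching_in_unique_snd: "matching_in E M \<Longrightarrow> (a, b) \<in> M \<Longrightarrow> (a, b') \<in> M \<Longrightarrow> b = b'"
  unfolding matching_in_iff by blast

lemma matching_in_unique_fst: "matching_in E M \<Longrightarrow> (a, b) \<in> M \<Longrightarrow> (a', b) \<in> M \<Longrightarrow> a = a'"
  unfolding matching_in_iff by blast

lemma matching_in_converse: "matching_in E M \<Longrightarrow> matching_in (E\<inverse>) (M\<inverse>)"
  unfolding matching_in_iff by blast

lemma card_matching_le_vertex_cover:
  assumes M: "matching_in E M" and fin: "finite A" "finite B"
    and cover: "\<And>a b. (a, b) \<in> M \<Longrightarrow> a \<in> A \<or> b \<in> B"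
  shows "finite M" "card M \<le> card A + card B"
proof -
  let ?MA = "{e \<in> M. fst e \<in> A}" and ?MB = "{e \<in> M. snd e \<in> B}"
  have inj: "inj_on fst ?MA" "inj_on snd ?MB"
    using M by (auto simp: matching_in_def intro: inj_on_subset)
  have "M \<subseteq> ?MA \<union> ?MB"
    using cover by fastforce
  moreover have "finite ?MA" "finite ?MB"
    using inj fin by (auto intro: inj_on_finite)
  ultimately show "finite M"
    by (meson finite_UnI finite_subset)
  have "card M \<le> card (?MA \<union> ?MB)"
    using \<open>M \<subseteq> ?MA \<union> ?MB\<close> \<open>finite M\<close> by (intro card_mono) auto
  also have "\<dots> \<le> card ?MA + card ?MB"
    by (rule card_Un_le)
  also have "\<dots> \<le> card A + card B"
    using inj fin by (intro add_mono card_inj_on_le) auto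
  finally show "card M \<le> card A + card B" .
qed

lemma ex_unmatched:
  assumes M: "matching_in E M" and "finite B" "card B < card A"
    and nbrs: "\<And>a b. a \<in> A \<Longrightarrow> (a, b) \<in> E \<Longrightarrow> b \<in> B"
  shows "\<exists>a\<in>A. \<forall>b. (a, b) \<notin> M"
proof (rule ccontr)
  assume "\<not> ?thesis"
  then have all_matched: "A \<subseteq> fst ` {e \<in> M. fst e \<in> A}"
    by force
  have "matching_in E {e \<in> M. fst e \<in> A}"
    using M by (auto simp: matching_in_def intro: inj_on_subset)
  then have "finite {e \<in> M. fst e \<in> A}" "card {e \<in> M. fst e \<in> A} \<le> card B"
    using nbrs matching_in_subset[OF M] \<open>finite B\<close>
      card_matching_le_vertex_cover[of E "{e \<in> M. fst e \<in> A}" "{}" B] by auto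
  then have "card A \<le> card B"
    using surj_card_le[OF _ all_matched] by simp
  with \<open>card B < card A\<close> show False
    by simp
qed

text \<open>
  \<open>P a b b'\<close>: the left vertex \<open>a\<close> prefers \<open>b\<close> to \<open>b'\<close>; \<open>R b a a'\<close>: the right vertex \<open>b\<close> prefers
  \<open>a\<close> to \<open>a'\<close>.
\<close>

definition blocks ::
    "('a \<times> 'b) set \<Rightarrow> ('a \<Rightarrow> 'b \<Rightarrow> 'b \<Rightarrow> bool) \<Rightarrow> ('b \<Rightarrow> 'a \<Rightarrow> 'a \<Rightarrow> bool) \<Rightarrow>
     ('a \<times> 'b) set \<Rightarrow> 'a \<Rightarrow> 'b \<Rightarrow> bool" where
  "blocks E P R M a b \<longleftrightarrow> (a, b) \<in> E - M \<and>
     (\<forall>b'\<in>M `` {a}. P a b b') \<and> (\<forall>a'\<in>M\<inverse> `` {b}. R b a a')"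

lemma blocksI:
  "(a, b) \<in> E \<Longrightarrow> (a, b) \<notin> M \<Longrightarrow> (\<And>b'. (a, b') \<in> M \<Longrightarrow> P a b b') \<Longrightarrow>
    (\<And>a'. (a', b) \<in> M \<Longrightarrow> R b a a') \<Longrightarrow> blocks E P R M a b"
  by (auto simp: blocks_def)

lemma blocksD:
  assumes "blocks E P R M a b"
  shows "(a, b) \<in> E" "(a, b) \<notin> M" "(a, b') \<in> M \<Longrightarrow> P a b b'" "(a', b) \<in> M \<Longrightarrow> R b a a'"
  using assms by (auto simp: blocks_def)

text \<open>With \<open>Q = {}\<close> this is stability, with \<open>Q\<close> the set of LQ resources it is relaxed stability.\<close>

definition stable_modulo ::
    "('a \<times> 'b) set \<Rightarrow> ('a \<Rightarrow> 'b \<Rightarrow> 'b \<Rightarrow> bool) \<Rightarrow> ('b \<Rightarrow> 'a \<Rightarrow> 'a \<Rightarrow> bool) \<Rightarrow>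
     'b set \<Rightarrow> ('a \<times> 'b) set \<Rightarrow> bool" where
  "stable_modulo E P R Q M \<longleftrightarrow> matching_in E M \<and>
     (\<forall>a b. blocks E P R M a b \<longrightarrow> M `` {a} \<inter> Q \<noteq> {})"

definition no_envy ::
    "('a \<times> 'b) set \<Rightarrow> ('a \<Rightarrow> 'b \<Rightarrow> 'b \<Rightarrow> bool) \<Rightarrow> ('b \<Rightarrow> 'a \<Rightarrow> 'a \<Rightarrow> bool) \<Rightarrow>
     ('a \<times> 'b) set \<Rightarrow> bool" where
  "no_envy E P R M \<longleftrightarrow> matching_in E M \<and>
     (\<forall>(a', b)\<in>M. \<forall>a\<in>E\<inverse> `` {b}. R b a a' \<longrightarrow> (\<exists>b'\<in>M `` {a}. \<not> P a b b'))"

lemma stable_modulo_matching: "stable_modulo E P R Q M \<Longrightarrow> matching_in E M"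
  by (simp add: stable_modulo_def)

lemma stable_modulo_converse:
  "stable_modulo E P R {} M \<Longrightarrow> stable_modulo (E\<inverse>) R P {} (M\<inverse>)"
  unfolding stable_modulo_def blocks_def using matching_in_converse by auto

lemma stable_modulo_restrict:
  "stable_modulo E P R Q M \<Longrightarrow> E' \<subseteq> E \<Longrightarrow> M \<subseteq> E' \<Longrightarrow> stable_modulo E' P R Q M"
  unfolding stable_modulo_def blocks_def using matching_in_mono[of E M E'] by blast

lemma no_envy_matching: "no_envy E P R M \<Longrightarrow> matching_in E M"
  by (simp add: no_envy_def)

lemma no_envy_restrict: "no_envy E P R M \<Longrightarrow> E' \<subseteq> E \<Longrightarrow> M \<subseteq> E' \<Longrightarrow> no_envy E' P R M"
  unfolding no_envy_def using matching_in_mono[of E M E'] by blast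

lemma no_envyI:
  assumes "matching_in E M"
    and "\<And>a a' b. (a', b) \<in> M \<Longrightarrow> (a, b) \<in> E \<Longrightarrow> R b a a' \<Longrightarrow> \<exists>b'\<in>M `` {a}. \<not> P a b b'"
  shows "no_envy E P R M"
  using assms unfolding no_envy_def by blast

lemma no_envyE:
  assumes "no_envy E P R M" "(a', b) \<in> M" "(a, b) \<in> E" "R b a a'"
  obtains b' where "(a, b') \<in> M" "\<not> P a b b'"
  using assms unfolding no_envy_def by blast

definition assign :: "'a \<Rightarrow> 'b \<Rightarrow> ('a \<times> 'b) set \<Rightarrow> ('a \<times> 'b) set" where
  "assign a b M = insert (a, b) {e \<in> M. fst e \<noteq> a}"

locale preference_graph =
  fixes E :: "('a \<times> 'b) set" and P :: "'a \<Rightarrow> 'b \<Rightarrow> 'b \<Rightarrow> bool" and R :: "'b \<Rightarrow> 'a \<Rightarrow> 'a \<Rightarrow> bool"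
  assumes finite_edges: "finite E"
    and P_asymp: "asymp_on (E `` {a}) (P a)"
    and P_transp: "transp_on (E `` {a}) (P a)"
    and P_totalp: "totalp_on (E `` {a}) (P a)"
    and R_asymp: "asymp_on (E\<inverse> `` {b}) (R b)"
    and R_transp: "transp_on (E\<inverse> `` {b}) (R b)"
    and R_totalp: "totalp_on (E\<inverse> `` {b}) (R b)"
begin

lemma preference_graph_converse: "preference_graph (E\<inverse>) R P"
  by unfold_locales
    (simp_all add: finite_edges P_asymp P_transp P_totalp R_asymp R_transp R_totalp)

lemma P_irrefl: "(a, b) \<in> E \<Longrightarrow> \<not> P a b b"
  using P_asymp[of a] by (auto simp: asymp_on_def)

lemma P_trans:
  "P a b c \<Longrightarrow> P a c d \<Longrightarrow> (a, b) \<in> E \<Longrightarrow> (a, c) \<in> E \<Longrightarrow> (a, d) \<in> E \<Longrightarrow> P a b d"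
  using transp_onD[OF P_transp[of a], of b c d] by blast

lemma P_total: "(a, b) \<in> E \<Longrightarrow> (a, c) \<in> E \<Longrightarrow> b \<noteq> c \<Longrightarrow> P a b c \<or> P a c b"
  using totalp_onD[OF P_totalp[of a], of b c] by blast

lemma R_irrefl: "(a, b) \<in> E \<Longrightarrow> \<not> R b a a"
  using preference_graph.P_irrefl[OF preference_graph_converse] by simp

lemma R_trans:
  "R b a a' \<Longrightarrow> R b a' a'' \<Longrightarrow> (a, b) \<in> E \<Longrightarrow> (a', b) \<in> E \<Longrightarrow> (a'', b) \<in> E \<Longrightarrow> R b a a''"
  using preference_graph.P_trans[OF preference_graph_converse, of b a a' a''] by simp

lemma finite_nbrs: "finite (E `` {a})"
  using finite_edges by (rule finite_Image)

lemma finite_matching: "matching_in E M \<Longrightarrow> finite M"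
  by (rule finite_subset[OF matching_in_subset finite_edges])

lemma blocks_better_agent:
  assumes blocking: "blocks E P R M a b" and "M \<subseteq> E"
    and better: "(a', b) \<in> E" "R b a' a" "a' \<notin> fst ` M"
  shows "blocks E P R M a' b"
proof (rule blocksI)
  show "R b a' c" if "(c, b) \<in> M" for c
    using R_trans[OF better(2) blocksD(4)[OF blocking that] better(1) blocksD(1)[OF blocking]]
      that \<open>M \<subseteq> E\<close> by blast
qed (use better in force)+

lemma blocks_better_resource:
  assumes blocking: "blocks E P R M a b" and "M \<subseteq> E"
    and better: "(a, b') \<in> E" "P a b' b" "b' \<notin> snd ` M"
  shows "blocks E P R M a b'"
proof (rule blocksI)
  show "P a b' c" if "(a, c) \<in> M" for c
    using P_trans[OF better(2) blocksD(3)[OF blocking that] better(1) blocksD(1)[OF blocking]]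
      that \<open>M \<subseteq> E\<close> by blast
qed (use better in force)+

lemma ex_best_blocking_agent:
  assumes "blocks E P R M a b"
  obtains a' where "blocks E P R M a' b" "\<And>a''. blocks E P R M a'' b \<Longrightarrow> \<not> R b a'' a'"
proof -
  let ?A = "{a'. blocks E P R M a' b}"
  have sub: "?A \<subseteq> E\<inverse> `` {b}"
    by (auto simp: blocks_def)
  have "finite ?A"
    using sub finite_edges by (meson finite_Image finite_converse finite_subset)
  moreover have "asymp_on ?A (R b)" "transp_on ?A (R b)"
    using sub R_asymp R_transp by (blast intro: asymp_on_subset transp_on_subset)+
  ultimately obtain a' where blocking: "blocks E P R M a' b"
    and best: "\<And>a''. blocks E P R M a'' b \<Longrightarrow> a'' \<noteq> a' \<Longrightarrow> \<not> R b a'' a'"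
    using Finite_Set.bex_min_element[of ?A "R b"] assms by auto
  moreover have "\<not> R b a' a'"
    using blocking R_irrefl by (simp add: blocks_def)
  ultimately show thesis
    by (metis that)
qed

lemma blocked_resource_unmatched:
  assumes "no_envy E P R M" "blocks E P R M a b"
  shows "(a', b) \<notin> M"
proof
  assume matched: "(a', b) \<in> M"
  then have "(a, b) \<in> E" "R b a a'"
    using assms(2) by (auto simp: blocks_def)
  with assms(1) matched obtain b' where "(a, b') \<in> M" "\<not> P a b b'"
    by (rule no_envyE)
  then show False
    using assms(2) by (auto simp: blocks_def)
qed

lemma no_envy_assign:
  assumes M: "no_envy E P R M" and blocking: "blocks E P R M a b"
    and best: "\<And>a'. blocks E P R M a' b \<Longrightarrow> \<not> R b a' a"
  shows "no_envy E P R (assign a b M)"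
proof (rule no_envyI)
  have edge: "(a, b) \<in> E" and improves: "\<And>b'. (a, b') \<in> M \<Longrightarrow> P a b b'"
    using blocking by (auto simp: blocks_def)
  note unmatched = blocked_resource_unmatched[OF M blocking]
  note matching = no_envy_matching[OF M]
  show "matching_in E (assign a b M)"
    using matching edge unmatched unfolding matching_in_iff assign_def by simp blast
  fix c c' b'
  assume placed: "(c', b') \<in> assign a b M" and envy: "(c, b') \<in> E" "R b' c c'"
  show "\<exists>d\<in>assign a b M `` {c}. \<not> P c b' d"
  proof (cases "(c', b') = (a, b)")
    case True
    then have "\<not> blocks E P R M c b" "c \<noteq> a"
      using best envy R_irrefl edge by auto
    then show ?thesis
      using True envy unmatched unfolding blocks_def assign_def by force
  next
    case False
    then have "(c', b') \<in> M"
      using placed by (auto simp: assign_def)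
    with M obtain d where satisfied: "(c, d) \<in> M" "\<not> P c b' d"
      using envy by (rule no_envyE)
    have "\<not> P a b' b" if "c = a"
      using P_trans[of a b' b d] improves satisfied envy that edge matching_in_subset[OF matching]
      by blast
    then show ?thesis
      using satisfied by (cases "c = a") (auto simp: assign_def)
  qed
qed

definition satisfaction :: "('a \<times> 'b) set \<Rightarrow> nat" where
  "satisfaction M = (\<Sum>(a, b)\<in>M. Suc (card {c \<in> E `` {a}. P a b c}))"

lemma card_worse_strict_mono:
  assumes "P a b b'" "(a, b) \<in> E" "(a, b') \<in> E"
  shows "card {c \<in> E `` {a}. P a b' c} < card {c \<in> E `` {a}. P a b c}"
proof (rule psubset_card_mono)
  show "{c \<in> E `` {a}. P a b' c} \<subset> {c \<in> E `` {a}. P a b c}"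
    using assms P_trans[OF assms(1)] P_irrefl[OF assms(3)] by blast
qed (rule finite_subset[OF _ finite_nbrs[of a]], blast)

lemma satisfaction_assign_less:
  assumes M: "matching_in E M" and blocking: "blocks E P R M a b"
  shows "satisfaction M < satisfaction (assign a b M)"
proof -
  let ?w = "\<lambda>(a, b). Suc (card {c \<in> E `` {a}. P a b c})"
  let ?old = "{e \<in> M. fst e = a}" and ?rest = "{e \<in> M. fst e \<noteq> a}"
  have fin: "finite M"
    using M by (rule finite_matching)
  have "sum ?w ?old < ?w (a, b)"
  proof (cases "?old = {}")
    case False
    then obtain b' where partner: "(a, b') \<in> M"
      by auto
    then have "?old = {(a, b')}"
      using matching_in_unique_snd[OF M] by auto
    moreover have "P a b b'" "(a, b) \<in> E" "(a, b') \<in> E"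
      using partner blocking matching_in_subset[OF M] by (auto simp: blocks_def)
    ultimately show ?thesis
      using card_worse_strict_mono[of a b b'] by simp
  next
    case True
    then show ?thesis
      by (simp only: sum.empty) simp
  qed
  moreover have "sum ?w M = sum ?w ?old + sum ?w ?rest"
    using fin by (subst sum.union_disjoint[symmetric]) (auto intro: sum.cong)
  moreover have "sum ?w (assign a b M) = ?w (a, b) + sum ?w ?rest"
    unfolding assign_def using fin by (intro sum.insert) auto
  ultimately show ?thesis
    by (simp add: satisfaction_def)
qed

text \<open>
  An envy-free matching that maximises the total satisfaction is stable, because the resource of a
  blocking pair is unmatched and can be given to its best blocking agent.
\<close>

lemma ex_stable: "\<exists>M. stable_modulo E P R {} M"
proof -
  have "satisfaction M < Suc (satisfaction E)" if "no_envy E P R M" for M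
    unfolding satisfaction_def less_Suc_eq_le
    using finite_edges matching_in_subset[OF no_envy_matching[OF that]] by (rule sum_mono2) simp
  moreover have "no_envy E P R {}"
    by (simp add: no_envy_def matching_in_def)
  ultimately obtain M where M: "no_envy E P R M"
    and max: "\<And>N. no_envy E P R N \<Longrightarrow> satisfaction N \<le> satisfaction M"
    using ex_has_greatest_nat[of "no_envy E P R" "{}" satisfaction "Suc (satisfaction E)"] by blast
  have "\<not> blocks E P R M c b" for c b
  proof
    assume "blocks E P R M c b"
    then obtain a where best: "blocks E P R M a b" "\<And>a'. blocks E P R M a' b \<Longrightarrow> \<not> R b a' a"
      by (rule ex_best_blocking_agent) blast
    from max[OF no_envy_assign[OF M best]] show False
      using satisfaction_assign_less[OF no_envy_matching[OF M] best(1)] by simp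
  qed
  then show ?thesis
    using no_envy_matching[OF M] by (auto simp: stable_modulo_def)
qed

end

definition preferring ::
    "('a \<Rightarrow> 'b \<Rightarrow> 'b \<Rightarrow> bool) \<Rightarrow> ('a \<times> 'b) set \<Rightarrow> ('a \<times> 'b) set \<Rightarrow> ('a \<times> 'b) set" where
  "preferring P M N = {(a, b) \<in> M. \<forall>b'\<in>N `` {a}. P a b b'}"

lemma matching_in_preferring: "matching_in E M \<Longrightarrow> matching_in E (preferring P M N)"
  unfolding matching_in_iff preferring_def by blast

lemma card_image_matching:
  assumes "matching_in E M"
  shows "card (fst ` M) = card M" "card (snd ` M) = card M"
  using assms by (auto simp: matching_in_def intro: card_image)

context preference_graph
begin

lemma snd_preferring_subset:
  assumes M: "stable_modulo E P R {} M" and N: "stable_modulo E P R {} N"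
  shows "snd ` preferring P M N \<subseteq> fst ` preferring R (N\<inverse>) (M\<inverse>)"
proof
  fix b
  assume "b \<in> snd ` preferring P M N"
  then obtain a where preferred: "(a, b) \<in> M" "\<forall>b'\<in>N `` {a}. P a b b'"
    by (auto simp: preferring_def)
  have edges: "M \<subseteq> E" "N \<subseteq> E"
    using M N stable_modulo_matching matching_in_subset by blast+
  have "(a, b) \<notin> N"
    using preferred P_irrefl edges by blast
  moreover have "\<not> blocks E P R N a b"
    using N by (auto simp: stable_modulo_def)
  ultimately obtain a' where partner: "(a', b) \<in> N" "\<not> R b a a'"
    using preferred edges unfolding blocks_def by blast
  then have "R b a' a"
    using preference_graph.P_total[OF preference_graph_converse, of b a a'] preferred edges
      \<open>(a, b) \<notin> N\<close> by blast
  moreover have "M\<inverse> `` {b} = {a}"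
    using preferred matching_in_unique_fst[OF stable_modulo_matching[OF M]] by blast
  ultimately show "b \<in> fst ` preferring R (N\<inverse>) (M\<inverse>)"
    using partner by (force simp: preferring_def)
qed

text \<open>
  Rural hospitals theorem: \<open>M\<close> maps the agents preferring \<open>M\<close> injectively into the resources
  preferring \<open>N\<close>, and \<open>N\<close> maps these injectively back; hence both maps are bijections, and every
  agent preferring \<open>M\<close> is matched in \<open>N\<close>.
\<close>

lemma stable_matched_agents_subset:
  assumes M: "stable_modulo E P R {} M" and N: "stable_modulo E P R {} N"
  shows "fst ` M \<subseteq> fst ` N"
proof
  let ?A = "preferring P M N" and ?B = "preferring R (N\<inverse>) (M\<inverse>)"
  interpret flip: preference_graph "E\<inverse>" R P
    by (rule preference_graph_converse)
  note flipped = stable_modulo_converse[OF M] stable_modulo_converse[OF N]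
  have matchings: "matching_in E ?A" "matching_in (E\<inverse>) ?B"
    using M flipped(2) by (auto intro: matching_in_preferring stable_modulo_matching)
  then have fin: "finite ?A" "finite ?B"
    using finite_matching flip.finite_matching by auto
  have resources_subset: "snd ` ?B \<subseteq> fst ` ?A"
    using flip.snd_preferring_subset[OF flipped(2,1)] by simp
  have "card (fst ` ?A) = card (snd ` ?A)"
    using matchings by (simp add: card_image_matching)
  also have "\<dots> \<le> card (fst ` ?B)"
    using snd_preferring_subset[OF M N] fin by (intro card_mono) auto
  also have "\<dots> = card (snd ` ?B)"
    using matchings by (simp add: card_image_matching)
  finally have same_agents: "snd ` ?B = fst ` ?A"
    using resources_subset fin by (intro card_seteq) auto
  fix a
  assume "a \<in> fst ` M"
  show "a \<in> fst ` N"
  proof (rule ccontr)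
    assume "a \<notin> fst ` N"
    with \<open>a \<in> fst ` M\<close> have "a \<in> fst ` ?A"
      by (force simp: preferring_def)
    then have "a \<in> snd ` ?B"
      using same_agents by simp
    with \<open>a \<notin> fst ` N\<close> show False
      by (force simp: preferring_def)
  qed
qed

lemma stable_card_eq:
  assumes M: "stable_modulo E P R {} M" and N: "stable_modulo E P R {} N"
  shows "card M = card N"
proof -
  have "fst ` M = fst ` N"
    using stable_matched_agents_subset[OF M N] stable_matched_agents_subset[OF N M] by simp
  then show ?thesis
    using M N by (metis card_image_matching(1) stable_modulo_matching)
qed

lemma matching_card_le_double_stable:
  assumes M: "stable_modulo E P R {} M" and N: "matching_in E N"
  shows "card N \<le> 2 * card M"
proof -
  note matching = stable_modulo_matching[OF M]
  have "a \<in> fst ` M \<or> b \<in> snd ` M" if "(a, b) \<in> N" for a b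
  proof -
    have "\<not> blocks E P R M a b" "(a, b) \<in> E"
      using M that matching_in_subset[OF N] by (auto simp: stable_modulo_def)
    then show ?thesis
      unfolding blocks_def by force
  qed
  then have "card N \<le> card (fst ` M) + card (snd ` M)"
    using finite_matching[OF matching] by (intro card_matching_le_vertex_cover(2)[OF N]) auto
  then show ?thesis
    by (simp add: card_image_matching[OF matching])
qed

end

section \<open>Deleting vertices outside a vertex cover\<close>

text \<open>\<open>XA\<close> and \<open>XB\<close> form a vertex cover; the vertices outside \<open>KA\<close> and \<open>KB\<close> are deleted.\<close>

locale agent_reduction = preference_graph E P R
  for E :: "('a \<times> 'b) set" and P :: "'a \<Rightarrow> 'b \<Rightarrow> 'b \<Rightarrow> bool" and R :: "'b \<Rightarrow> 'a \<Rightarrow> 'a \<Rightarrow> bool" +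
  fixes XA KA :: "'a set" and XB KB :: "'b set"
  assumes cover: "(a, b) \<in> E \<Longrightarrow> a \<in> XA \<or> b \<in> XB"
    and finite_XB: "finite XB"
    and XA_kept: "XA \<subseteq> KA" and XB_kept: "XB \<subseteq> KB"
    and enough_agents_kept: "(a, b) \<in> E \<Longrightarrow> a \<notin> KA \<Longrightarrow>
      card XB < card {a' \<in> KA - XA. (a', b) \<in> E \<and> R b a' a}"
begin

lemma better_unmatched_agent:
  assumes "matching_in E M" "(a, b) \<in> E" "a \<notin> KA"
  obtains a' where "a' \<in> KA" "(a', b) \<in> E" "R b a' a" "b \<in> KB" "a' \<notin> fst ` M"
proof -
  have covered: "b \<in> XB"
    using cover assms XA_kept by blast
  have "\<exists>a'\<in>{a' \<in> KA - XA. (a', b) \<in> E \<and> R b a' a}. \<forall>b'. (a', b') \<notin> M"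
    using assms(1) finite_XB enough_agents_kept[OF assms(2,3)]
    by (rule ex_unmatched) (use cover in blast)
  then show thesis
    using that covered XB_kept by force
qed

lemma no_envy_agents_kept:
  assumes M: "no_envy E P R M" and matched: "(a, b) \<in> M"
  shows "a \<in> KA"
proof (rule ccontr)
  assume "a \<notin> KA"
  have "(a, b) \<in> E"
    using matched matching_in_subset[OF no_envy_matching[OF M]] by blast
  then obtain a' where "(a', b) \<in> E" "R b a' a" "a' \<notin> fst ` M"
    using better_unmatched_agent[OF no_envy_matching[OF M] _ \<open>a \<notin> KA\<close>] by metis
  then show False
    using no_envyE[OF M matched] by (metis fst_conv image_eqI)
qed

lemma no_envy_extend:
  assumes M: "no_envy (E \<inter> KA \<times> KB) P R M"
  shows "no_envy E P R M"
proof (rule no_envyI)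
  have sub: "M \<subseteq> E \<inter> KA \<times> KB"
    using M no_envy_matching matching_in_subset by blast
  then show matching: "matching_in E M"
    using M no_envy_matching matching_in_mono by blast
  fix a a' b
  assume envy: "(a', b) \<in> M" "(a, b) \<in> E" "R b a a'"
  show "\<exists>b'\<in>M `` {a}. \<not> P a b b'"
  proof (cases "a \<in> KA")
    case True
    then have "(a, b) \<in> E \<inter> KA \<times> KB"
      using envy sub by blast
    with M envy(1) show ?thesis
      using envy(3) by (elim no_envyE) auto
  next
    case False
    with matching envy(2) obtain a'' where
      better: "a'' \<in> KA" "(a'', b) \<in> E" "R b a'' a" "b \<in> KB" "a'' \<notin> fst ` M"
      by (rule better_unmatched_agent)
    then have "R b a'' a'"
      using R_trans[of b a'' a a'] envy sub by blast
    then obtain b' where "(a'', b') \<in> M"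
      using M envy(1) better no_envyE[of "E \<inter> KA \<times> KB" P R M a' b a''] by blast
    with better(5) show ?thesis
      by force
  qed
qed

end

locale two_sided_reduction = agent_reduction E P R XA KA XB KB +
    flip: agent_reduction "E\<inverse>" R P XB KB XA KA
  for E :: "('a \<times> 'b) set" and P :: "'a \<Rightarrow> 'b \<Rightarrow> 'b \<Rightarrow> bool" and R :: "'b \<Rightarrow> 'a \<Rightarrow> 'a \<Rightarrow> bool"
    and XA KA :: "'a set" and XB KB :: "'b set"
begin

lemma better_unmatched_resource:
  assumes "matching_in E M" "(a, b) \<in> E" "b \<notin> KB"
  obtains b' where "b' \<in> KB" "(a, b') \<in> E" "P a b' b" "a \<in> KA" "b' \<notin> snd ` M"
proof -
  have "(b, a) \<in> E\<inverse>"
    using assms(2) by simp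
  with matching_in_converse[OF assms(1)] obtain b' where
    "b' \<in> KB" "(b', a) \<in> E\<inverse>" "P a b' b" "a \<in> KA" "b' \<notin> fst ` M\<inverse>"
    using assms(3) by (rule flip.better_unmatched_agent)
  then show thesis
    using that by (simp add: Domain_fst[symmetric] Range_snd[symmetric])
qed

lemma stable_modulo_kept:
  assumes M: "stable_modulo E P R Q M" and Q: "Q \<subseteq> KB"
  shows "M \<subseteq> KA \<times> KB"
proof clarify
  note matching = stable_modulo_matching[OF M]
  fix a b
  assume matched: "(a, b) \<in> M"
  then have edge: "(a, b) \<in> E"
    using matching_in_subset[OF matching] by blast
  have "a \<in> KA"
  proof (rule ccontr)
    assume "a \<notin> KA"
    with matching edge obtain a' where better: "(a', b) \<in> E" "R b a' a" "a' \<notin> fst ` M"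
      by (rule better_unmatched_agent)
    moreover have "M\<inverse> `` {b} = {a}"
      using matched matching_in_unique_fst[OF matching] by blast
    ultimately have "blocks E P R M a' b"
      by (intro blocksI) force+
    with M better(3) show False
      unfolding stable_modulo_def by force
  qed
  moreover have "b \<in> KB"
  proof (rule ccontr)
    assume "b \<notin> KB"
    with matching edge obtain b' where better: "(a, b') \<in> E" "P a b' b" "b' \<notin> snd ` M"
      by (rule better_unmatched_resource)
    moreover have partner: "M `` {a} = {b}"
      using matched matching_in_unique_snd[OF matching] by blast
    ultimately have "blocks E P R M a b'"
      by (intro blocksI) force+
    with M have "b \<in> Q"
      using partner unfolding stable_modulo_def by auto
    with \<open>b \<notin> KB\<close> Q show False
      by blast
  qed
  ultimately show "a \<in> KA \<and> b \<in> KB" ..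
qed

lemma ex_blocks_kept:
  assumes M: "matching_in E M" and blocking: "blocks E P R M a b"
  obtains a' b' where "blocks (E \<inter> KA \<times> KB) P R M a' b'" "a' = a \<or> a' \<notin> fst ` M"
proof -
  have edge: "(a, b) \<in> E" and edges: "M \<subseteq> E"
    using blocking matching_in_subset[OF M] by (auto simp: blocks_def)
  have restrict: "blocks (E \<inter> KA \<times> KB) P R M c d"
    if "blocks E P R M c d" "c \<in> KA" "d \<in> KB" for c d
    using that by (simp add: blocks_def)
  consider (agent_deleted) "a \<notin> KA" | (resource_deleted) "b \<notin> KB"
    | (both_kept) "a \<in> KA" "b \<in> KB"
    by blast
  then show thesis
  proof cases
    case agent_deleted
    with M edge obtain a' where
      "a' \<in> KA" "(a', b) \<in> E" "R b a' a" "b \<in> KB" "a' \<notin> fst ` M"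
      by (rule better_unmatched_agent)
    then show ?thesis
      using that restrict blocks_better_agent[OF blocking edges] by blast
  next
    case resource_deleted
    with M edge obtain b' where
      "b' \<in> KB" "(a, b') \<in> E" "P a b' b" "a \<in> KA" "b' \<notin> snd ` M"
      by (rule better_unmatched_resource)
    then show ?thesis
      using that restrict blocks_better_resource[OF blocking edges] by blast
  next
    case both_kept
    then show ?thesis
      using that restrict blocking by blast
  qed
qed

lemma stable_modulo_reduced_iff:
  assumes Q: "Q \<subseteq> KB"
  shows "stable_modulo (E \<inter> KA \<times> KB) P R Q M \<longleftrightarrow> stable_modulo E P R Q M"
proof
  assume M: "stable_modulo (E \<inter> KA \<times> KB) P R Q M"
  then have sub: "M \<subseteq> E \<inter> KA \<times> KB"
    using stable_modulo_matching matching_in_subset by blast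
  then have matching: "matching_in E M"
    using M stable_modulo_matching matching_in_mono by blast
  have "M `` {a} \<inter> Q \<noteq> {}" if blocking: "blocks E P R M a b" for a b
  proof -
    obtain a' b' where kept_blocking: "blocks (E \<inter> KA \<times> KB) P R M a' b'" "a' = a \<or> a' \<notin> fst ` M"
      using matching blocking by (rule ex_blocks_kept)
    then have "M `` {a'} \<inter> Q \<noteq> {}"
      using M unfolding stable_modulo_def by blast
    with kept_blocking(2) show ?thesis
      by force
  qed
  with matching show "stable_modulo E P R Q M"
    by (simp add: stable_modulo_def)
next
  assume M: "stable_modulo E P R Q M"
  have "M \<subseteq> E \<inter> KA \<times> KB"
    using stable_modulo_kept[OF M Q] matching_in_subset[OF stable_modulo_matching[OF M]] by blast
  with M show "stable_modulo (E \<inter> KA \<times> KB) P R Q M"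
    by (intro stable_modulo_restrict[OF M]) auto
qed

end

context preference_graph
begin

text \<open>Nobody envies an agent at a resource adjacent to no other agent.\<close>

lemma no_envy_relocate:
  assumes M: "no_envy E P R M"
    and moves: "\<And>a b. (a, b) \<in> M \<Longrightarrow> g a b \<noteq> b \<Longrightarrow> E\<inverse> `` {g a b} = {a} \<and> P a (g a b) b"
  shows "no_envy E P R ((\<lambda>(a, b). (a, g a b)) ` M)" (is "no_envy E P R ?M'")
proof (rule no_envyI)
  note matching = no_envy_matching[OF M]
  have edges: "(a, b) \<in> E" "(a, g a b) \<in> E" if "(a, b) \<in> M" for a b
    using that moves[OF that] matching_in_subset[OF matching] by (cases "g a b = b", auto)+
  have only_neighbour: "a' = a" if "(a, b) \<in> M" "g a b \<noteq> b" "(a', g a b) \<in> E" for a a' b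
    using moves[OF that(1,2)] that(3) by blast
  have same_agent: "a = a'" if pairs: "(a, b) \<in> M" "(a', b') \<in> M" "g a b = g a' b'" for a a' b b'
  proof (cases "g a b = b \<and> g a' b' = b'")
    case True
    then show ?thesis
      using matching_in_unique_fst[OF matching] pairs by metis
  next
    case False
    then show ?thesis
      using only_neighbour edges(2) pairs by metis
  qed
  show "matching_in E ?M'"
    unfolding matching_in_iff
    using edges(2) same_agent by (auto dest: matching_in_unique_snd[OF matching])
  fix a a' c
  assume "(a', c) \<in> ?M'" and envy: "(a, c) \<in> E" "R c a a'"
  then obtain b where old: "(a', b) \<in> M" "c = g a' b"
    by auto
  moreover have "c = b"
    using only_neighbour[OF old(1)] envy R_irrefl old(2) by metis
  ultimately obtain d where satisfied: "(a, d) \<in> M" "\<not> P a c d"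
    using no_envyE[OF M _ envy] by metis
  then have "\<not> P a c (g a d)"
    using P_trans[of a c "g a d" d] moves[OF satisfied(1)] edges[OF satisfied(1)] envy(1) by metis
  with satisfied(1) show "\<exists>b'\<in>?M' `` {a}. \<not> P a c b'"
    by force
qed

end

locale private_resource_reduction = agent_reduction +
  assumes private_resource_kept: "(a, b) \<in> E \<Longrightarrow> b \<notin> KB \<Longrightarrow>
    \<exists>b'\<in>KB. E\<inverse> `` {b'} = {a} \<and> P a b' b"
begin

lemma no_envy_reduce:
  assumes M: "no_envy E P R M" and Q: "Q \<subseteq> snd ` M" "Q \<subseteq> KB"
  obtains M' where "no_envy (E \<inter> KA \<times> KB) P R M'" "Q \<subseteq> snd ` M'" "card M' = card M"
proof -
  have edges: "M \<subseteq> E"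
    using matching_in_subset[OF no_envy_matching[OF M]] .
  have "\<exists>c\<in>KB. c \<noteq> b \<longrightarrow> b \<notin> KB \<and> E\<inverse> `` {c} = {a} \<and> P a c b" if "(a, b) \<in> M" for a b
    using private_resource_kept[of a b] that edges by blast
  then obtain g where moves: "\<And>a b. (a, b) \<in> M \<Longrightarrow> g a b \<in> KB"
    "\<And>a b. (a, b) \<in> M \<Longrightarrow> g a b \<noteq> b \<Longrightarrow> b \<notin> KB \<and> E\<inverse> `` {g a b} = {a} \<and> P a (g a b) b"
    by metis
  define M' where "M' = (\<lambda>(a, b). (a, g a b)) ` M"
  have M': "no_envy E P R M'"
    unfolding M'_def using M moves(2) by (intro no_envy_relocate) auto
  have "M' \<subseteq> KA \<times> KB"
    using no_envy_agents_kept[OF M] moves(1) by (auto simp: M'_def)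
  then have "no_envy (E \<inter> KA \<times> KB) P R M'"
    using M' matching_in_subset[OF no_envy_matching[OF M']] by (intro no_envy_restrict[OF M']) auto
  moreover have "Q \<subseteq> snd ` M'"
  proof
    fix b
    assume "b \<in> Q"
    then obtain a where matched: "(a, b) \<in> M"
      using Q(1) by auto
    then have "g a b = b"
      using moves(2) \<open>b \<in> Q\<close> Q(2) by blast
    with matched show "b \<in> snd ` M'"
      by (force simp: M'_def)
  qed
  moreover have "inj_on (\<lambda>(a, b). (a, g a b)) M"
    using matching_in_unique_snd[OF no_envy_matching[OF M]] by (auto simp: inj_on_def)
  then have "card M' = card M"
    by (simp add: M'_def card_image)
  ultimately show thesis
    by (rule that)
qed

end

section \<open>Relabelling vertices\<close>

locale relabelling =
  fixes f :: "'a \<Rightarrow> 'c" and g :: "'b \<Rightarrow> 'd" and A :: "'a set" and B :: "'b set"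
    and E :: "('a \<times> 'b) set"
    and P :: "'a \<Rightarrow> 'b \<Rightarrow> 'b \<Rightarrow> bool" and P' :: "'c \<Rightarrow> 'd \<Rightarrow> 'd \<Rightarrow> bool"
    and R :: "'b \<Rightarrow> 'a \<Rightarrow> 'a \<Rightarrow> bool" and R' :: "'d \<Rightarrow> 'c \<Rightarrow> 'c \<Rightarrow> bool"
  assumes inj_f: "inj_on f A" and inj_g: "inj_on g B" and edges_subset: "E \<subseteq> A \<times> B"
    and P_eq: "a \<in> A \<Longrightarrow> b \<in> B \<Longrightarrow> b' \<in> B \<Longrightarrow> P' (f a) (g b) (g b') \<longleftrightarrow> P a b b'"
    and R_eq: "b \<in> B \<Longrightarrow> a \<in> A \<Longrightarrow> a' \<in> A \<Longrightarrow> R' (g b) (f a) (f a') \<longleftrightarrow> R b a a'"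
begin

abbreviation relabel :: "'a \<times> 'b \<Rightarrow> 'c \<times> 'd" where
  "relabel \<equiv> map_prod f g"

lemma inj_on_relabel: "inj_on relabel (A \<times> B)"
  using inj_f inj_g by (rule map_prod_inj_on)

lemma Image_relabel: "M \<subseteq> A \<times> B \<Longrightarrow> a \<in> A \<Longrightarrow> (relabel ` M) `` {f a} = g ` (M `` {a})"
  using inj_f by (force dest: inj_onD)

lemma converse_Image_relabel:
  "M \<subseteq> A \<times> B \<Longrightarrow> b \<in> B \<Longrightarrow> (relabel ` M)\<inverse> `` {g b} = f ` (M\<inverse> `` {b})"
  using inj_g by (force dest: inj_onD)

lemma matching_in_relabel:
  assumes M: "M \<subseteq> A \<times> B"
  shows "matching_in (relabel ` E) (relabel ` M) \<longleftrightarrow> matching_in E M"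
proof -
  have inj: "inj_on relabel M" "inj_on f (fst ` M)" "inj_on g (snd ` M)"
    using M by (auto intro: inj_on_subset[OF inj_on_relabel]
        intro!: inj_on_subset[OF inj_f] inj_on_subset[OF inj_g])
  have "fst \<circ> relabel = f \<circ> fst" "snd \<circ> relabel = g \<circ> snd"
    by auto
  then have "inj_on (fst \<circ> relabel) M \<longleftrightarrow> inj_on fst M" "inj_on (snd \<circ> relabel) M \<longleftrightarrow> inj_on snd M"
    using inj(2,3) by (metis comp_inj_on inj_on_imageI2)+
  moreover have "relabel e \<in> relabel ` E \<longleftrightarrow> e \<in> E" if "e \<in> M" for e
    using M that by (intro inj_on_image_mem_iff[OF inj_on_relabel _ edges_subset]) auto
  then have "relabel ` M \<subseteq> relabel ` E \<longleftrightarrow> M \<subseteq> E"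
    unfolding image_subset_iff subset_iff[of M] Ball_def by simp
  ultimately show ?thesis
    by (simp add: matching_in_def comp_inj_on_iff[OF inj(1)])
qed

lemma blocks_relabel:
  assumes M: "M \<subseteq> A \<times> B" and vertices: "a \<in> A" "b \<in> B"
  shows "blocks (relabel ` E) P' R' (relabel ` M) (f a) (g b) \<longleftrightarrow> blocks E P R M a b"
proof -
  have "(f a, g b) \<in> relabel ` E - relabel ` M \<longleftrightarrow> (a, b) \<in> E - M"
    using inj_on_image_mem_iff[OF inj_on_relabel, of "(a, b)"] vertices M edges_subset by auto
  moreover have "(\<forall>b'\<in>M `` {a}. P' (f a) (g b) (g b')) \<longleftrightarrow> (\<forall>b'\<in>M `` {a}. P a b b')"
    using M P_eq[OF vertices] by blast
  moreover have "(\<forall>a'\<in>M\<inverse> `` {b}. R' (g b) (f a) (f a')) \<longleftrightarrow> (\<forall>a'\<in>M\<inverse> `` {b}. R b a a')"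
    using M R_eq[OF vertices(2,1)] by blast
  ultimately show ?thesis
    unfolding blocks_def Image_relabel[OF M vertices(1)] converse_Image_relabel[OF M vertices(2)]
    by (simp only: ball_simps)
qed

lemma stable_modulo_relabel:
  assumes M: "M \<subseteq> A \<times> B" and Q: "Q \<subseteq> B"
  shows "stable_modulo (relabel ` E) P' R' (g ` Q) (relabel ` M) \<longleftrightarrow> stable_modulo E P R Q M"
proof -
  have partner_in_Q: "(relabel ` M) `` {f a} \<inter> g ` Q \<noteq> {} \<longleftrightarrow> M `` {a} \<inter> Q \<noteq> {}"
    if "a \<in> A" for a
  proof -
    have "M `` {a} \<subseteq> B"
      using M by blast
    then show ?thesis
      using Q inj_on_image_Int[OF inj_g, of "M `` {a}" Q]
      by (simp add: Image_relabel[OF M that] flip: image_is_empty[of g "M `` {a} \<inter> Q"])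
  qed
  have blocks_edges: "(\<forall>a b. blocks E P R M a b \<longrightarrow> \<Phi> a b) \<longleftrightarrow>
      (\<forall>(a, b)\<in>E. blocks E P R M a b \<longrightarrow> \<Phi> a b)" for E P R M and \<Phi> :: "'x \<Rightarrow> 'y \<Rightarrow> bool"
    unfolding blocks_def by blast
  have "(\<forall>(x, y)\<in>relabel ` E. blocks (relabel ` E) P' R' (relabel ` M) x y \<longrightarrow>
      (relabel ` M) `` {x} \<inter> g ` Q \<noteq> {}) \<longleftrightarrow>
    (\<forall>(a, b)\<in>E. blocks E P R M a b \<longrightarrow> M `` {a} \<inter> Q \<noteq> {})"
    unfolding ball_simps
  proof (rule ball_cong[OF refl], clarify)
    fix a b
    assume "(a, b) \<in> E"
    then have "a \<in> A" "b \<in> B"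
      using edges_subset by auto
    then show "(case relabel (a, b) of (x, y) \<Rightarrow> blocks (relabel ` E) P' R' (relabel ` M) x y \<longrightarrow>
        (relabel ` M) `` {x} \<inter> g ` Q \<noteq> {}) \<longleftrightarrow> (blocks E P R M a b \<longrightarrow> M `` {a} \<inter> Q \<noteq> {})"
      using blocks_relabel[OF M] partner_in_Q by simp
  qed
  then show ?thesis
    unfolding stable_modulo_def matching_in_relabel[OF M] blocks_edges by simp
qed

lemma no_envy_relabel:
  assumes M: "M \<subseteq> A \<times> B"
  shows "no_envy (relabel ` E) P' R' (relabel ` M) \<longleftrightarrow> no_envy E P R M"
proof -
  have satisfied: "(\<exists>y\<in>(relabel ` M) `` {f a}. \<not> P' (f a) (g b) y) \<longleftrightarrow> (\<exists>b'\<in>M `` {a}. \<not> P a b b')"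
    if "a \<in> A" "b \<in> B" for a b
    using M P_eq[OF that] by (simp only: Image_relabel[OF M that(1)] bex_simps) blast
  have "(\<forall>x\<in>(relabel ` E)\<inverse> `` {g b}. R' (g b) x (f a') \<longrightarrow>
      (\<exists>y\<in>(relabel ` M) `` {x}. \<not> P' x (g b) y)) \<longleftrightarrow>
    (\<forall>a\<in>E\<inverse> `` {b}. R b a a' \<longrightarrow> (\<exists>b'\<in>M `` {a}. \<not> P a b b'))"
    if "a' \<in> A" "b \<in> B" for a' b
    unfolding converse_Image_relabel[OF edges_subset that(2)] ball_simps
  proof (rule ball_cong[OF refl])
    fix a
    assume "a \<in> E\<inverse> `` {b}"
    then have "a \<in> A"
      using edges_subset by blast
    then show "(R' (g b) (f a) (f a') \<longrightarrow> (\<exists>y\<in>(relabel ` M) `` {f a}. \<not> P' (f a) (g b) y)) \<longleftrightarrow>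
        (R b a a' \<longrightarrow> (\<exists>b'\<in>M `` {a}. \<not> P a b b'))"
      using that satisfied R_eq by simp
  qed
  then show ?thesis
    unfolding no_envy_def matching_in_relabel[OF M] using M by fastforce
qed

end

section \<open>Subinstances\<close>

lemma precedes_Nil [simp]: "\<not> precedes [] v w"
  by (simp add: precedes_def)

lemma precedes_Cons [simp]: "precedes (x # xs) v w \<longleftrightarrow> x = v \<and> w \<in> set xs \<or> precedes xs v w"
proof
  assume "precedes (x # xs) v w"
  then obtain i j where "i < j" "j < length (x # xs)" "(x # xs) ! i = v" "(x # xs) ! j = w"
    unfolding precedes_def by blast
  then show "x = v \<and> w \<in> set xs \<or> precedes xs v w"
    unfolding precedes_def by (cases i; cases j) auto
next
  assume "x = v \<and> w \<in> set xs \<or> precedes xs v w"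
  then consider (head) j where "j < length xs" "xs ! j = w" "x = v"
    | (tail) i j where "i < j" "j < length xs" "xs ! i = v" "xs ! j = w"
    by (auto simp: precedes_def in_set_conv_nth)
  then show "precedes (x # xs) v w"
  proof cases
    case head
    then show ?thesis
      unfolding precedes_def by (intro exI[of _ 0] exI[of _ "Suc j"]) auto
  next
    case tail
    then show ?thesis
      unfolding precedes_def by (intro exI[of _ "Suc i"] exI[of _ "Suc j"]) auto
  qed
qed

lemma precedes_mem: "precedes xs v w \<Longrightarrow> v \<in> set xs \<and> w \<in> set xs"
  by (induction xs) auto

lemma precedes_asym: "distinct xs \<Longrightarrow> precedes xs v w \<Longrightarrow> \<not> precedes xs w v"
  by (induction xs) (auto dest: precedes_mem)

lemma precedes_trans: "distinct xs \<Longrightarrow> precedes xs u v \<Longrightarrow> precedes xs v w \<Longrightarrow> precedes xs u w"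
  by (induction xs) (auto dest: precedes_mem)

lemma precedes_total:
  "v \<in> set xs \<Longrightarrow> w \<in> set xs \<Longrightarrow> v \<noteq> w \<Longrightarrow> precedes xs v w \<or> precedes xs w v"
  by (induction xs) auto

lemma precedes_strict_linear_order_on:
  assumes distinct: "A \<noteq> {} \<Longrightarrow> distinct xs" and sub: "A \<subseteq> set xs"
  shows "asymp_on A (precedes xs)" "transp_on A (precedes xs)" "totalp_on A (precedes xs)"
proof -
  show "asymp_on A (precedes xs)"
    using precedes_asym[OF distinct] by (intro asymp_onI) blast
  show "transp_on A (precedes xs)"
    using precedes_trans[OF distinct] by (intro transp_onI) blast
  show "totalp_on A (precedes xs)"
    using precedes_total sub by (intro totalp_onI) blast
qed

lemma precedes_map_filter:
  assumes "inj_on f K" "v \<in> K" "w \<in> K"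
  shows "precedes (map f (filter (\<lambda>x. x \<in> K) xs)) (f v) (f w) \<longleftrightarrow> precedes xs v w"
  using assms by (induction xs) (auto dest: inj_onD)

definition rank :: "nat set \<Rightarrow> nat \<Rightarrow> nat" where
  "rank K x = card {y \<in> K. y < x}"

lemma rank_0 [simp]: "rank K 0 = 0"
  by (simp add: rank_def)

lemma rank_Suc: "rank K (Suc x) = rank K x + of_bool (x \<in> K)"
proof -
  have "{y \<in> K. y < Suc x} = (if x \<in> K then insert x {y \<in> K. y < x} else {y \<in> K. y < x})"
    by (auto simp: less_Suc_eq)
  then show ?thesis
    by (simp add: rank_def)
qed

lemma rank_mono: "x \<le> y \<Longrightarrow> rank K x \<le> rank K y"
  unfolding rank_def by (intro card_mono) auto

lemma rank_strict_mono: "x \<in> K \<Longrightarrow> x < y \<Longrightarrow> rank K x < rank K y"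
  using rank_mono[of "Suc x" y K] by (simp add: rank_Suc)

lemma inj_on_rank: "inj_on (rank K) K"
  by (rule inj_onI) (metis nat_neq_iff rank_strict_mono)

lemma rank_eq_card: "K \<subseteq> {..<n} \<Longrightarrow> rank K n = card K"
  unfolding rank_def by (rule arg_cong[of _ _ card]) auto

lemma rank_image:
  assumes "K \<subseteq> {..<n}"
  shows "rank K ` K = {..<rank K n}"
proof (rule card_seteq)
  show "rank K ` K \<subseteq> {..<rank K n}"
    using assms by (auto intro: rank_strict_mono)
  show "card {..<rank K n} \<le> card (rank K ` K)"
    using rank_eq_card[OF assms] by (simp add: card_image inj_on_rank)
qed simp

lemma length_filter_upt: "length (filter (\<lambda>x. x \<in> K) [0..<n]) = rank K n"
  by (induction n) (auto simp: rank_Suc)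

lemma nth_filter_upt_rank: "x \<in> K \<Longrightarrow> x < n \<Longrightarrow> filter (\<lambda>x. x \<in> K) [0..<n] ! rank K x = x"
proof (induction n)
  case (Suc n)
  show ?case
  proof (cases "x < n")
    case True
    then have "rank K x < length (filter (\<lambda>x. x \<in> K) [0..<n])"
      using Suc.prems rank_strict_mono by (simp add: length_filter_upt)
    then show ?thesis
      using Suc True by (simp add: nth_append)
  next
    case False
    then have "x = n"
      using Suc.prems by simp
    then show ?thesis
      using Suc.prems by (simp add: nth_append length_filter_upt)
  qed
qed simp

definition sub_lists :: "nat \<Rightarrow> nat set \<Rightarrow> nat set \<Rightarrow> nat list list \<Rightarrow> nat list list" where
  "sub_lists n K L xss =
     map (\<lambda>x. map (rank L) (filter (\<lambda>y. y \<in> L) (xss ! x))) (filter (\<lambda>x. x \<in> K) [0..<n])"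

definition sub_instance :: "lq_instance \<Rightarrow> nat set \<Rightarrow> nat set \<Rightarrow> lq_instance" where
  "sub_instance G KA KB = \<lparr>
     apref = sub_lists (length (apref G)) KA KB (apref G),
     bpref = sub_lists (length (bpref G)) KB KA (bpref G),
     lq = map (\<lambda>b. lq G ! b) (filter (\<lambda>b. b \<in> KB) [0..<length (bpref G)])\<rparr>"

lemma length_sub_lists: "length (sub_lists n K L xss) = rank K n"
  by (simp add: sub_lists_def length_filter_upt)

lemma nth_sub_lists:
  assumes "x \<in> K" "x < n"
  shows "sub_lists n K L xss ! rank K x = map (rank L) (filter (\<lambda>y. y \<in> L) (xss ! x))"
  using assms rank_strict_mono[of x K n]
  by (simp add: sub_lists_def length_filter_upt nth_filter_upt_rank)

abbreviation agent_pref :: "lq_instance \<Rightarrow> nat \<Rightarrow> nat \<Rightarrow> nat \<Rightarrow> bool" where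
  "agent_pref G \<equiv> \<lambda>a. precedes (apref G ! a)"

abbreviation resource_pref :: "lq_instance \<Rightarrow> nat \<Rightarrow> nat \<Rightarrow> nat \<Rightarrow> bool" where
  "resource_pref G \<equiv> \<lambda>b. precedes (bpref G ! b)"

abbreviation lq_resources :: "lq_instance \<Rightarrow> nat set" where
  "lq_resources G \<equiv> {b. is_lq G b}"

lemma wf_instance_agent:
  assumes "wf_instance G" "a \<in> agents G"
  shows "distinct (apref G ! a)" "set (apref G ! a) \<subseteq> resources G"
  using assms unfolding wf_instance_def by blast+

lemma wf_instance_resource:
  assumes "wf_instance G" "b \<in> resources G"
  shows "distinct (bpref G ! b)" "set (bpref G ! b) \<subseteq> agents G"
  using assms unfolding wf_instance_def by blast+

lemma edges_wf:
  assumes "wf_instance G" "(a, b) \<in> edges G"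
  shows "a \<in> agents G" "b \<in> resources G" "b \<in> set (apref G ! a)" "a \<in> set (bpref G ! b)"
  using assms unfolding wf_instance_def edges_def by blast+

lemma preference_graph_instance:
  assumes wf: "wf_instance G"
  shows "preference_graph (edges G) (agent_pref G) (resource_pref G)"
proof
  have "edges G \<subseteq> agents G \<times> resources G"
    using edges_wf[OF wf] by auto
  then show "finite (edges G)"
    by (rule finite_subset) (simp add: agents_def resources_def)
next
  fix a
  have "edges G `` {a} \<subseteq> set (apref G ! a)" "edges G `` {a} \<noteq> {} \<Longrightarrow> distinct (apref G ! a)"
    using edges_wf[OF wf] wf_instance_agent[OF wf] by blast+
  then show "asymp_on (edges G `` {a}) (agent_pref G a)"
    "transp_on (edges G `` {a}) (agent_pref G a)"
    "totalp_on (edges G `` {a}) (agent_pref G a)"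
    by (simp_all add: precedes_strict_linear_order_on)
next
  fix b
  have "(edges G)\<inverse> `` {b} \<subseteq> set (bpref G ! b)" "(edges G)\<inverse> `` {b} \<noteq> {} \<Longrightarrow> distinct (bpref G ! b)"
    using edges_wf[OF wf] wf_instance_resource[OF wf] by blast+
  then show "asymp_on ((edges G)\<inverse> `` {b}) (resource_pref G b)"
    "transp_on ((edges G)\<inverse> `` {b}) (resource_pref G b)"
    "totalp_on ((edges G)\<inverse> `` {b}) (resource_pref G b)"
    by (simp_all add: precedes_strict_linear_order_on)
qed

lemma matching_iff_matching_in: "matching G M \<longleftrightarrow> matching_in (edges G) M"
  by (simp add: matching_def matching_in_iff)

lemma apartner_eq_Some_iff: "matching_in E M \<Longrightarrow> apartner M a = Some b \<longleftrightarrow> (a, b) \<in> M"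
  unfolding apartner_def by (auto intro: theI dest: matching_in_unique_snd intro!: the_equality)

lemma apartner_eq_None_iff: "apartner M a = None \<longleftrightarrow> M `` {a} = {}"
  by (auto simp: apartner_def)

lemma bpartner_eq_Some_iff: "matching_in E M \<Longrightarrow> bpartner M b = Some a \<longleftrightarrow> (a, b) \<in> M"
  unfolding bpartner_def by (auto intro: theI dest: matching_in_unique_fst intro!: the_equality)

lemma bpartner_eq_None_iff: "bpartner M b = None \<longleftrightarrow> M\<inverse> `` {b} = {}"
  by (auto simp: bpartner_def)

lemma precedes_opt_apartner:
  assumes M: "matching_in (edges G) M" and edge: "(a, b) \<in> edges G"
  shows "precedes_opt (apref G ! a) b (apartner M a) \<longleftrightarrow> (\<forall>b'\<in>M `` {a}. agent_pref G a b b')"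
proof (cases "apartner M a")
  case None
  then have "M `` {a} = {}"
    by (simp add: apartner_eq_None_iff)
  with None edge show ?thesis
    by (simp add: edges_def)
next
  case (Some b')
  then have "M `` {a} = {b'}"
    using M by (auto simp: apartner_eq_Some_iff[OF M] dest: matching_in_unique_snd)
  with Some show ?thesis
    by simp
qed

lemma precedes_opt_bpartner:
  assumes wf: "wf_instance G" and M: "matching_in (edges G) M" and edge: "(a, b) \<in> edges G"
  shows "precedes_opt (bpref G ! b) a (bpartner M b) \<longleftrightarrow> (\<forall>a'\<in>M\<inverse> `` {b}. resource_pref G b a a')"
proof (cases "bpartner M b")
  case None
  then have "M\<inverse> `` {b} = {}"
    by (simp add: bpartner_eq_None_iff)
  with None edges_wf(4)[OF wf edge] show ?thesis
    by simp
next
  case (Some a')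
  then have "M\<inverse> `` {b} = {a'}"
    using M by (auto simp: bpartner_eq_Some_iff[OF M] dest: matching_in_unique_fst)
  with Some show ?thesis
    by simp
qed

lemma blocking_pair_iff:
  assumes "wf_instance G" "matching_in (edges G) M"
  shows "blocking_pair G M a b \<longleftrightarrow> blocks (edges G) (agent_pref G) (resource_pref G) M a b"
  using precedes_opt_apartner[OF assms(2)] precedes_opt_bpartner[OF assms]
  unfolding blocking_pair_def blocks_def by blast

lemma stable_iff:
  "wf_instance G \<Longrightarrow> stable G M \<longleftrightarrow> stable_modulo (edges G) (agent_pref G) (resource_pref G) {} M"
  unfolding stable_def stable_modulo_def matching_iff_matching_in using blocking_pair_iff by auto

lemma relaxed_stable_iff:
  assumes wf: "wf_instance G"
  shows "relaxed_stable G M \<longleftrightarrow>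
    stable_modulo (edges G) (agent_pref G) (resource_pref G) (lq_resources G) M"
proof (cases "matching_in (edges G) M")
  case True
  then have "(\<exists>b. apartner M a = Some b \<and> is_lq G b) \<longleftrightarrow> M `` {a} \<inter> lq_resources G \<noteq> {}" for a
    by (auto simp: apartner_eq_Some_iff)
  with True show ?thesis
    by (simp add: relaxed_stable_def stable_modulo_def matching_iff_matching_in
        blocking_pair_iff[OF wf])
qed (simp add: relaxed_stable_def stable_modulo_def matching_iff_matching_in)

lemma envy_free_iff:
  "envy_free G M \<longleftrightarrow> no_envy (edges G) (agent_pref G) (resource_pref G) M"
proof (cases "matching_in (edges G) M")
  case True
  then have "(\<forall>a a'. \<not> envies G M a a') \<longleftrightarrow>
    (\<forall>(a', b)\<in>M. \<forall>a\<in>(edges G)\<inverse> `` {b}. resource_pref G b a a' \<longrightarrow>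
      (\<exists>b'\<in>M `` {a}. \<not> agent_pref G a b b'))"
    unfolding envies_def apartner_eq_Some_iff[OF True]
    using precedes_opt_apartner[OF True] by blast
  with True show ?thesis
    by (simp add: envy_free_def no_envy_def matching_iff_matching_in)
qed (simp add: envy_free_def no_envy_def matching_iff_matching_in)

lemma feasible_iff: "feasible G M \<longleftrightarrow> lq_resources G \<subseteq> snd ` M"
  unfolding feasible_def bpartner_eq_None_iff by force

lemma stable_size_eq:
  assumes wf: "wf_instance G" and M: "stable G M"
  shows "stable_size G = card M"
proof -
  interpret preference_graph "edges G" "agent_pref G" "resource_pref G"
    using wf by (rule preference_graph_instance)
  show ?thesis
    unfolding stable_size_def
    using stable_card_eq M unfolding stable_iff[OF wf] by blast
qed

lemma matching_card_le:
  assumes wf: "wf_instance G" and N: "matching G N"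
  shows "card N \<le> 2 * stable_size G"
proof -
  interpret preference_graph "edges G" "agent_pref G" "resource_pref G"
    using wf by (rule preference_graph_instance)
  obtain M where M: "stable_modulo (edges G) (agent_pref G) (resource_pref G) {} M"
    using ex_stable by blast
  then have "stable_size G = card M"
    by (simp add: stable_size_eq[OF wf] stable_iff[OF wf])
  then show ?thesis
    using matching_card_le_double_stable[OF M] N by (simp add: matching_iff_matching_in)
qed

locale subinstance =
  fixes G :: lq_instance and KA KB :: "nat set"
  assumes wf: "wf_instance G" and KA: "KA \<subseteq> agents G" and KB: "KB \<subseteq> resources G"
begin

abbreviation G' :: lq_instance where
  "G' \<equiv> sub_instance G KA KB"

lemma length_sub_instance: "length (apref G') = rank KA (length (apref G))"
  "length (bpref G') = rank KB (length (bpref G))" "length (lq G') = rank KB (length (bpref G))"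
  by (simp_all add: sub_instance_def length_sub_lists length_filter_upt)

lemma agents_sub: "agents G' = rank KA ` KA"
  using KA rank_image[of KA "length (apref G)"] by (simp add: agents_def length_sub_instance)

lemma resources_sub: "resources G' = rank KB ` KB"
  using KB rank_image[of KB "length (bpref G)"] by (simp add: resources_def length_sub_instance)

lemma apref_sub:
  "a \<in> KA \<Longrightarrow> apref G' ! rank KA a = map (rank KB) (filter (\<lambda>b. b \<in> KB) (apref G ! a))"
  using KA by (auto simp: sub_instance_def nth_sub_lists agents_def)

lemma bpref_sub:
  "b \<in> KB \<Longrightarrow> bpref G' ! rank KB b = map (rank KA) (filter (\<lambda>a. a \<in> KA) (bpref G ! b))"
  using KB by (auto simp: sub_instance_def nth_sub_lists resources_def)

lemma rank_mem_iff:
  "x \<in> K \<Longrightarrow> rank K x \<in> set (map (rank K) (filter (\<lambda>y. y \<in> K) xs)) \<longleftrightarrow> x \<in> set xs"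
  using inj_on_rank[of K] by (auto dest: inj_onD)

lemma distinct_map_rank: "distinct xs \<Longrightarrow> distinct (map (rank K) (filter (\<lambda>y. y \<in> K) xs))"
  by (auto simp: distinct_map intro: inj_on_subset[OF inj_on_rank])

lemma wf_sub: "wf_instance G'"
  unfolding wf_instance_def
proof (intro conjI ballI)
  show "length (lq G') = length (bpref G')"
    by (simp add: length_sub_instance)
  show "distinct (apref G' ! x)" "set (apref G' ! x) \<subseteq> resources G'" if "x \<in> agents G'" for x
    using that wf_instance_agent(1)[OF wf subsetD[OF KA]]
    by (auto simp: agents_sub apref_sub resources_sub intro!: distinct_map_rank)
  show "distinct (bpref G' ! x)" "set (bpref G' ! x) \<subseteq> agents G'" if "x \<in> resources G'" for x
    using that wf_instance_resource(1)[OF wf subsetD[OF KB]]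
    by (auto simp: agents_sub bpref_sub resources_sub intro!: distinct_map_rank)
  fix x y
  assume "x \<in> agents G'" "y \<in> resources G'"
  then obtain a b where agent: "x = rank KA a" "a \<in> KA" and resource: "y = rank KB b" "b \<in> KB"
    by (auto simp: agents_sub resources_sub)
  then have "b \<in> set (apref G ! a) \<longleftrightarrow> a \<in> set (bpref G ! b)"
    using wf KA KB unfolding wf_instance_def by blast
  then show "y \<in> set (apref G' ! x) \<longleftrightarrow> x \<in> set (bpref G' ! y)"
    unfolding agent(1) resource(1) apref_sub[OF agent(2)] bpref_sub[OF resource(2)]
      rank_mem_iff[OF agent(2)] rank_mem_iff[OF resource(2)] .
qed

sublocale relabelling "rank KA" "rank KB" KA KB "edges G \<inter> KA \<times> KB"
    "agent_pref G" "agent_pref G'" "resource_pref G" "resource_pref G'"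
proof
  show "agent_pref G' (rank KA a) (rank KB b) (rank KB b') \<longleftrightarrow> agent_pref G a b b'"
    if "a \<in> KA" "b \<in> KB" "b' \<in> KB" for a b b'
    using that inj_on_rank by (simp add: apref_sub precedes_map_filter)
  show "resource_pref G' (rank KB b) (rank KA a) (rank KA a') \<longleftrightarrow> resource_pref G b a a'"
    if "b \<in> KB" "a \<in> KA" "a' \<in> KA" for a a' b
    using that inj_on_rank by (simp add: bpref_sub precedes_map_filter)
qed (auto intro: inj_on_rank)

lemma edges_sub: "edges G' = relabel ` (edges G \<inter> KA \<times> KB)"
proof -
  have "edges G' = {(rank KA a, rank KB b) |a b. a \<in> KA \<and> b \<in> KB \<and> b \<in> set (apref G ! a)}"
    unfolding edges_def agents_sub by (auto simp: apref_sub) (use apref_sub in fastforce)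
  then show ?thesis
    using KA by (force simp: edges_def)
qed

lemma lq_sub: "lq_resources G' = rank KB ` (lq_resources G \<inter> KB)"
proof -
  have "lq G' ! rank KB b = lq G ! b" if "b \<in> KB" for b
  proof -
    have "rank KB b < rank KB (length (bpref G))"
      using that KB by (auto simp: resources_def intro: rank_strict_mono)
    then show ?thesis
      using that KB nth_filter_upt_rank[of b KB "length (bpref G)"]
      by (auto simp: sub_instance_def length_filter_upt resources_def)
  qed
  then show ?thesis
    using KB unfolding is_lq_def resources_sub by auto
qed

lemma card_relabel: "M \<subseteq> KA \<times> KB \<Longrightarrow> card (relabel ` M) = card M"
  by (intro card_image inj_on_subset[OF inj_on_relabel])

lemma feasible_sub:
  assumes M: "M \<subseteq> KA \<times> KB" and lq: "lq_resources G \<subseteq> KB"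
  shows "feasible G' (relabel ` M) \<longleftrightarrow> feasible G M"
proof -
  have "snd ` relabel ` M = rank KB ` snd ` M"
    by force
  moreover have "rank KB b \<in> rank KB ` snd ` M \<longleftrightarrow> b \<in> snd ` M" if "b \<in> lq_resources G" for b
    using that M lq by (intro inj_on_image_mem_iff[OF inj_on_rank]) auto
  ultimately show ?thesis
    using lq by (simp add: feasible_iff lq_sub Int_absorb2 subset_eq)
qed

lemma relaxed_stable_sub:
  assumes "M \<subseteq> KA \<times> KB" "lq_resources G \<subseteq> KB"
  shows "relaxed_stable G' (relabel ` M) \<longleftrightarrow>
    stable_modulo (edges G \<inter> KA \<times> KB) (agent_pref G) (resource_pref G) (lq_resources G) M"
  using stable_modulo_relabel[OF assms] assms(2)
  unfolding relaxed_stable_iff[OF wf_sub] edges_sub lq_sub by (simp add: Int_absorb2)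

lemma stable_sub:
  assumes "M \<subseteq> KA \<times> KB"
  shows "stable G' (relabel ` M) \<longleftrightarrow>
    stable_modulo (edges G \<inter> KA \<times> KB) (agent_pref G) (resource_pref G) {} M"
  using stable_modulo_relabel[OF assms, of "{}"]
  unfolding stable_iff[OF wf_sub] edges_sub by simp

lemma envy_free_sub:
  assumes "M \<subseteq> KA \<times> KB"
  shows "envy_free G' (relabel ` M) \<longleftrightarrow>
    no_envy (edges G \<inter> KA \<times> KB) (agent_pref G) (resource_pref G) M"
  using no_envy_relabel[OF assms] unfolding envy_free_iff edges_sub .

lemma ex_matching_sub_iff:
  assumes "\<And>M'. \<Phi> M' \<Longrightarrow> matching G' M'"
  shows "(\<exists>M'. \<Phi> M') \<longleftrightarrow> (\<exists>M\<subseteq>edges G \<inter> KA \<times> KB. \<Phi> (relabel ` M))"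
  using assms unfolding matching_def edges_sub by (metis subset_imageE)

lemma
  assumes reduction: "two_sided_reduction (edges G) (agent_pref G) (resource_pref G) XA KA XB KB"
    and lq: "lq_resources G \<subseteq> KB"
  shows maxrsm_yes_sub_iff: "(G', k) \<in> maxrsm_yes \<longleftrightarrow> (G, k) \<in> maxrsm_yes"
    and stable_feasible_sub_iff:
      "(\<exists>M'. stable G' M' \<and> feasible G' M') \<longleftrightarrow> (\<exists>M. stable G M \<and> feasible G M)"
proof -
  interpret two_sided_reduction "edges G" "agent_pref G" "resource_pref G" XA KA XB KB
    by (rule reduction)
  have kept: "M \<subseteq> edges G \<inter> KA \<times> KB" if "relaxed_stable G M \<or> stable G M" for M
    using that stable_modulo_kept matching_in_subset stable_modulo_matching lq
    unfolding relaxed_stable_iff[OF wf] stable_iff[OF wf] by (metis empty_subsetI le_inf_iff)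
  have sub: "stable G' (relabel ` M) \<longleftrightarrow> stable G M"
    "relaxed_stable G' (relabel ` M) \<longleftrightarrow> relaxed_stable G M"
    "feasible G' (relabel ` M) \<longleftrightarrow> feasible G M" "card (relabel ` M) = card M"
    if "M \<subseteq> edges G \<inter> KA \<times> KB" for M
    using that lq stable_modulo_reduced_iff
    by (simp_all add: stable_sub relaxed_stable_sub feasible_sub card_relabel stable_iff[OF wf]
        relaxed_stable_iff[OF wf])
  have "(\<exists>M'. feasible G' M' \<and> relaxed_stable G' M' \<and> card M' = k) \<longleftrightarrow>
      (\<exists>M\<subseteq>edges G \<inter> KA \<times> KB.
        feasible G' (relabel ` M) \<and> relaxed_stable G' (relabel ` M) \<and> card (relabel ` M) = k)"
    by (rule ex_matching_sub_iff) (simp add: relaxed_stable_def)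
  also have "\<dots> \<longleftrightarrow>
      (\<exists>M\<subseteq>edges G \<inter> KA \<times> KB. feasible G M \<and> relaxed_stable G M \<and> card M = k)"
    by (simp add: sub cong: conj_cong)
  finally show "(G', k) \<in> maxrsm_yes \<longleftrightarrow> (G, k) \<in> maxrsm_yes"
    unfolding maxrsm_yes_def mem_Collect_eq prod.case using kept by metis
  have "(\<exists>M'. stable G' M' \<and> feasible G' M') \<longleftrightarrow>
      (\<exists>M\<subseteq>edges G \<inter> KA \<times> KB. stable G' (relabel ` M) \<and> feasible G' (relabel ` M))"
    by (rule ex_matching_sub_iff) (simp add: stable_def)
  also have "\<dots> \<longleftrightarrow> (\<exists>M\<subseteq>edges G \<inter> KA \<times> KB. stable G M \<and> feasible G M)"
    by (simp add: sub cong: conj_cong)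
  finally show "(\<exists>M'. stable G' M' \<and> feasible G' M') \<longleftrightarrow> (\<exists>M. stable G M \<and> feasible G M)"
    using kept by metis
qed

lemma maxefm_yes_sub_iff:
  assumes reduction:
      "private_resource_reduction (edges G) (agent_pref G) (resource_pref G) XA KA XB KB"
    and lq: "lq_resources G \<subseteq> KB"
  shows "(G', k) \<in> maxefm_yes \<longleftrightarrow> (G, k) \<in> maxefm_yes"
proof -
  interpret private_resource_reduction "edges G" "agent_pref G" "resource_pref G" XA KA XB KB
    by (rule reduction)
  let ?sol = "\<lambda>E M. no_envy E (agent_pref G) (resource_pref G) M \<and>
    lq_resources G \<subseteq> snd ` M \<and> card M = k"
  have "(\<exists>M'. feasible G' M' \<and> envy_free G' M' \<and> card M' = k) \<longleftrightarrow>
      (\<exists>M\<subseteq>edges G \<inter> KA \<times> KB.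
        feasible G' (relabel ` M) \<and> envy_free G' (relabel ` M) \<and> card (relabel ` M) = k)"
    by (rule ex_matching_sub_iff) (simp add: envy_free_def)
  also have "\<dots> \<longleftrightarrow> (\<exists>M\<subseteq>edges G \<inter> KA \<times> KB. ?sol (edges G \<inter> KA \<times> KB) M)"
    using lq by (intro ex_cong)
      (simp add: feasible_sub envy_free_sub card_relabel feasible_iff[of G] conj_ac)
  also have "\<dots> \<longleftrightarrow> (\<exists>M. ?sol (edges G) M)"
  proof
    assume "\<exists>M\<subseteq>edges G \<inter> KA \<times> KB. ?sol (edges G \<inter> KA \<times> KB) M"
    then show "\<exists>M. ?sol (edges G) M"
      using no_envy_extend by blast
  next
    assume "\<exists>M. ?sol (edges G) M"
    then obtain M where "?sol (edges G) M"
      by blast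
    then obtain M' where M': "?sol (edges G \<inter> KA \<times> KB) M'"
      using no_envy_reduce[of M "lq_resources G"] lq by metis
    then have "M' \<subseteq> edges G \<inter> KA \<times> KB"
      by (elim conjE) (rule matching_in_subset[OF no_envy_matching])
    with M' show "\<exists>M\<subseteq>edges G \<inter> KA \<times> KB. ?sol (edges G \<inter> KA \<times> KB) M"
      by blast
  qed
  finally show ?thesis
    by (simp add: maxefm_yes_def feasible_iff[of G] envy_free_iff[of G] conj_ac)
qed

end

section \<open>The kernel\<close>

lemma precedes_append: "x \<in> set us \<Longrightarrow> y \<in> set vs \<Longrightarrow> precedes (us @ vs) x y"
  by (induction us) auto

lemma precedes_filter: "precedes (filter p xs) v w \<Longrightarrow> precedes xs v w"
  by (induction xs) (auto split: if_splits)

lemma precedes_map_iff: "inj f \<Longrightarrow> precedes (map f xs) (f v) (f w) \<longleftrightarrow> precedes xs v w"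
  by (induction xs) (auto simp: inj_eq)

lemma not_in_take_filter:
  assumes "distinct xs" "y \<in> set xs" "p y" "y \<notin> set (take C (filter p xs))"
  shows "card (set (take C (filter p xs))) = C"
    and "x \<in> set (take C (filter p xs)) \<Longrightarrow> precedes xs x y"
proof -
  let ?ys = "filter p xs"
  have "y \<in> set ?ys"
    using assms by simp
  then have dropped: "y \<in> set (drop C ?ys)"
    using assms(4) by (metis UnE append_take_drop_id set_append)
  then have "C \<le> length ?ys"
    by (metis drop_all empty_iff linorder_le_cases list.set(1))
  then show "card (set (take C ?ys)) = C"
    using assms(1) by (simp add: distinct_card)
  show "precedes xs x y" if "x \<in> set (take C ?ys)"
    using precedes_append[OF that dropped] precedes_filter[of p] by simp
qed

text \<open>
  Agent \<open>a\<close> is the vertex \<open>a\<close> and resource \<open>b\<close> is the vertex \<open>num_agents G + b\<close>.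
\<close>

definition num_agents :: "lq_instance \<Rightarrow> nat" where
  "num_agents G = length (apref G)"

definition num_vertices :: "lq_instance \<Rightarrow> nat" where
  "num_vertices G = num_agents G + length (bpref G)"

definition neighbours :: "lq_instance \<Rightarrow> nat \<Rightarrow> nat list" where
  "neighbours G v = (if v < num_agents G then map ((+) (num_agents G)) (apref G ! v)
     else bpref G ! (v - num_agents G))"

definition edge_vertices :: "lq_instance \<Rightarrow> nat \<times> nat \<Rightarrow> nat set" where
  "edge_vertices G = (\<lambda>(a, b). {a, num_agents G + b})"

definition lq_vertices :: "lq_instance \<Rightarrow> nat set" where
  "lq_vertices G = (+) (num_agents G) ` lq_resources G"

definition agents_of :: "lq_instance \<Rightarrow> nat set \<Rightarrow> nat set" where
  "agents_of G K = {a. a < num_agents G \<and> a \<in> K}"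

definition resources_of :: "lq_instance \<Rightarrow> nat set \<Rightarrow> nat set" where
  "resources_of G K = {b. num_agents G + b \<in> K}"

lemma finite_resources_of: "finite K \<Longrightarrow> finite (resources_of G K)"
  using finite_vimageI[of K "(+) (num_agents G)"] by (simp add: resources_of_def vimage_def)

definition induced_instance :: "lq_instance \<Rightarrow> nat set \<Rightarrow> lq_instance" where
  "induced_instance G K = sub_instance G (agents_of G K) (resources_of G K)"

definition greedy_step :: "lq_instance \<Rightarrow> nat \<times> nat \<Rightarrow> nat set \<Rightarrow> nat set" where
  "greedy_step G e X = (if edge_vertices G e \<inter> X = {} then edge_vertices G e \<union> X else X)"

definition greedy_cover :: "lq_instance \<Rightarrow> (nat \<times> nat) list \<Rightarrow> nat set" where
  "greedy_cover G es = fold (greedy_step G) es (lq_vertices G)"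

definition edge_list :: "lq_instance \<Rightarrow> nat \<Rightarrow> (nat \<times> nat) list" where
  "edge_list G i = concat (map (\<lambda>a. map (Pair a) (apref G ! a)) [0..<i])"

definition cover_vertices :: "lq_instance \<Rightarrow> nat set" where
  "cover_vertices G = greedy_cover G (edge_list G (num_agents G))"

text \<open>The vertices in \<open>X\<close> are the cover, those in \<open>S\<close> do not count towards the quota \<open>C\<close>.\<close>

definition marked :: "nat set \<Rightarrow> nat set \<Rightarrow> nat \<Rightarrow> nat list \<Rightarrow> nat set" where
  "marked X S C us = {u \<in> set us. u \<notin> X \<and> u \<in> S} \<union> set (take C (filter (\<lambda>u. u \<notin> X \<and> u \<notin> S) us))"

definition kept :: "lq_instance \<Rightarrow> nat set \<Rightarrow> nat set \<Rightarrow> nat set" where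
  "kept G S X = X \<union> (\<Union>v\<in>X. marked X S (card X + 1) (neighbours G v))"

text \<open>
  Those outside the cover have two neighbours in it, so there are at most quadratically many in the
  size of the cover times \<open>max_common G\<close>.
\<close>

definition shared_resources :: "lq_instance \<Rightarrow> nat set" where
  "shared_resources G = {u. num_agents G \<le> u \<and> 1 < length (neighbours G u)}"

definition kernel_vertices :: "(lq_instance \<Rightarrow> nat set) \<Rightarrow> lq_instance \<Rightarrow> nat set" where
  "kernel_vertices S G = kept G (S G) (cover_vertices G)"

text \<open>No matching has more than \<open>num_agents H\<close> edges, so larger \<open>k\<close> need not be distinguished.\<close>

definition kernelize :: "(lq_instance \<Rightarrow> nat set) \<Rightarrow> lq_instance \<times> nat \<Rightarrow> lq_instance \<times> nat" where
  "kernelize S = (\<lambda>(G, k). let H = induced_instance G (kernel_vertices S G)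
     in (H, min k (Suc (num_agents H))))"

lemma edges_bounds: "wf_instance G \<Longrightarrow> (a, b) \<in> edges G \<Longrightarrow> a < num_agents G \<and> b < length (bpref G)"
  using edges_wf[of G a b] by (simp add: agents_def resources_def num_agents_def)

lemma mem_neighbours_agent:
  "a < num_agents G \<Longrightarrow> num_agents G + b \<in> set (neighbours G a) \<longleftrightarrow> (a, b) \<in> edges G"
  by (auto simp: edges_def neighbours_def agents_def num_agents_def)

lemma mem_neighbours_resource:
  assumes "wf_instance G" "b < length (bpref G)"
  shows "a \<in> set (neighbours G (num_agents G + b)) \<longleftrightarrow> (a, b) \<in> edges G"
  using assms edges_wf[OF assms(1), of a b]
  unfolding wf_instance_def edges_def neighbours_def resources_def by auto blast+

lemma vertex_cases:
  assumes "v < num_vertices G"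
  obtains
    (agent) "v < num_agents G" "v \<in> agents G"
      "neighbours G v = map ((+) (num_agents G)) (apref G ! v)"
  | (resource) b where "v = num_agents G + b" "b \<in> resources G" "neighbours G v = bpref G ! b"
proof (cases "v < num_agents G")
  case False
  then have "v = num_agents G + (v - num_agents G)" "v - num_agents G \<in> resources G"
    using assms by (auto simp: num_vertices_def resources_def)
  with resource[of "v - num_agents G"] show thesis
    by (simp add: neighbours_def)
qed (use agent in \<open>simp add: neighbours_def agents_def num_agents_def\<close>)

lemma neighbours_wf:
  assumes wf: "wf_instance G" and vertex: "v < num_vertices G"
  shows "distinct (neighbours G v)" "set (neighbours G v) \<subseteq> {..<num_vertices G}"
    and "v < num_agents G \<Longrightarrow> u \<in> set (neighbours G v) \<Longrightarrow> num_agents G \<le> u"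
    and "num_agents G \<le> v \<Longrightarrow> u \<in> set (neighbours G v) \<Longrightarrow> u < num_agents G"
  using vertex wf_instance_agent[OF wf, of v] wf_instance_resource[OF wf, of "v - num_agents G"]
  by (cases rule: vertex_cases,
      auto simp: distinct_map num_vertices_def num_agents_def agents_def resources_def)+

lemma greedy_cover_snoc: "greedy_cover G (es @ [e]) = greedy_step G e (greedy_cover G es)"
  by (simp add: greedy_cover_def)

lemma set_edge_list: "set (edge_list G (num_agents G)) = edges G"
  by (auto simp: edge_list_def edges_def agents_def num_agents_def)

lemma matching_insert:
  assumes "matching G M" "(a, b) \<in> edges G" "a \<notin> fst ` M" "b \<notin> snd ` M"
  shows "matching G (insert (a, b) M)"
  using assms unfolding matching_iff_matching_in matching_in_def
  by (auto simp: inj_on_def image_iff)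

lemma greedy_cover_matching:
  assumes "set es \<subseteq> edges G"
  shows "\<exists>M. matching G M \<and> greedy_cover G es = lq_vertices G \<union> (\<Union>e\<in>M. edge_vertices G e)"
  using assms
proof (induction es rule: rev_induct)
  case Nil
  show ?case
    by (rule exI[of _ "{}"]) (simp add: matching_def greedy_cover_def)
next
  case (snoc e es)
  then obtain M where M: "matching G M"
    and cover: "greedy_cover G es = lq_vertices G \<union> (\<Union>e\<in>M. edge_vertices G e)"
    by auto
  obtain a b where edge: "e = (a, b)" "(a, b) \<in> edges G"
    using snoc.prems by (cases e) auto
  show ?case
  proof (cases "edge_vertices G e \<inter> greedy_cover G es = {}")
    case True
    then have "a \<notin> fst ` M" "b \<notin> snd ` M"
      by (auto simp: cover edge edge_vertices_def)
    then have "matching G (insert e M)"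
      using matching_insert[OF M] edge by blast
    moreover have "greedy_cover G (es @ [e]) = lq_vertices G \<union> (\<Union>e\<in>insert e M. edge_vertices G e)"
      using True by (auto simp: greedy_cover_snoc greedy_step_def cover)
    ultimately show ?thesis
      by blast
  qed (use M cover in \<open>auto simp: greedy_cover_snoc greedy_step_def\<close>)
qed

lemma greedy_cover_covers:
  "e \<in> set es \<Longrightarrow> edge_vertices G e \<inter> greedy_cover G es \<noteq> {}"
proof (induction es rule: rev_induct)
  case (snoc e' es)
  have "edge_vertices G e' \<noteq> {}"
    by (auto simp: edge_vertices_def split: prod.splits)
  with snoc show ?case
    by (auto simp: greedy_cover_snoc greedy_step_def)
qed simp

lemma cover_vertices_covers:
  "(a, b) \<in> edges G \<Longrightarrow> a \<in> cover_vertices G \<or> num_agents G + b \<in> cover_vertices G"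
  using greedy_cover_covers[of "(a, b)" "edge_list G (num_agents G)" G]
  by (auto simp: cover_vertices_def set_edge_list edge_vertices_def)

lemma cover_vertices_matching:
  obtains M where "matching G M" "cover_vertices G = lq_vertices G \<union> (\<Union>e\<in>M. edge_vertices G e)"
  using greedy_cover_matching[of "edge_list G (num_agents G)" G]
  by (auto simp: cover_vertices_def set_edge_list)

lemma cover_vertices_subset:
  assumes "wf_instance G"
  shows "cover_vertices G \<subseteq> {..<num_vertices G}"
proof -
  obtain M where "matching G M"
    "cover_vertices G = lq_vertices G \<union> (\<Union>e\<in>M. edge_vertices G e)"
    by (rule cover_vertices_matching)
  moreover have "edge_vertices G e \<subseteq> {..<num_vertices G}" if "e \<in> edges G" for e
    using that by (auto dest!: edges_bounds[OF assms] simp: edge_vertices_def num_vertices_def)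
  moreover have "lq_vertices G \<subseteq> {..<num_vertices G}"
    by (auto simp: lq_vertices_def is_lq_def resources_def num_vertices_def)
  ultimately show ?thesis
    unfolding matching_def by blast
qed

lemma lq_vertices_subset_cover: "lq_vertices G \<subseteq> cover_vertices G"
  by (rule cover_vertices_matching[of G]) auto

lemma card_cover_vertices_le:
  assumes wf: "wf_instance G" and feasible: "matching G M" "feasible G M"
  shows "card (cover_vertices G) \<le> 6 * stable_size G"
proof -
  obtain N where N: "matching G N"
    and cover: "cover_vertices G = lq_vertices G \<union> (\<Union>e\<in>N. edge_vertices G e)"
    by (rule cover_vertices_matching)
  have finite: "finite M'" if "matching G M'" for M'
    using that preference_graph.finite_matching[OF preference_graph_instance[OF wf]]
    by (simp add: matching_iff_matching_in)
  have "lq_vertices G \<subseteq> (+) (num_agents G) ` snd ` M"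
    using feasible(2) by (auto simp: lq_vertices_def feasible_iff)
  then have "card (lq_vertices G) \<le> card M"
    using finite[OF feasible(1)] by (simp add: image_image surj_card_le)
  also have "card M \<le> 2 * stable_size G"
    using wf feasible(1) by (rule matching_card_le)
  finally have lq: "card (lq_vertices G) \<le> 2 * stable_size G" .
  have "card (edge_vertices G e) \<le> 2" for e
    by (auto simp: edge_vertices_def card_insert_if split: prod.splits)
  then have "card (\<Union>e\<in>N. edge_vertices G e) \<le> card N * 2"
    using card_UN_le[OF finite[OF N], of "edge_vertices G"]
      sum_bounded_above[of N "\<lambda>e. card (edge_vertices G e)" 2] by fastforce
  also have "card N \<le> 2 * stable_size G"
    using wf N by (rule matching_card_le)
  finally have "card (\<Union>e\<in>N. edge_vertices G e) \<le> 4 * stable_size G"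
    by simp
  with lq show ?thesis
    unfolding cover using card_Un_le[of "lq_vertices G" "\<Union>e\<in>N. edge_vertices G e"] by linarith
qed

lemma marked_subset: "marked X S C us \<subseteq> set us - X"
  unfolding marked_def using set_take_subset by fastforce

locale covered_instance =
  fixes G :: lq_instance and S :: "nat set"
  assumes wf: "wf_instance G"
begin

abbreviation n :: nat where "n \<equiv> num_agents G"
abbreviation X :: "nat set" where "X \<equiv> cover_vertices G"
abbreviation K :: "nat set" where "K \<equiv> kept G S X"

lemma finite_cover: "finite X"
  using cover_vertices_subset[OF wf] finite_subset by blast

lemma kept_subset: "K \<subseteq> {..<num_vertices G}"
proof -
  have "marked X S C (neighbours G v) \<subseteq> {..<num_vertices G}" if "v \<in> X" for v C
    using that cover_vertices_subset[OF wf] neighbours_wf(2)[OF wf, of v] marked_subset by blast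
  then show ?thesis
    using cover_vertices_subset[OF wf] by (auto simp: kept_def)
qed

lemma finite_kept: "finite K"
  using kept_subset finite_subset by blast

lemma many_better_neighbours_kept:
  assumes covered: "v \<in> X" and deleted: "u \<in> set (neighbours G v)" "u \<notin> K"
  shows "card X <
    card {x \<in> K - X. x \<in> set (neighbours G v) \<and> x \<notin> S \<and> precedes (neighbours G v) x u}"
    (is "_ < card ?better")
proof -
  let ?free = "\<lambda>u. u \<notin> X \<and> u \<notin> S"
  let ?T = "set (take (card X + 1) (filter ?free (neighbours G v)))"
  have marked: "marked X S (card X + 1) (neighbours G v) \<subseteq> K"
    using covered by (auto simp: kept_def)
  then have marked_kept: "?T \<subseteq> K"
    by (auto simp: marked_def)
  have "?free u" "u \<notin> ?T"
    using deleted marked marked_kept by (auto simp: marked_def kept_def)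
  moreover have "distinct (neighbours G v)"
    using covered cover_vertices_subset[OF wf] neighbours_wf(1)[OF wf] by blast
  ultimately have "card ?T = card X + 1" "\<And>x. x \<in> ?T \<Longrightarrow> precedes (neighbours G v) x u"
    using not_in_take_filter[of "neighbours G v" u ?free "card X + 1"] deleted(1) by blast+
  moreover from this(2) marked_kept have "?T \<subseteq> ?better"
    by (auto dest: in_set_takeD)
  moreover have "finite ?better"
    by (rule finite_subset[of _ "set (neighbours G v)"]) auto
  ultimately show ?thesis
    using card_mono[of ?better ?T] by simp
qed

lemma card_agents_of_le: "card (agents_of G X) \<le> card X"
  using finite_cover by (intro card_mono) (auto simp: agents_of_def)

lemma card_resources_of_le: "card (resources_of G X) \<le> card X"
  by (rule card_inj_on_le[OF _ _ finite_cover, of "(+) n"]) (auto simp: resources_of_def)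

lemma many_better_agents_kept:
  assumes edge: "(a, b) \<in> edges G" and deleted: "a \<notin> agents_of G K"
  shows "card (resources_of G X) <
    card {a' \<in> agents_of G K - agents_of G X. (a', b) \<in> edges G \<and> resource_pref G b a' a}"
    (is "_ < card ?better")
proof -
  note bounds = edges_bounds[OF wf edge]
  have covered: "n + b \<in> X"
    using cover_vertices_covers[OF edge] bounds deleted by (auto simp: agents_of_def kept_def)
  have neighbours_eq: "neighbours G (n + b) = bpref G ! b"
    by (simp add: neighbours_def)
  have mem_iff: "x \<in> set (bpref G ! b) \<longleftrightarrow> (x, b) \<in> edges G" for x
    using mem_neighbours_resource[OF wf] bounds unfolding neighbours_eq[symmetric] by simp
  have "card (resources_of G X) \<le> card X"
    by (rule card_resources_of_le)
  also have "card X < card {x \<in> K - X. x \<in> set (bpref G ! b) \<and> x \<notin> S \<and> resource_pref G b x a}"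
    using many_better_neighbours_kept[of "n + b" a] deleted covered edge bounds
    by (simp add: neighbours_eq mem_iff agents_of_def)
  also have "\<dots> \<le> card ?better"
  proof (rule card_mono)
    show "finite ?better"
      by (rule finite_subset[of _ "{..<n}"]) (auto simp: agents_of_def)
    show "{x \<in> K - X. x \<in> set (bpref G ! b) \<and> x \<notin> S \<and> resource_pref G b x a} \<subseteq> ?better"
      by (auto simp: mem_iff agents_of_def dest: edges_bounds[OF wf])
  qed
  finally show ?thesis .
qed

lemma many_better_resources_kept:
  assumes edge: "(a, b) \<in> edges G" and deleted: "b \<notin> resources_of G K"
  shows "card (agents_of G X) < card {b' \<in> resources_of G K - resources_of G X.
    (a, b') \<in> edges G \<and> n + b' \<notin> S \<and> agent_pref G a b' b}" (is "_ < card ?better")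
proof -
  have covered: "a \<in> X" "a < n"
    using cover_vertices_covers[OF edge] edges_bounds[OF wf edge] deleted
    by (auto simp: resources_of_def kept_def)
  have precedes_iff: "precedes (neighbours G a) (n + c) (n + d) \<longleftrightarrow> agent_pref G a c d" for c d
    using covered(2) precedes_map_iff[of "(+) n"] by (simp add: neighbours_def)
  let ?vertices = "{x \<in> K - X. x \<in> set (neighbours G a) \<and> x \<notin> S \<and>
    precedes (neighbours G a) x (n + b)}"
  have "card (agents_of G X) \<le> card X"
    by (rule card_agents_of_le)
  also have "card X < card ?vertices"
    using covered deleted edge
    by (intro many_better_neighbours_kept) (simp_all add: mem_neighbours_agent resources_of_def)
  also have "card ?vertices \<le> card ?better"
  proof (rule surj_card_le)
    show "finite ?better"
      using finite_resources_of[OF finite_kept] by simp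
    show "?vertices \<subseteq> (+) n ` ?better"
    proof
      fix x
      assume better: "x \<in> ?vertices"
      then have "n \<le> x"
        using neighbours_wf(3)[OF wf _ covered(2)] covered(2) by (auto simp: num_vertices_def)
      then obtain c where "x = n + c"
        using le_Suc_ex by blast
      with better show "x \<in> (+) n ` ?better"
        using covered(2) by (simp add: precedes_iff mem_neighbours_agent resources_of_def)
    qed
  qed
  finally show ?thesis .
qed

lemma kept_agent_reduction: "agent_reduction (edges G) (agent_pref G) (resource_pref G)
  (agents_of G X) (agents_of G K) (resources_of G X) (resources_of G K)"
proof (intro agent_reduction.intro agent_reduction_axioms.intro)
  show "preference_graph (edges G) (agent_pref G) (resource_pref G)"
    using wf by (rule preference_graph_instance)
  show "a \<in> agents_of G X \<or> b \<in> resources_of G X" if "(a, b) \<in> edges G" for a b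
    using cover_vertices_covers[OF that] edges_bounds[OF wf that]
    by (auto simp: agents_of_def resources_of_def)
  show "finite (resources_of G X)"
    using finite_cover by (rule finite_resources_of)
  show "agents_of G X \<subseteq> agents_of G K" "resources_of G X \<subseteq> resources_of G K"
    by (auto simp: agents_of_def resources_of_def kept_def)
qed (rule many_better_agents_kept)

lemma kept_two_sided_reduction: "two_sided_reduction (edges G) (agent_pref G) (resource_pref G)
  (agents_of G X) (agents_of G K) (resources_of G X) (resources_of G K)"
proof -
  interpret agent_reduction "edges G" "agent_pref G" "resource_pref G"
    "agents_of G X" "agents_of G K" "resources_of G X" "resources_of G K"
    by (rule kept_agent_reduction)
  have "agent_reduction ((edges G)\<inverse>) (resource_pref G) (agent_pref G)
    (resources_of G X) (resources_of G K) (agents_of G X) (agents_of G K)"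
  proof (intro agent_reduction.intro agent_reduction_axioms.intro preference_graph_converse)
    show "finite (agents_of G X)"
      by (auto simp: agents_of_def)
    fix a b
    assume "(b, a) \<in> (edges G)\<inverse>" "b \<notin> resources_of G K"
    then have "card (agents_of G X) < card {b' \<in> resources_of G K - resources_of G X.
        (a, b') \<in> edges G \<and> n + b' \<notin> S \<and> agent_pref G a b' b}"
      by (intro many_better_resources_kept) auto
    also have "\<dots> \<le> card {b' \<in> resources_of G K - resources_of G X.
        (b', a) \<in> (edges G)\<inverse> \<and> agent_pref G a b' b}"
      using finite_resources_of[OF finite_kept] by (intro card_mono) auto
    finally show "card (agents_of G X) < card {b' \<in> resources_of G K - resources_of G X.
        (b', a) \<in> (edges G)\<inverse> \<and> agent_pref G a b' b}" .
  qed (use cover XA_kept XB_kept in auto)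
  then show ?thesis
    by (rule two_sided_reduction.intro[OF kept_agent_reduction])
qed

lemma private_unless_shared:
  assumes "n + b \<notin> shared_resources G" "(a, b) \<in> edges G"
  shows "(edges G)\<inverse> `` {b} = {a}"
proof -
  have "length (bpref G ! b) \<le> 1"
    using assms(1) by (simp add: shared_resources_def neighbours_def)
  moreover have "a \<in> set (bpref G ! b)"
    using edges_wf(4)[OF wf assms(2)] .
  ultimately have "set (bpref G ! b) \<subseteq> {a}"
    by (cases "bpref G ! b") auto
  then show ?thesis
    using assms(2) by (auto dest: edges_wf(4)[OF wf])
qed

lemma kept_private_resource_reduction:
  assumes "shared_resources G \<subseteq> S"
  shows "private_resource_reduction (edges G) (agent_pref G) (resource_pref G)
    (agents_of G X) (agents_of G K) (resources_of G X) (resources_of G K)"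
proof (intro private_resource_reduction.intro kept_agent_reduction
    private_resource_reduction_axioms.intro)
  fix a b
  assume "(a, b) \<in> edges G" "b \<notin> resources_of G K"
  from many_better_resources_kept[OF this]
  have "{b' \<in> resources_of G K - resources_of G X.
      (a, b') \<in> edges G \<and> n + b' \<notin> S \<and> agent_pref G a b' b} \<noteq> {}"
    by (metis card.empty less_nat_zero_code)
  then obtain b' where
    "b' \<in> resources_of G K" "(a, b') \<in> edges G" "n + b' \<notin> S" "agent_pref G a b' b"
    by blast
  then show "\<exists>b'\<in>resources_of G K. (edges G)\<inverse> `` {b'} = {a} \<and> agent_pref G a b' b"
    using assms private_unless_shared by blast
qed

lemma subinstance_kept: "subinstance G (agents_of G K) (resources_of G K)"
proof
  show "agents_of G K \<subseteq> agents G"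
    by (auto simp: agents_of_def agents_def num_agents_def)
  show "resources_of G K \<subseteq> resources G"
    using kept_subset by (auto simp: resources_of_def resources_def num_vertices_def)
qed (rule wf)

lemma lq_resources_kept: "lq_resources G \<subseteq> resources_of G K"
  using lq_vertices_subset_cover[of G] by (auto simp: lq_vertices_def resources_of_def kept_def)

lemma maxrsm_yes_kept_iff: "(induced_instance G K, k) \<in> maxrsm_yes \<longleftrightarrow> (G, k) \<in> maxrsm_yes"
  using subinstance.maxrsm_yes_sub_iff[OF subinstance_kept kept_two_sided_reduction
      lq_resources_kept]
  by (simp add: induced_instance_def)

lemma stable_feasible_kept_iff:
  "(\<exists>M. stable (induced_instance G K) M \<and> feasible (induced_instance G K) M) \<longleftrightarrow>
    (\<exists>M. stable G M \<and> feasible G M)"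
  using subinstance.stable_feasible_sub_iff[OF subinstance_kept kept_two_sided_reduction
      lq_resources_kept]
  by (simp add: induced_instance_def)

lemma maxefm_yes_kept_iff:
  "shared_resources G \<subseteq> S \<Longrightarrow> (induced_instance G K, k) \<in> maxefm_yes \<longleftrightarrow> (G, k) \<in> maxefm_yes"
  using subinstance.maxefm_yes_sub_iff[OF subinstance_kept kept_private_resource_reduction
      lq_resources_kept]
  by (simp add: induced_instance_def)

lemma wf_induced_kept: "wf_instance (induced_instance G K)"
  unfolding induced_instance_def by (rule subinstance.wf_sub[OF subinstance_kept])

lemma card_kept_le:
  assumes "\<And>v. v \<in> X \<Longrightarrow> card {u \<in> set (neighbours G v). u \<notin> X \<and> u \<in> S} \<le> t"
  shows "card K \<le> card X + card X * (t + (card X + 1))"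
proof -
  have "card (marked X S (card X + 1) (neighbours G v)) \<le> t + (card X + 1)" if "v \<in> X" for v
  proof -
    have "card (set (take (card X + 1) us)) \<le> card X + 1" for us :: "nat list"
      by (rule order_trans[OF card_length]) simp
    then show ?thesis
      unfolding marked_def by (intro order_trans[OF card_Un_le] add_mono assms that)
  qed
  then have "(\<Sum>v\<in>X. card (marked X S (card X + 1) (neighbours G v))) \<le> card X * (t + (card X + 1))"
    using sum_bounded_above[of X "\<lambda>v. card (marked X S (card X + 1) (neighbours G v))"
        "t + (card X + 1)"] by simp
  with card_UN_le[OF finite_cover, of "\<lambda>v. marked X S (card X + 1) (neighbours G v)"]
  have "card (\<Union>v\<in>X. marked X S (card X + 1) (neighbours G v)) \<le> card X * (t + (card X + 1))"
    by (rule order_trans)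
  then show ?thesis
    unfolding kept_def by (intro order_trans[OF card_Un_le] add_left_mono)
qed

end

definition common_resources :: "lq_instance \<Rightarrow> nat \<Rightarrow> nat \<Rightarrow> nat set" where
  "common_resources G a a' =
     {b \<in> resources G. \<not> is_lq G b \<and> b \<in> set (apref G ! a) \<and> b \<in> set (apref G ! a')}"

lemma finite_common_resources: "finite (common_resources G a a')"
  by (simp add: common_resources_def resources_def)

lemma card_common_resources_le:
  assumes "a \<in> agents G" "a' \<in> agents G" "a \<noteq> a'"
  shows "card (common_resources G a a') \<le> max_common G"
proof -
  let ?cards = "{card (common_resources G a a') |a a'. a \<in> agents G \<and> a' \<in> agents G \<and> a \<noteq> a'}"
  have "?cards \<subseteq> (\<lambda>(a, a'). card (common_resources G a a')) ` (agents G \<times> agents G)"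
    by auto
  then have "finite ?cards"
    by (rule finite_subset) (simp add: agents_def)
  moreover have "card (common_resources G a a') \<in> ?cards"
    using assms by blast
  ultimately show ?thesis
    unfolding max_common_def common_resources_def[symmetric] by (intro Max_ge) auto
qed

context covered_instance
begin

lemma shared_resources_subset:
  assumes agent: "v < n"
  shows "{u \<in> set (neighbours G v). u \<notin> X \<and> u \<in> shared_resources G} \<subseteq>
    (\<Union>a\<in>{a \<in> X. a < n \<and> a \<noteq> v}. (+) n ` common_resources G v a)"
proof clarify
  fix u
  assume shared: "u \<in> set (neighbours G v)" "u \<notin> X" "u \<in> shared_resources G"
  then obtain b where b: "u = n + b"
    using le_Suc_ex by (auto simp: shared_resources_def)
  have edge: "(v, b) \<in> edges G"
    using shared(1) agent b mem_neighbours_agent by blast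
  note bounds = edges_bounds[OF wf edge]
  have "u < num_vertices G"
    using b bounds by (simp add: num_vertices_def)
  then have "distinct (neighbours G u)" "1 < length (neighbours G u)"
    using shared(3) neighbours_wf(1)[OF wf] by (auto simp: shared_resources_def)
  then have "\<not> set (neighbours G u) \<subseteq> {v}"
    using card_mono[of "{v}" "set (neighbours G u)"] by (auto simp: distinct_card)
  then obtain a where other: "a \<in> set (neighbours G u)" "a \<noteq> v"
    by blast
  then have other_edge: "(a, b) \<in> edges G"
    using mem_neighbours_resource[OF wf] b bounds by simp
  have "a \<in> X"
    using cover_vertices_covers[OF other_edge] shared(2) b by simp
  moreover have "\<not> is_lq G b"
    using shared(2) b lq_vertices_subset_cover[of G] by (auto simp: lq_vertices_def)
  then have "b \<in> common_resources G v a"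
    using edges_wf[OF wf edge] edges_wf[OF wf other_edge] by (simp add: common_resources_def)
  ultimately show "u \<in> (\<Union>a\<in>{a \<in> X. a < n \<and> a \<noteq> v}. (+) n ` common_resources G v a)"
    using other(2) b edges_bounds[OF wf other_edge] by blast
qed

lemma card_shared_resources_le:
  assumes covered: "v \<in> X"
  shows "card {u \<in> set (neighbours G v). u \<notin> X \<and> u \<in> shared_resources G} \<le> card X * max_common G"
    (is "card ?shared \<le> _")
proof (cases "v < n")
  case False
  then have "?shared = {}"
    using neighbours_wf(4)[OF wf] covered cover_vertices_subset[OF wf]
    by (fastforce simp: shared_resources_def)
  then show ?thesis
    by (simp only: card.empty)
next
  case True
  let ?others = "{a \<in> X. a < n \<and> a \<noteq> v}"
  let ?common = "\<lambda>a. (+) n ` common_resources G v a"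
  have "card ?shared \<le> card (\<Union>a\<in>?others. ?common a)"
    using shared_resources_subset[OF True] finite_cover finite_common_resources
    by (intro card_mono) auto
  also have "\<dots> \<le> (\<Sum>a\<in>?others. card (?common a))"
    using finite_cover by (intro card_UN_le) auto
  also have "\<dots> \<le> card ?others * max_common G"
  proof (rule sum_bounded_above[where K = "max_common G", simplified])
    fix a
    assume "a \<in> ?others"
    then have "card (common_resources G v a) \<le> max_common G"
      using True by (intro card_common_resources_le) (auto simp: agents_def num_agents_def)
    then show "card (?common a) \<le> max_common G"
      by (simp add: card_image)
  qed
  also have "\<dots> \<le> card X * max_common G"
    using finite_cover by (intro mult_le_mono1 card_mono) auto
  finally show ?thesis .
qed

end

section \<open>Size and correctness of the kernel\<close>

lemma rank_agents_of: "a \<le> num_agents G \<Longrightarrow> rank (agents_of G K) a = rank K a"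
  unfolding rank_def agents_of_def by (rule arg_cong[of _ _ card]) auto

lemma rank_resources_of:
  "rank K (num_agents G + b) = rank K (num_agents G) + rank (resources_of G K) b"
  by (induction b) (simp_all add: rank_Suc resources_of_def)

lemma num_agents_induced: "num_agents (induced_instance G K) = rank K (num_agents G)"
  using rank_agents_of[of "num_agents G" G K]
  by (simp add: induced_instance_def sub_instance_def length_sub_lists num_agents_def)

lemma length_bpref_induced:
  "length (bpref (induced_instance G K)) = rank K (num_vertices G) - rank K (num_agents G)"
  by (simp add: induced_instance_def sub_instance_def length_sub_lists num_vertices_def
      rank_resources_of)

lemma num_vertices_induced:
  assumes "K \<subseteq> {..<num_vertices G}"
  shows "num_vertices (induced_instance G K) = card K"
  using rank_eq_card[OF assms] rank_mono[of "num_agents G" "num_vertices G" K]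
  by (simp add: num_vertices_def[of "induced_instance G K"] num_agents_induced length_bpref_induced
      num_vertices_def[of G])

lemma encode_lists_append: "encode_lists (xss @ yss) = encode_lists xss @ encode_lists yss"
  by (simp add: encode_lists_def)

lemma floor_log_le: "floor_log x \<le> x"
proof (cases "x = 0")
  case False
  then have "2 ^ floor_log x \<le> x"
    by (simp add: floor_log_exp2_le)
  then show ?thesis
    using less_exp[of "floor_log x"] by linarith
qed simp

lemma length_le_word_size: "length w \<le> word_size w"
  by (induction w) (auto simp: word_size_def)

lemma word_size_le: "(\<And>x. x \<in> set w \<Longrightarrow> x < c) \<Longrightarrow> word_size w \<le> c * length w"
proof (induction w)
  case (Cons x w)
  then have "word_size w \<le> c * length w" "x < c"
    by auto
  then show ?case
    using floor_log_le[of x] by (simp add: word_size_def)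
qed (simp add: word_size_def)

lemma length_encode_lists_le:
  "(\<And>xs. xs \<in> set xss \<Longrightarrow> length xs \<le> c) \<Longrightarrow> length (encode_lists xss) \<le> length xss * (c + 1)"
proof (induction xss)
  case (Cons xs xss)
  then have "length (encode_lists xss) \<le> length xss * (c + 1)" "length xs \<le> c"
    by auto
  then show ?case
    by (simp add: encode_lists_def)
qed (simp add: encode_lists_def)

lemma wf_instance_lists:
  assumes wf: "wf_instance H" and xs: "xs \<in> set (apref H @ bpref H)"
  shows "set xs \<subseteq> {..<num_vertices H}" "length xs \<le> num_vertices H"
proof -
  have "distinct xs \<and> set xs \<subseteq> {..<num_vertices H}"
    using xs wf_instance_agent[OF wf] wf_instance_resource[OF wf]
    by (fastforce simp: in_set_conv_nth agents_def resources_def num_vertices_def num_agents_def)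
  then show "set xs \<subseteq> {..<num_vertices H}" "length xs \<le> num_vertices H"
    using card_mono[of "{..<num_vertices H}" "set xs"] distinct_card[of xs] by auto
qed

lemma length_encode_le:
  assumes wf: "wf_instance H"
  shows "length (encode (H, k)) \<le> (num_vertices H + 2)\<^sup>2"
proof -
  let ?V = "num_vertices H"
  have "length (encode (H, k)) = 3 + length (bpref H) + length (encode_lists (apref H @ bpref H))"
    using wf by (simp add: encode_def encode_lists_append wf_instance_def)
  also have "\<dots> \<le> 3 + ?V + ?V * (?V + 1)"
    using length_encode_lists_le[of "apref H @ bpref H" ?V] wf_instance_lists(2)[OF wf]
    by (intro add_mono) (auto simp: num_vertices_def num_agents_def)
  also have "\<dots> \<le> (?V + 2)\<^sup>2"
    by (simp add: power2_eq_square algebra_simps)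
  finally show ?thesis .
qed

lemma word_size_encode_le:
  assumes wf: "wf_instance H" and k: "k \<le> Suc (num_vertices H)"
  shows "word_size (encode (H, k)) \<le> (num_vertices H + 2) ^ 3"
proof -
  have list_entry: "x < num_vertices H + 2" if "x \<in> set (encode_lists (apref H @ bpref H))" for x
  proof -
    from that obtain xs where xs: "xs \<in> set (apref H @ bpref H)" "x = length xs \<or> x \<in> set xs"
      unfolding encode_lists_def by auto
    then show ?thesis
      using wf_instance_lists[OF wf xs(1)] by fastforce
  qed
  have "x < num_vertices H + 2" if "x \<in> set (encode (H, k))" for x
  proof -
    have "x \<in> {k, length (apref H), length (bpref H)} \<or> x \<le> 1 \<or>
        x \<in> set (encode_lists (apref H @ bpref H))"
      using that by (auto simp: encode_def encode_lists_append)
    then show ?thesis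
      using list_entry[of x] k by (auto simp: num_vertices_def num_agents_def)
  qed
  then have "word_size (encode (H, k)) \<le> (num_vertices H + 2) * length (encode (H, k))"
    by (rule word_size_le)
  also have "\<dots> \<le> (num_vertices H + 2) * (num_vertices H + 2)\<^sup>2"
    using wf by (intro mult_le_mono2 length_encode_le)
  finally show ?thesis
    by (simp only: power_Suc[symmetric] numeral_2_eq_2 numeral_3_eq_3)
qed

lemma matching_card_le_num_agents:
  assumes "matching H M"
  shows "card M \<le> num_agents H"
  using assms card_inj_on_le[of fst M "{..<num_agents H}"]
  by (force simp: matching_iff_matching_in matching_in_def edges_def agents_def num_agents_def)

lemma min_Suc_mem_iff:
  fixes n k :: nat
  assumes "\<And>j. (H, j) \<in> Y \<Longrightarrow> j \<le> n"
  shows "(H, min k (Suc n)) \<in> Y \<longleftrightarrow> (H, k) \<in> Y"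
  using assms[of k] assms[of "Suc n"] by (auto simp: min_def)

lemma maxrsm_yes_min_iff:
  "(H, min k (Suc (num_agents H))) \<in> maxrsm_yes \<longleftrightarrow> (H, k) \<in> maxrsm_yes"
  by (rule min_Suc_mem_iff)
    (auto simp: maxrsm_yes_def relaxed_stable_def intro: matching_card_le_num_agents)

lemma maxefm_yes_min_iff:
  "(H, min k (Suc (num_agents H))) \<in> maxefm_yes \<longleftrightarrow> (H, k) \<in> maxefm_yes"
  by (rule min_Suc_mem_iff)
    (auto simp: maxefm_yes_def envy_free_def intro: matching_card_le_num_agents)

lemma efm_instances_iff: "(G, k) \<in> efm_instances \<longleftrightarrow> wf_instance G \<and> (\<exists>k. (G, k) \<in> maxefm_yes)"
  by (auto simp: efm_instances_def maxefm_yes_def)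

lemma kernelize_eq:
  "kernelize S (G, k) = (induced_instance G (kernel_vertices S G),
     min k (Suc (num_agents (induced_instance G (kernel_vertices S G)))))"
  by (simp add: kernelize_def Let_def)

definition size_poly :: "nat poly" where
  "size_poly = ([:2, 6:] + [:0, 6:] * ([:0, 6:] * [:0, 1:] + [:1, 6:])) ^ 3"

context
  fixes G :: lq_instance
  assumes wf: "wf_instance G"
begin

interpretation covered_instance G "S G" for S
  by unfold_locales (rule wf)

lemma kernelize_maxrsm_iff: "kernelize S (G, k) \<in> maxrsm_yes \<longleftrightarrow> (G, k) \<in> maxrsm_yes"
  unfolding kernelize_eq maxrsm_yes_min_iff kernel_vertices_def by (rule maxrsm_yes_kept_iff)

lemma kernelize_maxefm_iff:
  "kernelize shared_resources (G, k) \<in> maxefm_yes \<longleftrightarrow> (G, k) \<in> maxefm_yes"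
  unfolding kernelize_eq maxefm_yes_min_iff kernel_vertices_def by (rule maxefm_yes_kept_iff) simp

lemma kernelize_stable_feasible:
  "(G, k) \<in> stable_feasible_instances \<Longrightarrow> kernelize S (G, k) \<in> stable_feasible_instances"
  using stable_feasible_kept_iff[of S] wf_induced_kept[of S]
  by (simp add: stable_feasible_instances_def kernelize_eq kernel_vertices_def)

lemma kernelize_efm_instances:
  "(G, k) \<in> efm_instances \<Longrightarrow> kernelize shared_resources (G, k) \<in> efm_instances"
  using maxefm_yes_kept_iff[of shared_resources] wf_induced_kept[of shared_resources]
  by (simp add: efm_instances_iff kernelize_eq kernel_vertices_def)

lemma wf_kernel: "wf_instance (induced_instance G (kernel_vertices S G))"
  unfolding kernel_vertices_def by (rule wf_induced_kept)

lemma kernel_vertices_subset: "kernel_vertices S G \<subseteq> {..<num_vertices G}"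
  unfolding kernel_vertices_def by (rule kept_subset)

lemma num_vertices_kernel:
  "num_vertices (induced_instance G (kernel_vertices S G)) = card (kernel_vertices S G)"
  using kernel_vertices_subset by (rule num_vertices_induced)

lemma word_size_kernelize_le:
  "word_size (encode (kernelize S (G, k))) \<le> (card (kernel_vertices S G) + 2) ^ 3"
proof -
  have "min k (Suc (num_agents H)) \<le> Suc (num_vertices H)" for H
    by (simp add: num_vertices_def)
  then show ?thesis
    using word_size_encode_le[OF wf_kernel] num_vertices_kernel by (metis kernelize_eq)
qed

lemma word_size_kernelize_le_poly:
  assumes matching: "matching G M" "feasible G M"
    and marked: "\<And>v. v \<in> cover_vertices G \<Longrightarrow>
      card {u \<in> set (neighbours G v). u \<notin> cover_vertices G \<and> u \<in> S G} \<le> card (cover_vertices G) * t"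
    and \<kappa>: "stable_size G + t \<le> \<kappa>"
  shows "word_size (encode (kernelize S (G, k))) \<le> poly size_poly \<kappa>"
proof -
  let ?X = "cover_vertices G"
  have cover: "card ?X \<le> 6 * \<kappa>"
    using card_cover_vertices_le[OF wf matching] \<kappa> by linarith
  have "card (kernel_vertices S G) \<le> card ?X + card ?X * (card ?X * t + (card ?X + 1))"
    unfolding kernel_vertices_def using marked by (rule card_kept_le)
  also have "\<dots> \<le> 6 * \<kappa> + 6 * \<kappa> * (6 * \<kappa> * \<kappa> + (6 * \<kappa> + 1))"
    using cover \<kappa> by (intro add_mono mult_mono) auto
  finally have "(card (kernel_vertices S G) + 2) ^ 3 \<le> poly size_poly \<kappa>"
    by (auto simp: size_poly_def poly_power algebra_simps intro!: power_mono)
  with word_size_kernelize_le show ?thesis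
    by (rule order_trans)
qed

lemma word_size_kernelize_efm_le:
  assumes "(G, k) \<in> efm_instances"
  shows "word_size (encode (kernelize shared_resources (G, k)))
    \<le> poly size_poly (stable_size G + max_common G)"
proof -
  obtain M where "matching G M" "feasible G M"
    using assms by (auto simp: efm_instances_def envy_free_def)
  then show ?thesis
    using card_shared_resources_le by (intro word_size_kernelize_le_poly) auto
qed

lemma word_size_kernelize_rsm_le:
  assumes "(G, k) \<in> stable_feasible_instances"
  shows "word_size (encode (kernelize (\<lambda>_. {}) (G, k))) \<le> poly size_poly (stable_size G)"
proof -
  obtain M where "matching G M" "feasible G M"
    using assms by (auto simp: stable_feasible_instances_def stable_def)
  then show ?thesis
    by (intro word_size_kernelize_le_poly[where t = 0]) auto
qed

end

section \<open>The program\<close>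

abbreviation (input) agents_reg :: nat where "agents_reg \<equiv> 2"
abbreviation (input) vertices_reg :: nat where "vertices_reg \<equiv> 3"
abbreviation (input) vertex_reg :: nat where "vertex_reg \<equiv> 4"
abbreviation (input) index_reg :: nat where "index_reg \<equiv> 5"
abbreviation (input) neighbour_reg :: nat where "neighbour_reg \<equiv> 6"
abbreviation (input) quota_reg :: nat where "quota_reg \<equiv> 7"
abbreviation (input) counter_reg :: nat where "counter_reg \<equiv> 8"

abbreviation (input) word_arr :: nat where "word_arr \<equiv> 0"
abbreviation (input) offset_arr :: nat where "offset_arr \<equiv> 2"
abbreviation (input) cover_arr :: nat where "cover_arr \<equiv> 3"
abbreviation (input) kept_arr :: nat where "kept_arr \<equiv> 4"
abbreviation (input) rank_arr :: nat where "rank_arr \<equiv> 5"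

definition load_neighbour :: com where
  "load_neighbour =
     SetReg neighbour_reg
       (Cell word_arr (Plus (Plus (Cell offset_arr (Reg vertex_reg)) (Const 1)) (Reg index_reg))) ;;
     When (Less (Reg vertex_reg) (Reg agents_reg))
       (SetReg neighbour_reg (Plus (Reg agents_reg) (Reg neighbour_reg)))"

definition for_neighbours :: "com \<Rightarrow> com" where
  "for_neighbours c =
     For index_reg (Cell word_arr (Cell offset_arr (Reg vertex_reg))) (load_neighbour ;; c)"

definition parse_prog :: com where
  "parse_prog =
     SetReg agents_reg (Cell word_arr (Const 1)) ;;
     SetReg vertices_reg (Plus (Reg agents_reg) (Cell word_arr (Const 2))) ;;
     SetReg counter_reg (Plus (Const 3) (Cell word_arr (Const 2))) ;;
     For vertex_reg (Reg vertices_reg)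
       (SetCell offset_arr (Reg vertex_reg) (Reg counter_reg) ;;
        SetReg counter_reg
          (Plus (Plus (Reg counter_reg) (Cell word_arr (Reg counter_reg))) (Const 1)))"

definition lq_prog :: com where
  "lq_prog =
     For vertex_reg (Reg vertices_reg)
       (When (Conj (Neg (Less (Reg vertex_reg) (Reg agents_reg)))
           (Equal (Cell word_arr (Plus (Const 3) (Minus (Reg vertex_reg) (Reg agents_reg))))
             (Const 1)))
         (SetCell cover_arr (Reg vertex_reg) (Const 1)))"

definition cover_edge :: com where
  "cover_edge =
     When (Conj (Equal (Cell cover_arr (Reg vertex_reg)) (Const 0))
         (Equal (Cell cover_arr (Reg neighbour_reg)) (Const 0)))
       (SetCell cover_arr (Reg vertex_reg) (Const 1) ;;
        SetCell cover_arr (Reg neighbour_reg) (Const 1))"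

definition cover_prog :: com where
  "cover_prog = For vertex_reg (Reg agents_reg) (for_neighbours cover_edge)"

definition count_prog :: com where
  "count_prog =
     SetReg quota_reg (Const 1) ;;
     For vertex_reg (Reg vertices_reg)
       (SetCell kept_arr (Reg vertex_reg) (Cell cover_arr (Reg vertex_reg)) ;;
        SetReg quota_reg (Plus (Reg quota_reg) (Cell cover_arr (Reg vertex_reg))))"

definition mark_neighbour :: "bexp \<Rightarrow> com" where
  "mark_neighbour test =
     When (Equal (Cell cover_arr (Reg neighbour_reg)) (Const 0))
       (Cond test
         (SetCell kept_arr (Reg neighbour_reg) (Const 1))
         (When (Less (Reg counter_reg) (Reg quota_reg))
           (SetCell kept_arr (Reg neighbour_reg) (Const 1) ;;
            SetReg counter_reg (Plus (Reg counter_reg) (Const 1)))))"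

definition mark_neighbours :: "bexp \<Rightarrow> com" where
  "mark_neighbours test = SetReg counter_reg (Const 0) ;; for_neighbours (mark_neighbour test)"

definition mark_prog :: "bexp \<Rightarrow> com" where
  "mark_prog test =
     For vertex_reg (Reg vertices_reg)
       (When (Equal (Cell cover_arr (Reg vertex_reg)) (Const 1)) (mark_neighbours test))"

definition rank_prog :: com where
  "rank_prog =
     SetReg counter_reg (Const 0) ;;
     For vertex_reg (Plus (Reg vertices_reg) (Const 1))
       (SetCell rank_arr (Reg vertex_reg) (Reg counter_reg) ;;
        SetReg counter_reg (Plus (Reg counter_reg) (Cell kept_arr (Reg vertex_reg))))"

definition kernel_vertices_prog :: "bexp \<Rightarrow> com" where
  "kernel_vertices_prog test =
     parse_prog ;; lq_prog ;; cover_prog ;; count_prog ;; mark_prog test ;; rank_prog"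

lemma indicator_eq_Suc_0_iff: "indicator S v = Suc 0 \<longleftrightarrow> v \<in> S"
  by (simp add: indicator_def)

lemma indicator_upd: "(indicator S)(v := Suc 0) = (indicator (insert v S) :: nat \<Rightarrow> nat)"
  by (auto simp: indicator_def fun_eq_iff)

lemmas nat_indicator_simps = indicator_eq_Suc_0_iff indicator_upd indicator_eq_0_iff

definition pref_list :: "lq_instance \<Rightarrow> nat \<Rightarrow> nat list" where
  "pref_list G v = (apref G @ bpref G) ! v"

definition list_offset :: "lq_instance \<Rightarrow> nat \<Rightarrow> nat" where
  "list_offset G v = 3 + length (bpref G) + length (encode_lists (take v (apref G @ bpref G)))"

definition parsed :: "lq_instance \<Rightarrow> nat \<Rightarrow> ram_state \<Rightarrow> bool" where
  "parsed G k \<sigma> \<longleftrightarrow> arr \<sigma> word_arr = arr (initial (encode (G, k))) word_arr \<and>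
     reg \<sigma> agents_reg = num_agents G \<and> reg \<sigma> vertices_reg = num_vertices G \<and>
     (\<forall>v<num_vertices G. arr \<sigma> offset_arr v = list_offset G v)"

lemma parsed_set_reg [simp]: "3 < r \<Longrightarrow> parsed G k (set_reg r v \<sigma>) \<longleftrightarrow> parsed G k \<sigma>"
  by (simp add: parsed_def)

lemma parsed_set_cell [simp]: "2 < A \<Longrightarrow> parsed G k (set_cell A i v \<sigma>) \<longleftrightarrow> parsed G k \<sigma>"
  by (simp add: parsed_def)

lemma parsed_regs:
  "parsed G k \<sigma> \<Longrightarrow> reg \<sigma> agents_reg = num_agents G"
  "parsed G k \<sigma> \<Longrightarrow> reg \<sigma> vertices_reg = num_vertices G"
  by (simp_all add: parsed_def)

definition covering :: "nat set \<Rightarrow> ram_state \<Rightarrow> bool" where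
  "covering X \<sigma> \<longleftrightarrow> arr \<sigma> cover_arr = indicator X \<and> arr \<sigma> kept_arr = indicator {}"

lemma covering_set_reg [simp]: "covering X (set_reg r v \<sigma>) \<longleftrightarrow> covering X \<sigma>"
  by (simp add: covering_def)

definition ranked :: "lq_instance \<Rightarrow> nat set \<Rightarrow> ram_state \<Rightarrow> bool" where
  "ranked G K \<sigma> \<longleftrightarrow>
     arr \<sigma> kept_arr = indicator K \<and> (\<forall>v\<le>num_vertices G. arr \<sigma> rank_arr v = rank K v)"

lemma encode_lists_snoc: "encode_lists (xss @ [xs]) = encode_lists xss @ length xs # xs"
  by (simp add: encode_lists_def)

lemma encode_lists_split:
  "v < length xss \<Longrightarrow> encode_lists xss =
     encode_lists (take v xss) @ (length (xss ! v) # xss ! v) @ encode_lists (drop (Suc v) xss)"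
  by (subst id_take_nth_drop[of v xss]) (auto simp: encode_lists_def)

lemma length_encode_lists_ge: "length xss \<le> length (encode_lists xss)"
  by (induction xss) (auto simp: encode_lists_def)

lemma list_offset_0: "list_offset G 0 = 3 + length (bpref G)"
  by (simp add: list_offset_def encode_lists_def)

lemma list_offset_Suc:
  assumes "v < num_vertices G"
  shows "list_offset G (Suc v) = list_offset G v + length (pref_list G v) + 1"
proof -
  have "take (Suc v) (apref G @ bpref G) = take v (apref G @ bpref G) @ [pref_list G v]"
    using assms unfolding pref_list_def
    by (intro take_Suc_conv_app_nth) (simp add: num_vertices_def num_agents_def)
  then show ?thesis
    unfolding list_offset_def by (simp add: encode_lists_snoc del: take_append)
qed

lemma neighbours_eq_map_pref_list:
  "v < num_vertices G \<Longrightarrow>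
    neighbours G v = map (\<lambda>u. if v < num_agents G then num_agents G + u else u) (pref_list G v)"
  by (auto simp: neighbours_def pref_list_def num_vertices_def num_agents_def nth_append)

locale program_input =
  fixes G :: lq_instance and k :: nat
  assumes wf: "wf_instance G"
begin

abbreviation n :: nat where "n \<equiv> num_agents G"
abbreviation N :: nat where "N \<equiv> num_vertices G"
abbreviation w :: "nat list" where "w \<equiv> encode (G, k)"
abbreviation input :: "nat \<Rightarrow> nat" where "input \<equiv> arr (initial w) word_arr"
abbreviation L :: nat where "L \<equiv> length w"
abbreviation phase_time :: nat where "phase_time \<equiv> 40 * (L + 1)\<^sup>2"

lemma length_lq: "length (lq G) = length (bpref G)"
  using wf by (simp add: wf_instance_def)

lemma encode_eq:
  "w = [k, n, length (bpref G)] @ map of_bool (lq G) @ encode_lists (apref G @ bpref G)"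
  by (simp add: encode_def num_agents_def encode_lists_append)

lemma input_header: "input 0 = k" "input (Suc 0) = n" "input 2 = length (bpref G)"
  by (simp_all add: initial_def encode_eq numeral_2_eq_2)

lemma input_lq: "b < length (bpref G) \<Longrightarrow> input (3 + b) = of_bool (lq G ! b)"
  using length_lq by (auto simp: initial_def encode_eq numeral_3_eq_3 nth_append)

lemma input_append: "w = xs @ y # ys \<Longrightarrow> input (length xs) = y"
  by (simp add: initial_def)

lemma encode_split:
  assumes "v < N"
  obtains xs ys where "w = xs @ length (pref_list G v) # pref_list G v @ ys"
    "length xs = list_offset G v"
proof -
  let ?lists = "apref G @ bpref G"
  let ?xs = "[k, n, length (bpref G)] @ map of_bool (lq G) @ encode_lists (take v ?lists)"
  have "w = ?xs @ length (pref_list G v) # pref_list G v @ encode_lists (drop (Suc v) ?lists)"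
    using encode_lists_split[of v ?lists] assms
    by (simp add: encode_eq pref_list_def num_vertices_def num_agents_def)
  then show thesis
    by (rule that) (simp add: list_offset_def length_lq)
qed

lemma input_list_offset: "v < N \<Longrightarrow> input (list_offset G v) = length (pref_list G v)"
  by (metis encode_split input_append)

lemma input_list_offset_nth:
  assumes "v < N" "j < length (pref_list G v)"
  shows "input (list_offset G v + 1 + j) = pref_list G v ! j"
proof -
  obtain xs ys where w: "w = xs @ length (pref_list G v) # pref_list G v @ ys"
    "length xs = list_offset G v"
    using encode_split[OF assms(1)] .
  have "w = (xs @ length (pref_list G v) # take j (pref_list G v)) @
      pref_list G v ! j # (drop (Suc j) (pref_list G v) @ ys)"
    using w(1) id_take_nth_drop[OF assms(2)] by simp
  from input_append[OF this] w(2) assms(2) show ?thesis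
    by (simp add: add.commute)
qed

lemma length_pref_list_le:
  assumes "v < N"
  shows "length (pref_list G v) \<le> L"
proof -
  obtain xs ys where "w = xs @ length (pref_list G v) # pref_list G v @ ys"
    using encode_split[OF assms] .
  then have "L = length (xs @ length (pref_list G v) # pref_list G v @ ys)"
    by simp
  then show ?thesis
    by simp
qed

lemma num_vertices_le: "N \<le> L"
  using length_encode_lists_ge[of "apref G @ bpref G"]
  by (simp add: encode_eq num_vertices_def num_agents_def)

lemma num_agents_le: "n \<le> N"
  by (simp add: num_vertices_def)

lemma length_neighbours: "v < N \<Longrightarrow> length (neighbours G v) = length (pref_list G v)"
  by (simp add: neighbours_eq_map_pref_list)

lemma parsed_length_neighbours:
  "parsed G k \<sigma> \<Longrightarrow> v < N \<Longrightarrow> arr \<sigma> word_arr (arr \<sigma> offset_arr v) = length (neighbours G v)"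
  by (simp add: parsed_def input_list_offset length_neighbours)

lemma neighbour_less: "v < N \<Longrightarrow> j < length (neighbours G v) \<Longrightarrow> neighbours G v ! j < N"
  using neighbours_wf(2)[OF wf] nth_mem by blast

lemma run_within_phase:
  assumes pre: "parsed G k \<sigma>" "I 0 \<sigma>"
    and frame: "\<And>i \<tau> v. I i \<tau> \<Longrightarrow> I i (set_reg vertex_reg v \<tau>)"
    and bound: "\<And>\<tau>. parsed G k \<tau> \<Longrightarrow> aval e \<tau> = K" "K \<le> L + 1"
    and body: "\<And>i \<tau>. i < K \<Longrightarrow> parsed G k \<tau> \<Longrightarrow> reg \<tau> vertex_reg = i \<Longrightarrow> I i \<tau> \<Longrightarrow>
      run_within c \<tau> (15 * L + 20) (\<lambda>\<tau>'. parsed G k \<tau>' \<and> reg \<tau>' vertex_reg = i \<and> I (Suc i) \<tau>')"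
  shows "run_within (For vertex_reg e c) \<sigma> phase_time (\<lambda>\<tau>. parsed G k \<tau> \<and> I K \<tau>)"
proof (rule run_within_weaken)
  show "run_within (For vertex_reg e c) \<sigma> (K * (15 * L + 20 + 2) + 2) (\<lambda>\<tau>. parsed G k \<tau> \<and> I K \<tau>)"
  proof (rule run_within_For)
    fix i \<tau>
    assume "i < K" "parsed G k \<tau> \<and> I i \<tau>" "reg \<tau> vertex_reg = i"
    then show "run_within c \<tau> (15 * L + 20)
        (\<lambda>\<tau>'. reg \<tau>' vertex_reg = i \<and> parsed G k \<tau>' \<and> I (Suc i) \<tau>')"
      using body[of i \<tau>] by (auto elim: run_mono)
  qed (use pre frame bound in auto)
  have "K * (15 * L + 20 + 2) \<le> (L + 1) * (15 * L + 20 + 2)"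
    using bound(2) by (rule mult_le_mono1)
  also have "\<dots> + 2 \<le> phase_time"
    by (simp add: power2_eq_square algebra_simps)
  finally show "K * (15 * L + 20 + 2) + 2 \<le> phase_time"
    by simp
qed

lemma run_load_neighbour:
  assumes "parsed G k \<sigma>" "reg \<sigma> vertex_reg = v" "v < N"
    and "reg \<sigma> index_reg = j" "j < length (neighbours G v)"
  shows "run load_neighbour \<sigma> Q \<longleftrightarrow> Q 3 (set_reg neighbour_reg (neighbours G v ! j) \<sigma>)"
  using assms input_list_offset_nth[of v j] length_neighbours[of v]
  by (auto simp: load_neighbour_def run_simps parsed_def neighbours_eq_map_pref_list numeral_3_eq_3)

lemma run_within_for_neighbours:
  assumes vertex: "v < N" and pre: "parsed G k \<sigma>" "reg \<sigma> vertex_reg = v" "I 0 \<sigma>"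
    and frame: "\<And>j \<tau> r u. r \<in> {index_reg, neighbour_reg} \<Longrightarrow> I j \<tau> \<Longrightarrow> I j (set_reg r u \<tau>)"
    and body: "\<And>j \<tau>. j < length (neighbours G v) \<Longrightarrow> parsed G k \<tau> \<Longrightarrow> reg \<tau> vertex_reg = v \<Longrightarrow>
      reg \<tau> neighbour_reg = neighbours G v ! j \<Longrightarrow> I j \<tau> \<Longrightarrow>
      run_within c \<tau> 10 (\<lambda>\<tau>'. parsed G k \<tau>' \<and> reg \<tau>' vertex_reg = v \<and>
        reg \<tau>' index_reg = reg \<tau> index_reg \<and> I (Suc j) \<tau>')"
  shows "run_within (for_neighbours c) \<sigma> (15 * L + 2)
    (\<lambda>\<tau>. parsed G k \<tau> \<and> reg \<tau> vertex_reg = v \<and> I (length (neighbours G v)) \<tau>)"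
proof (rule run_within_weaken)
  let ?d = "length (neighbours G v)"
  let ?I = "\<lambda>j \<tau>. parsed G k \<tau> \<and> reg \<tau> vertex_reg = v \<and> I j \<tau>"
  show "run_within (for_neighbours c) \<sigma> (?d * (13 + 2) + 2) (?I ?d)"
    unfolding for_neighbours_def
  proof (rule run_within_For)
    show "?I j (set_reg index_reg u \<tau>)" if "?I j \<tau>" for j \<tau> u
      using that frame by simp
    show "aval (Cell word_arr (Cell offset_arr (Reg vertex_reg))) \<tau> = ?d" if "?I j \<tau>" for j \<tau>
      using that vertex parsed_length_neighbours by simp
    fix j \<tau>
    assume entry: "j < ?d" and invariant: "?I j \<tau>" and index: "reg \<tau> index_reg = j"
    let ?\<tau> = "set_reg neighbour_reg (neighbours G v ! j) \<tau>"
    have "run_within c ?\<tau> 10 (\<lambda>\<tau>'. parsed G k \<tau>' \<and> reg \<tau>' vertex_reg = v \<and>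
        reg \<tau>' index_reg = reg ?\<tau> index_reg \<and> I (Suc j) \<tau>')"
      using invariant by (intro body entry frame) auto
    then show "run_within (load_neighbour ;; c) \<tau> 13 (\<lambda>\<tau>'. reg \<tau>' index_reg = j \<and> ?I (Suc j) \<tau>')"
      unfolding run_Seq using invariant vertex index entry
      by (subst run_load_neighbour) (auto elim: run_mono)
  qed (use pre in auto)
qed (use length_pref_list_le[OF vertex] length_neighbours[OF vertex] in auto)

lemma run_parse_prog:
  "run_within parse_prog (initial w) phase_time (\<lambda>\<tau>. parsed G k \<tau> \<and> covering {} \<tau>)"
proof -
  define I where "I i \<tau> \<longleftrightarrow> arr \<tau> word_arr = input \<and> reg \<tau> agents_reg = n \<and>
    reg \<tau> vertices_reg = N \<and> reg \<tau> counter_reg = list_offset G i \<and>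
    (\<forall>v<i. arr \<tau> offset_arr v = list_offset G v) \<and> covering {} \<tau>" for i \<tau>
  let ?body = "SetCell offset_arr (Reg vertex_reg) (Reg counter_reg) ;;
    SetReg counter_reg (Plus (Plus (Reg counter_reg) (Cell word_arr (Reg counter_reg))) (Const 1))"
  have loop: "run_within (For vertex_reg (Reg vertices_reg) ?body) \<sigma> (N * (2 + 2) + 2) (I N)"
    if "I 0 \<sigma>" for \<sigma>
  proof (rule run_within_For)
    show "run_within ?body \<tau> 2 (\<lambda>\<tau>'. reg \<tau>' vertex_reg = i \<and> I (Suc i) \<tau>')"
      if "i < N" "I i \<tau>" "reg \<tau> vertex_reg = i" for i \<tau>
      using that
      by (simp add: run_simps I_def covering_def input_list_offset list_offset_Suc less_Suc_eq)
  qed (use that in \<open>simp_all add: I_def\<close>)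
  let ?\<sigma> = "set_reg counter_reg (3 + length (bpref G))
    (set_reg vertices_reg (n + length (bpref G)) (set_reg agents_reg n (initial w)))"
  have "I 0 ?\<sigma>"
    by (simp add: I_def list_offset_0 num_vertices_def)
      (simp add: initial_def covering_def fun_eq_iff)
  moreover have "3 + (N * (2 + 2) + 2) \<le> phase_time"
    using num_vertices_le by (simp add: power2_eq_square algebra_simps)
  ultimately have "run (For vertex_reg (Reg vertices_reg) ?body) ?\<sigma>
      (\<lambda>t \<tau>. 1 + (1 + (1 + t)) \<le> phase_time \<and> parsed G k \<tau> \<and> covering {} \<tau>)"
    by (intro run_mono[OF loop]) (auto simp: I_def parsed_def)
  then show ?thesis
    by (simp add: parse_prog_def run_simps input_header)
qed

lemma mem_lq_vertices_iff:
  assumes "i < N"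
  shows "i \<in> lq_vertices G \<longleftrightarrow> n \<le> i \<and> input (3 + (i - n)) = 1"
proof (cases "n \<le> i")
  case True
  then obtain b where "i = n + b"
    using le_Suc_ex by blast
  then show ?thesis
    using assms input_lq[of b]
    by (simp add: lq_vertices_def inj_image_mem_iff is_lq_def resources_def num_vertices_def)
qed (auto simp: lq_vertices_def)

lemma run_lq_prog:
  assumes "parsed G k \<sigma>" "covering {} \<sigma>"
  shows "run_within lq_prog \<sigma> phase_time (\<lambda>\<tau>. parsed G k \<tau> \<and> covering (lq_vertices G) \<tau>)"
proof -
  let ?upto = "\<lambda>i. {v \<in> lq_vertices G. v < i}"
  let ?guard = "Conj (Neg (Less (Reg vertex_reg) (Reg agents_reg)))
    (Equal (Cell word_arr (Plus (Const 3) (Minus (Reg vertex_reg) (Reg agents_reg)))) (Const 1))"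
  have upto_Suc: "?upto (Suc i) = (if i \<in> lq_vertices G then insert i (?upto i) else ?upto i)" for i
    by (auto simp: less_Suc_eq)
  have "run_within lq_prog \<sigma> phase_time (\<lambda>\<tau>. parsed G k \<tau> \<and> covering (?upto N) \<tau>)"
    unfolding lq_prog_def
  proof (rule run_within_phase)
    fix i \<tau>
    assume state: "i < N" "parsed G k \<tau>" "reg \<tau> vertex_reg = i" "covering (?upto i) \<tau>"
    then have "bval ?guard \<tau> \<longleftrightarrow> i \<in> lq_vertices G"
      using mem_lq_vertices_iff by (auto simp: parsed_def)
    then show "run_within (When ?guard (SetCell cover_arr (Reg vertex_reg) (Const 1))) \<tau>
        (15 * L + 20)
        (\<lambda>\<tau>'. parsed G k \<tau>' \<and> reg \<tau>' vertex_reg = i \<and> covering (?upto (Suc i)) \<tau>')"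
      using state unfolding upto_Suc
      by (simp add: run_simps covering_def indicator_upd del: bval.simps)
  qed (use assms num_vertices_le in \<open>auto simp: parsed_regs\<close>)
  moreover have "?upto N = lq_vertices G"
    by (auto simp: lq_vertices_def is_lq_def resources_def num_vertices_def)
  ultimately show ?thesis
    by simp
qed

lemma edge_list_Suc: "edge_list G (Suc i) = edge_list G i @ map (Pair i) (apref G ! i)"
  by (simp add: edge_list_def)

lemma run_cover_edge:
  assumes "parsed G k \<tau>" "reg \<tau> vertex_reg = a" "reg \<tau> neighbour_reg = n + b"
    and "covering (greedy_cover G es) \<tau>"
  shows "run_within cover_edge \<tau> 10 (\<lambda>\<tau>'. parsed G k \<tau>' \<and> reg \<tau>' vertex_reg = a \<and>
    reg \<tau>' index_reg = reg \<tau> index_reg \<and> covering (greedy_cover G (es @ [(a, b)])) \<tau>')"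
  using assms
  by (auto simp: cover_edge_def run_simps covering_def greedy_cover_snoc greedy_step_def
      edge_vertices_def nat_indicator_simps insert_commute)

lemma run_cover_prog:
  assumes "parsed G k \<sigma>" "covering (lq_vertices G) \<sigma>"
  shows "run_within cover_prog \<sigma> phase_time (\<lambda>\<tau>. parsed G k \<tau> \<and> covering (cover_vertices G) \<tau>)"
proof -
  define upto where "upto i j = edge_list G i @ map (Pair i) (take j (apref G ! i))" for i j
  let ?I = "\<lambda>es. covering (greedy_cover G es)"
  have "run_within cover_prog \<sigma> phase_time (\<lambda>\<tau>. parsed G k \<tau> \<and> ?I (edge_list G n) \<tau>)"
    unfolding cover_prog_def
  proof (rule run_within_phase)
    fix i \<tau>
    assume agent: "i < n" and pre: "parsed G k \<tau>" "reg \<tau> vertex_reg = i" "?I (edge_list G i) \<tau>"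
    have "run_within (for_neighbours cover_edge) \<tau> (15 * L + 2)
      (\<lambda>\<tau>. parsed G k \<tau> \<and> reg \<tau> vertex_reg = i \<and> ?I (upto i (length (neighbours G i))) \<tau>)"
    proof (rule run_within_for_neighbours)
      fix j \<tau>
      assume state: "j < length (neighbours G i)" "parsed G k \<tau>" "reg \<tau> vertex_reg = i"
        "reg \<tau> neighbour_reg = neighbours G i ! j" "?I (upto i j) \<tau>"
      then have "reg \<tau> neighbour_reg = n + apref G ! i ! j"
        "upto i (Suc j) = upto i j @ [(i, apref G ! i ! j)]"
        using agent by (auto simp: neighbours_def upto_def take_Suc_conv_app_nth)
      then show "run_within cover_edge \<tau> 10 (\<lambda>\<tau>'. parsed G k \<tau>' \<and> reg \<tau>' vertex_reg = i \<and>
          reg \<tau>' index_reg = reg \<tau> index_reg \<and> ?I (upto i (Suc j)) \<tau>')"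
        using run_cover_edge[OF state(2,3) _ state(5)] by simp
    qed (use agent pre num_agents_le in \<open>auto simp: upto_def\<close>)
    moreover have "upto i (length (neighbours G i)) = edge_list G (Suc i)"
      using agent by (simp add: upto_def edge_list_Suc neighbours_def)
    ultimately show "run_within (for_neighbours cover_edge) \<tau> (15 * L + 20)
      (\<lambda>\<tau>'. parsed G k \<tau>' \<and> reg \<tau>' vertex_reg = i \<and> ?I (edge_list G (Suc i)) \<tau>')"
      by (auto elim: run_mono)
  qed (use assms num_agents_le num_vertices_le in
      \<open>auto simp: parsed_regs edge_list_def greedy_cover_def\<close>)
  then show ?thesis
    by (simp add: cover_vertices_def)
qed

lemma rank_Suc_indicator: "rank K (Suc v) = rank K v + indicator K v"
  by (simp add: rank_Suc indicator_def)

lemma run_count_prog: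
  assumes "parsed G k \<sigma>" "covering X \<sigma>" and bounded: "X \<subseteq> {..<N}"
  shows "run_within count_prog \<sigma> (1 + phase_time) (\<lambda>\<tau>. parsed G k \<tau> \<and>
    arr \<tau> cover_arr = indicator X \<and> arr \<tau> kept_arr = indicator X \<and> reg \<tau> quota_reg = card X + 1)"
proof -
  define I where "I i \<tau> \<longleftrightarrow> arr \<tau> cover_arr = indicator X \<and>
    arr \<tau> kept_arr = indicator {v \<in> X. v < i} \<and> reg \<tau> quota_reg = Suc (rank X i)"
    for i and \<tau> :: ram_state
  let ?body = "SetCell kept_arr (Reg vertex_reg) (Cell cover_arr (Reg vertex_reg)) ;;
    SetReg quota_reg (Plus (Reg quota_reg) (Cell cover_arr (Reg vertex_reg)))"
  have copy: "(indicator {v \<in> X. v < i})(i := indicator X i) =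
      (indicator {v \<in> X. v < Suc i} :: nat \<Rightarrow> nat)" for i
    by (auto simp: indicator_def fun_eq_iff less_Suc_eq)
  have "run_within count_prog \<sigma> (1 + phase_time) (\<lambda>\<tau>. parsed G k \<tau> \<and> I N \<tau>)"
    unfolding count_prog_def
  proof (rule run_within_Seq)
    show "run_within (SetReg quota_reg (Const 1)) \<sigma> 1 (\<lambda>\<tau>. parsed G k \<tau> \<and> I 0 \<tau>)"
      using assms by (simp add: run_simps I_def covering_def)
    show "run_within (For vertex_reg (Reg vertices_reg) ?body) \<tau> phase_time
        (\<lambda>\<tau>. parsed G k \<tau> \<and> I N \<tau>)" if "parsed G k \<tau> \<and> I 0 \<tau>" for \<tau>
    proof (rule run_within_phase)
      show "run_within ?body \<tau> (15 * L + 20)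
          (\<lambda>\<tau>'. parsed G k \<tau>' \<and> reg \<tau>' vertex_reg = i \<and> I (Suc i) \<tau>')"
        if "parsed G k \<tau>" "reg \<tau> vertex_reg = i" "I i \<tau>" for i \<tau>
        using that by (simp add: run_simps I_def copy rank_Suc_indicator)
    qed (use that num_vertices_le in \<open>auto simp: I_def parsed_regs\<close>)
  qed
  moreover have "{v \<in> X. v < N} = X"
    using bounded by auto
  ultimately show ?thesis
    by (simp add: I_def rank_eq_card[OF bounded])
qed

lemma run_rank_prog:
  assumes "parsed G k \<sigma>" "arr \<sigma> kept_arr = indicator K"
  shows "run_within rank_prog \<sigma> (1 + phase_time) (\<lambda>\<tau>. parsed G k \<tau> \<and> ranked G K \<tau>)"
proof -
  define I where "I i \<tau> \<longleftrightarrow> arr \<tau> kept_arr = indicator K \<and>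
    (\<forall>v<i. arr \<tau> rank_arr v = rank K v) \<and> reg \<tau> counter_reg = rank K i"
    for i and \<tau> :: ram_state
  let ?body = "SetCell rank_arr (Reg vertex_reg) (Reg counter_reg) ;;
    SetReg counter_reg (Plus (Reg counter_reg) (Cell kept_arr (Reg vertex_reg)))"
  have "run_within rank_prog \<sigma> (1 + phase_time) (\<lambda>\<tau>. parsed G k \<tau> \<and> I (N + 1) \<tau>)"
    unfolding rank_prog_def
  proof (rule run_within_Seq)
    show "run_within (SetReg counter_reg (Const 0)) \<sigma> 1 (\<lambda>\<tau>. parsed G k \<tau> \<and> I 0 \<tau>)"
      using assms by (simp add: run_simps I_def)
    show "run_within (For vertex_reg (Plus (Reg vertices_reg) (Const 1)) ?body) \<tau> phase_time
        (\<lambda>\<tau>. parsed G k \<tau> \<and> I (N + 1) \<tau>)" if "parsed G k \<tau> \<and> I 0 \<tau>" for \<tau>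
    proof (rule run_within_phase)
      show "run_within ?body \<tau> (15 * L + 20)
          (\<lambda>\<tau>'. parsed G k \<tau>' \<and> reg \<tau>' vertex_reg = i \<and> I (Suc i) \<tau>')"
        if "parsed G k \<tau>" "reg \<tau> vertex_reg = i" "I i \<tau>" for i \<tau>
        using that by (simp add: run_simps I_def rank_Suc_indicator less_Suc_eq)
    qed (use that num_vertices_le in \<open>auto simp: I_def parsed_regs\<close>)
  qed
  then show ?thesis
    by (rule run_mono) (auto simp: I_def ranked_def)
qed

end

lemma marked_snoc:
  "marked X S C (us @ [u]) = (if u \<notin> X \<and> (u \<in> S \<or> length (filter (\<lambda>u. u \<notin> X \<and> u \<notin> S) us) < C)
    then insert u (marked X S C us) else marked X S C us)"
  by (auto simp: marked_def)

locale marking_program = program_input +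
  fixes test :: bexp and S :: "nat set"
  assumes test: "parsed G k \<sigma> \<Longrightarrow> reg \<sigma> neighbour_reg < N \<Longrightarrow>
    bval test \<sigma> \<longleftrightarrow> reg \<sigma> neighbour_reg \<in> S"
begin

definition marking :: "nat set \<Rightarrow> nat set \<Rightarrow> nat list \<Rightarrow> ram_state \<Rightarrow> bool" where
  "marking X K us \<sigma> \<longleftrightarrow> arr \<sigma> cover_arr = indicator X \<and> reg \<sigma> quota_reg = card X + 1 \<and>
     arr \<sigma> kept_arr = indicator (K \<union> marked X S (card X + 1) us) \<and>
     reg \<sigma> counter_reg = min (card X + 1) (length (filter (\<lambda>u. u \<notin> X \<and> u \<notin> S) us))"

lemma run_mark_neighbour:
  assumes "parsed G k \<tau>" "reg \<tau> neighbour_reg = u" "u < N" "marking X K us \<tau>"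
  shows "run_within (mark_neighbour test) \<tau> 10 (\<lambda>\<tau>'. parsed G k \<tau>' \<and>
    reg \<tau>' vertex_reg = reg \<tau> vertex_reg \<and> reg \<tau>' index_reg = reg \<tau> index_reg \<and>
    marking X K (us @ [u]) \<tau>')"
proof -
  let ?C = "card X + 1" and ?free = "filter (\<lambda>u. u \<notin> X \<and> u \<notin> S) us"
  have "bval test \<tau> \<longleftrightarrow> u \<in> S"
    using test assms by simp
  moreover have "min ?C (length ?free) < ?C \<longleftrightarrow> length ?free < ?C"
    by (simp add: min_less_iff_disj)
  ultimately show ?thesis
    using assms
    by (cases "u \<in> X"; cases "u \<in> S"; cases "length ?free < ?C")
      (simp_all add: mark_neighbour_def run_simps marking_def marked_snoc nat_indicator_simps)
qed

lemma run_mark_neighbours: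
  assumes vertex: "v < N" and pre: "parsed G k \<sigma>" "reg \<sigma> vertex_reg = v"
      "arr \<sigma> cover_arr = indicator X" "arr \<sigma> kept_arr = indicator K" "reg \<sigma> quota_reg = card X + 1"
  shows "run_within (mark_neighbours test) \<sigma> (1 + (15 * L + 2))
    (\<lambda>\<tau>. parsed G k \<tau> \<and> reg \<tau> vertex_reg = v \<and> marking X K (neighbours G v) \<tau>)"
  unfolding mark_neighbours_def
proof (rule run_within_Seq)
  let ?I = "\<lambda>j. marking X K (take j (neighbours G v))"
  show "run_within (SetReg counter_reg (Const 0)) \<sigma> 1
      (\<lambda>\<tau>. parsed G k \<tau> \<and> reg \<tau> vertex_reg = v \<and> ?I 0 \<tau>)"
    using pre by (simp add: run_simps marking_def marked_def)
  fix \<tau>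
  assume "parsed G k \<tau> \<and> reg \<tau> vertex_reg = v \<and> ?I 0 \<tau>"
  then have "run_within (for_neighbours (mark_neighbour test)) \<tau> (15 * L + 2)
      (\<lambda>\<tau>'. parsed G k \<tau>' \<and> reg \<tau>' vertex_reg = v \<and> ?I (length (neighbours G v)) \<tau>')"
  proof (intro run_within_for_neighbours[OF vertex])
    fix j \<tau>
    assume "j < length (neighbours G v)" "parsed G k \<tau>" "reg \<tau> vertex_reg = v"
      "reg \<tau> neighbour_reg = neighbours G v ! j" "?I j \<tau>"
    then show "run_within (mark_neighbour test) \<tau> 10 (\<lambda>\<tau>'. parsed G k \<tau>' \<and>
        reg \<tau>' vertex_reg = v \<and> reg \<tau>' index_reg = reg \<tau> index_reg \<and> ?I (Suc j) \<tau>')"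
      using run_mark_neighbour[of \<tau> "neighbours G v ! j" X K "take j (neighbours G v)"]
        neighbour_less[OF vertex] by (simp add: take_Suc_conv_app_nth)
  qed (auto simp: marking_def)
  then show "run_within (for_neighbours (mark_neighbour test)) \<tau> (15 * L + 2)
      (\<lambda>\<tau>'. parsed G k \<tau>' \<and> reg \<tau>' vertex_reg = v \<and> marking X K (neighbours G v) \<tau>')"
    by simp
qed

definition kept_upto :: "nat set \<Rightarrow> nat \<Rightarrow> nat set" where
  "kept_upto X i = X \<union> (\<Union>v\<in>{v \<in> X. v < i}. marked X S (card X + 1) (neighbours G v))"

lemma kept_upto_Suc: "kept_upto X (Suc i) =
    kept_upto X i \<union> (if i \<in> X then marked X S (card X + 1) (neighbours G i) else {})"
  by (auto simp: kept_upto_def less_Suc_eq)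

lemma kept_upto_num_vertices: "X \<subseteq> {..<N} \<Longrightarrow> kept_upto X N = kept G S X"
  by (auto simp: kept_upto_def kept_def)

lemma run_mark_prog:
  assumes pre: "parsed G k \<sigma>" "arr \<sigma> cover_arr = indicator X" "arr \<sigma> kept_arr = indicator X"
      "reg \<sigma> quota_reg = card X + 1"
    and bounded: "X \<subseteq> {..<N}"
  shows "run_within (mark_prog test) \<sigma> phase_time
    (\<lambda>\<tau>. parsed G k \<tau> \<and> arr \<tau> kept_arr = indicator (kept G S X))"
proof -
  define I where "I i \<tau> \<longleftrightarrow> arr \<tau> cover_arr = indicator X \<and> reg \<tau> quota_reg = card X + 1 \<and>
     arr \<tau> kept_arr = indicator (kept_upto X i)" for i and \<tau> :: ram_state
  let ?guard = "Equal (Cell cover_arr (Reg vertex_reg)) (Const 1)"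
  have "run_within (mark_prog test) \<sigma> phase_time (\<lambda>\<tau>. parsed G k \<tau> \<and> I N \<tau>)"
    unfolding mark_prog_def
  proof (rule run_within_phase)
    fix i \<tau>
    assume vertex: "i < N" and state: "parsed G k \<tau>" "reg \<tau> vertex_reg = i" "I i \<tau>"
    have guard: "bval ?guard \<tau> \<longleftrightarrow> i \<in> X"
      using state by (simp add: I_def indicator_eq_Suc_0_iff)
    show "run_within (When ?guard (mark_neighbours test)) \<tau> (15 * L + 20)
        (\<lambda>\<tau>'. parsed G k \<tau>' \<and> reg \<tau>' vertex_reg = i \<and> I (Suc i) \<tau>')"
    proof (cases "i \<in> X")
      case True
      then show ?thesis
        using run_mark_neighbours[OF vertex state(1,2), of X "kept_upto X i"] state(3)
        unfolding run_Cond guard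
        by (auto simp: I_def marking_def kept_upto_Suc elim: run_mono)
    next
      case False
      then show ?thesis
        using state unfolding run_Cond guard by (simp add: run_Skip I_def kept_upto_Suc)
    qed
  qed (use pre num_vertices_le in \<open>auto simp: I_def parsed_regs kept_upto_def\<close>)
  then show ?thesis
    by (auto simp: I_def kept_upto_num_vertices[OF bounded] elim: run_mono)
qed

lemma run_kernel_vertices_prog:
  defines "K \<equiv> kept G S (cover_vertices G)"
  shows "run_within (kernel_vertices_prog test) (initial w) (6 * phase_time + 2)
    (\<lambda>\<tau>. parsed G k \<tau> \<and> ranked G K \<tau>)"
proof -
  let ?X = "cover_vertices G" and ?T = phase_time
  let ?Q = "\<lambda>\<tau>. parsed G k \<tau> \<and> ranked G K \<tau>"
  have bounded: "?X \<subseteq> {..<N}"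
    using wf by (rule cover_vertices_subset)
  have mark: "run_within (mark_prog test ;; rank_prog) \<tau> (?T + (1 + ?T)) ?Q"
    if "parsed G k \<tau> \<and> arr \<tau> cover_arr = indicator ?X \<and> arr \<tau> kept_arr = indicator ?X \<and>
      reg \<tau> quota_reg = card ?X + 1" for \<tau>
    using that unfolding K_def
    by (intro run_within_Seq[OF run_mark_prog[OF _ _ _ _ bounded]] run_rank_prog) auto
  have count: "run_within (count_prog ;; mark_prog test ;; rank_prog) \<tau>
      ((1 + ?T) + (?T + (1 + ?T))) ?Q" if "parsed G k \<tau> \<and> covering ?X \<tau>" for \<tau>
    using that by (intro run_within_Seq[OF run_count_prog[OF _ _ bounded] mark]) auto
  have cover: "run_within (cover_prog ;; count_prog ;; mark_prog test ;; rank_prog) \<tau>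
      (?T + ((1 + ?T) + (?T + (1 + ?T)))) ?Q"
    if "parsed G k \<tau> \<and> covering (lq_vertices G) \<tau>" for \<tau>
    using that by (intro run_within_Seq[OF run_cover_prog count]) auto
  have lq: "run_within (lq_prog ;; cover_prog ;; count_prog ;; mark_prog test ;; rank_prog) \<tau>
      (?T + (?T + ((1 + ?T) + (?T + (1 + ?T))))) ?Q" if "parsed G k \<tau> \<and> covering {} \<tau>" for \<tau>
    using that by (intro run_within_Seq[OF run_lq_prog cover]) auto
  have "run_within (kernel_vertices_prog test) (initial w)
      (?T + (?T + (?T + ((1 + ?T) + (?T + (1 + ?T)))))) ?Q"
    unfolding kernel_vertices_prog_def by (rule run_within_Seq[OF run_parse_prog lq])
  then show ?thesis
    by (rule run_within_weaken) simp_all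
qed

end

section \<open>Writing the kernel\<close>

abbreviation (input) length_reg :: nat where "length_reg \<equiv> 9"
abbreviation (input) start_reg :: nat where "start_reg \<equiv> 10"
abbreviation (input) output_arr :: nat where "output_arr \<equiv> 6"

definition emit :: "aexp \<Rightarrow> com" where
  "emit e = SetCell output_arr (Reg length_reg) e ;;
     SetReg length_reg (Plus (Reg length_reg) (Const 1))"

definition header_prog :: com where
  "header_prog =
     SetReg length_reg (Const 0) ;;
     Cond (Less (Cell rank_arr (Reg agents_reg)) (Cell word_arr (Const 0)))
       (emit (Plus (Cell rank_arr (Reg agents_reg)) (Const 1)))
       (emit (Cell word_arr (Const 0))) ;;
     emit (Cell rank_arr (Reg agents_reg)) ;;
     emit (Minus (Cell rank_arr (Reg vertices_reg)) (Cell rank_arr (Reg agents_reg)))"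

definition emit_lq_prog :: com where
  "emit_lq_prog =
     For vertex_reg (Reg vertices_reg)
       (When (Conj (Neg (Less (Reg vertex_reg) (Reg agents_reg)))
           (Equal (Cell kept_arr (Reg vertex_reg)) (Const 1)))
         (emit (Cell word_arr (Plus (Const 3) (Minus (Reg vertex_reg) (Reg agents_reg))))))"

definition emit_neighbour :: com where
  "emit_neighbour =
     When (Equal (Cell kept_arr (Reg neighbour_reg)) (Const 1))
       (Cond (Less (Reg vertex_reg) (Reg agents_reg))
         (emit (Minus (Cell rank_arr (Reg neighbour_reg)) (Cell rank_arr (Reg agents_reg))))
         (emit (Cell rank_arr (Reg neighbour_reg))))"

text \<open>The length of a list is only known after its entries, so it overwrites a placeholder.\<close>

definition emit_list :: com where
  "emit_list =
     SetReg start_reg (Reg length_reg) ;;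
     emit (Const 0) ;;
     for_neighbours emit_neighbour ;;
     SetCell output_arr (Reg start_reg)
       (Minus (Minus (Reg length_reg) (Reg start_reg)) (Const 1))"

definition emit_lists_prog :: com where
  "emit_lists_prog =
     For vertex_reg (Reg vertices_reg)
       (When (Equal (Cell kept_arr (Reg vertex_reg)) (Const 1)) emit_list)"

definition copy_prog :: com where
  "copy_prog =
     For vertex_reg (Reg length_reg)
       (SetCell word_arr (Reg vertex_reg) (Cell output_arr (Reg vertex_reg))) ;;
     SetReg 0 (Reg length_reg)"

definition write_kernel_prog :: com where
  "write_kernel_prog = header_prog ;; emit_lq_prog ;; emit_lists_prog ;; copy_prog"

definition written :: "nat list \<Rightarrow> ram_state \<Rightarrow> bool" where
  "written ys \<sigma> \<longleftrightarrow> reg \<sigma> length_reg = length ys \<and> (\<forall>i<length ys. arr \<sigma> output_arr i = ys ! i)"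

definition put :: "nat \<Rightarrow> ram_state \<Rightarrow> ram_state" where
  "put y \<sigma> =
     set_reg length_reg (Suc (reg \<sigma> length_reg)) (set_cell output_arr (reg \<sigma> length_reg) y \<sigma>)"

lemma run_emit: "run (emit e) \<sigma> Q \<longleftrightarrow> Q 2 (put (aval e \<sigma>) \<sigma>)"
  by (simp add: emit_def run_simps put_def numeral_2_eq_2)

lemma put_simps [simp]:
  "r \<noteq> length_reg \<Longrightarrow> reg (put y \<sigma>) r = reg \<sigma> r"
  "A \<noteq> output_arr \<Longrightarrow> arr (put y \<sigma>) A = arr \<sigma> A"
  by (simp_all add: put_def)

lemma written_put: "written ys \<sigma> \<Longrightarrow> written (ys @ [y]) (put y \<sigma>)"
  by (simp add: written_def put_def nth_append less_Suc_eq)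

lemma written_set_reg [simp]: "r \<noteq> length_reg \<Longrightarrow> written ys (set_reg r v \<sigma>) \<longleftrightarrow> written ys \<sigma>"
  by (simp add: written_def)

lemma written_set_cell:
  "written (ys @ y # zs) \<sigma> \<Longrightarrow> written (ys @ z # zs) (set_cell output_arr (length ys) z \<sigma>)"
  by (auto simp: written_def nth_append nth_Cons split: nat.splits)

lemma parsed_put [simp]: "parsed G k (put y \<sigma>) \<longleftrightarrow> parsed G k \<sigma>"
  by (simp add: put_def)

lemma run_copy_prog:
  assumes "written ys \<sigma>"
  shows "run_within copy_prog \<sigma> (3 * length ys + 3) (\<lambda>\<tau>. output_word \<tau> = ys)"
proof -
  let ?I = "\<lambda>i \<tau>. written ys \<tau> \<and> (\<forall>j<i. arr \<tau> word_arr j = ys ! j)"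
  let ?body = "SetCell word_arr (Reg vertex_reg) (Cell output_arr (Reg vertex_reg))"
  have "run_within (For vertex_reg (Reg length_reg) ?body) \<sigma> (length ys * (1 + 2) + 2)
      (?I (length ys))"
  proof (rule run_within_For)
    show "run_within ?body \<tau> 1 (\<lambda>\<tau>'. reg \<tau>' vertex_reg = i \<and> ?I (Suc i) \<tau>')"
      if "i < length ys" "?I i \<tau>" "reg \<tau> vertex_reg = i" for i \<tau>
      using that by (simp add: run_simps written_def less_Suc_eq)
  qed (use assms in \<open>auto simp: written_def\<close>)
  then have "run_within copy_prog \<sigma> (length ys * (1 + 2) + 2 + 1) (\<lambda>\<tau>. output_word \<tau> = ys)"
    unfolding copy_prog_def
    by (rule run_within_Seq)
      (auto simp: run_simps written_def output_word_def intro: nth_equalityI)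
  then show ?thesis
    by (rule run_within_weaken) simp_all
qed

lemma ranked_set_reg [simp]: "ranked G K (set_reg r v \<sigma>) \<longleftrightarrow> ranked G K \<sigma>"
  by (simp add: ranked_def)

lemma ranked_set_cell [simp]: "5 < A \<Longrightarrow> ranked G K (set_cell A i v \<sigma>) \<longleftrightarrow> ranked G K \<sigma>"
  by (simp add: ranked_def)

lemma ranked_put [simp]: "ranked G K (put y \<sigma>) \<longleftrightarrow> ranked G K \<sigma>"
  by (simp add: put_def)

definition new_label :: "lq_instance \<Rightarrow> nat set \<Rightarrow> nat \<Rightarrow> nat \<Rightarrow> nat" where
  "new_label G K v u = (if v < num_agents G then rank K u - rank K (num_agents G) else rank K u)"

definition out_list :: "lq_instance \<Rightarrow> nat set \<Rightarrow> nat \<Rightarrow> nat list" where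
  "out_list G K v = map (new_label G K v) (filter (\<lambda>u. u \<in> K) (neighbours G v))"

definition out_lists :: "lq_instance \<Rightarrow> nat set \<Rightarrow> nat \<Rightarrow> nat list" where
  "out_lists G K i = encode_lists (map (out_list G K) (filter (\<lambda>v. v \<in> K) [0..<i]))"

lemma out_lists_Suc:
  "out_lists G K (Suc i) = (if i \<in> K
     then out_lists G K i @ length (out_list G K i) # out_list G K i else out_lists G K i)"
  by (simp add: out_lists_def encode_lists_snoc)

definition out_lq :: "lq_instance \<Rightarrow> nat set \<Rightarrow> nat \<Rightarrow> nat list" where
  "out_lq G K i =
     map (\<lambda>v. of_bool (lq G ! (v - num_agents G))) (filter (\<lambda>v. num_agents G \<le> v \<and> v \<in> K) [0..<i])"

lemma out_lq_Suc:
  "out_lq G K (Suc i) = (if num_agents G \<le> i \<and> i \<in> K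
     then out_lq G K i @ [of_bool (lq G ! (i - num_agents G))] else out_lq G K i)"
  by (simp add: out_lq_def)

context program_input
begin

definition out_header :: "nat set \<Rightarrow> nat list" where
  "out_header K = [min k (Suc (rank K n)), rank K n, rank K N - rank K n]"

lemma run_header_prog:
  assumes "parsed G k \<sigma>" "ranked G K \<sigma>"
  shows "run_within header_prog \<sigma> phase_time
    (\<lambda>\<tau>. parsed G k \<tau> \<and> ranked G K \<tau> \<and> written (out_header K) \<tau>)"
proof -
  let ?\<sigma> = "set_reg length_reg 0 \<sigma>"
  have cells: "reg \<sigma> agents_reg = n" "reg \<sigma> vertices_reg = N" "arr \<sigma> word_arr 0 = k"
    "arr \<sigma> rank_arr n = rank K n" "arr \<sigma> rank_arr N = rank K N"
    using assms num_agents_le input_header by (auto simp: parsed_def ranked_def)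
  have "written ([] @ [min k (Suc (rank K n))] @ [rank K n] @ [rank K N - rank K n])
      (put (rank K N - rank K n) (put (rank K n) (put (min k (Suc (rank K n))) ?\<sigma>)))"
    unfolding append_assoc[symmetric] by (intro written_put) (simp add: written_def)
  then show ?thesis
    using assms
    by (cases "rank K n < k")
      (simp_all add: header_prog_def run_simps run_emit cells out_header_def)
qed

lemma run_emit_lq_prog:
  assumes "parsed G k \<sigma>" "ranked G K \<sigma>" "written ys \<sigma>"
  shows "run_within emit_lq_prog \<sigma> phase_time
    (\<lambda>\<tau>. parsed G k \<tau> \<and> ranked G K \<tau> \<and> written (ys @ out_lq G K N) \<tau>)"
  unfolding emit_lq_prog_def
proof (rule run_within_phase)
  fix i \<tau>
  assume state: "i < N" "parsed G k \<tau>" "reg \<tau> vertex_reg = i"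
    and invariant: "ranked G K \<tau> \<and> written (ys @ out_lq G K i) \<tau>"
  let ?guard = "Conj (Neg (Less (Reg vertex_reg) (Reg agents_reg)))
    (Equal (Cell kept_arr (Reg vertex_reg)) (Const 1))"
  let ?bit = "Cell word_arr (Plus (Const 3) (Minus (Reg vertex_reg) (Reg agents_reg)))"
  have guard: "bval ?guard \<tau> \<longleftrightarrow> n \<le> i \<and> i \<in> K"
    using state invariant by (auto simp: ranked_def parsed_regs indicator_eq_Suc_0_iff)
  have bit: "aval ?bit \<tau> = of_bool (lq G ! (i - n))" if "n \<le> i"
    using state that input_lq[of "i - n"] by (simp add: parsed_def num_vertices_def)
  show "run_within (When ?guard (emit ?bit)) \<tau> (15 * L + 20)
      (\<lambda>\<tau>'. parsed G k \<tau>' \<and> reg \<tau>' vertex_reg = i \<and> ranked G K \<tau>' \<and>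
        written (ys @ out_lq G K (Suc i)) \<tau>')"
  proof (cases "n \<le> i \<and> i \<in> K")
    case True
    then show ?thesis
      using state invariant bit written_put[of "ys @ out_lq G K i" \<tau> "of_bool (lq G ! (i - n))"]
      unfolding run_Cond guard out_lq_Suc if_P[OF True] by (simp add: run_emit del: aval.simps)
  next
    case False
    then show ?thesis
      using state invariant unfolding run_Cond guard out_lq_Suc if_not_P[OF False]
      by (simp add: run_Skip)
  qed
qed (use assms num_vertices_le in \<open>auto simp: parsed_regs out_lq_def\<close>)

lemma run_emit_neighbour:
  assumes "parsed G k \<tau>" "ranked G K \<tau>" "written ys \<tau>"
    and "reg \<tau> vertex_reg = v" "reg \<tau> neighbour_reg = u" "u < N"
  shows "run_within emit_neighbour \<tau> 10 (\<lambda>\<tau>'. parsed G k \<tau>' \<and> ranked G K \<tau>' \<and>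
    reg \<tau>' vertex_reg = v \<and> reg \<tau>' index_reg = reg \<tau> index_reg \<and>
    reg \<tau>' start_reg = reg \<tau> start_reg \<and>
    written (ys @ (if u \<in> K then [new_label G K v u] else [])) \<tau>')"
proof -
  have "arr \<tau> rank_arr u = rank K u" "arr \<tau> rank_arr n = rank K n"
    using assms num_agents_le by (auto simp: ranked_def)
  moreover have "arr \<tau> kept_arr u = Suc 0 \<longleftrightarrow> u \<in> K"
    using assms by (simp add: ranked_def indicator_eq_Suc_0_iff)
  ultimately show ?thesis
    using assms
    by (simp add: emit_neighbour_def run_simps run_emit new_label_def parsed_regs written_put)
qed

lemma run_emit_neighbours:
  assumes vertex: "v < N"
    and pre: "parsed G k \<sigma>" "reg \<sigma> vertex_reg = v" "ranked G K \<sigma>" "written ys \<sigma>"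
  shows "run_within (for_neighbours emit_neighbour) \<sigma> (15 * L + 2)
    (\<lambda>\<tau>. parsed G k \<tau> \<and> reg \<tau> vertex_reg = v \<and> ranked G K \<tau> \<and>
      reg \<tau> start_reg = reg \<sigma> start_reg \<and> written (ys @ out_list G K v) \<tau>)"
proof -
  define out where
    "out j = ys @ map (new_label G K v) (filter (\<lambda>u. u \<in> K) (take j (neighbours G v)))" for j
  define I where "I j \<tau> \<longleftrightarrow> ranked G K \<tau> \<and> reg \<tau> start_reg = reg \<sigma> start_reg \<and> written (out j) \<tau>"
    for j and \<tau> :: ram_state
  have "run_within (for_neighbours emit_neighbour) \<sigma> (15 * L + 2)
      (\<lambda>\<tau>. parsed G k \<tau> \<and> reg \<tau> vertex_reg = v \<and> I (length (neighbours G v)) \<tau>)"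
  proof (rule run_within_for_neighbours[OF vertex])
    fix j \<tau>
    assume state: "j < length (neighbours G v)" "parsed G k \<tau>" "reg \<tau> vertex_reg = v"
      "reg \<tau> neighbour_reg = neighbours G v ! j" and invariant: "I j \<tau>"
    have "out (Suc j) = out j @ (if neighbours G v ! j \<in> K
        then [new_label G K v (neighbours G v ! j)] else [])"
      using state(1) by (simp add: out_def take_Suc_conv_app_nth)
    then show "run_within emit_neighbour \<tau> 10 (\<lambda>\<tau>'. parsed G k \<tau>' \<and> reg \<tau>' vertex_reg = v \<and>
        reg \<tau>' index_reg = reg \<tau> index_reg \<and> I (Suc j) \<tau>')"
      using run_emit_neighbour[OF state(2) _ _ state(3,4) neighbour_less[OF vertex state(1)],
          of K "out j"] invariant
      by (auto simp: I_def elim: run_mono)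
  qed (use pre in \<open>auto simp: I_def out_def\<close>)
  then show ?thesis
    by (simp add: I_def out_def out_list_def)
qed

lemma run_emit_list:
  assumes pre: "parsed G k \<sigma>" "ranked G K \<sigma>" "written ys \<sigma>"
    and vertex: "reg \<sigma> vertex_reg = v" "v < N"
  shows "run_within emit_list \<sigma> (15 * L + 6) (\<lambda>\<tau>. parsed G k \<tau> \<and> reg \<tau> vertex_reg = v \<and>
    ranked G K \<tau> \<and> written (ys @ length (out_list G K v) # out_list G K v) \<tau>)"
proof -
  let ?P = "\<lambda>zs \<tau>. parsed G k \<tau> \<and> reg \<tau> vertex_reg = v \<and> ranked G K \<tau> \<and>
    reg \<tau> start_reg = length ys \<and> written (ys @ zs) \<tau>"
  let ?len = "Minus (Minus (Reg length_reg) (Reg start_reg)) (Const 1)"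
  have start: "run_within (SetReg start_reg (Reg length_reg) ;; emit (Const 0)) \<sigma> 3 (?P [0])"
    using pre vertex written_put[of ys "set_reg start_reg (length ys) \<sigma>" 0]
    by (simp add: run_simps run_emit) (simp add: written_def)
  have loop: "run_within (for_neighbours emit_neighbour) \<tau> (15 * L + 2) (?P (0 # out_list G K v))"
    if "?P [0] \<tau>" for \<tau>
    using that by (intro run_mono[OF run_emit_neighbours[OF vertex(2), of \<tau> K "ys @ [0]"]]) auto
  have finish: "run_within (SetCell output_arr (Reg start_reg) ?len) \<tau> 1
      (\<lambda>\<tau>. parsed G k \<tau> \<and> reg \<tau> vertex_reg = v \<and> ranked G K \<tau> \<and>
        written (ys @ length (out_list G K v) # out_list G K v) \<tau>)"
    if "?P (0 # out_list G K v) \<tau>" for \<tau>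
  proof -
    have "aval ?len \<tau> = length (out_list G K v)"
      using that by (simp add: written_def)
    then show ?thesis
      using that written_set_cell[of ys 0 "out_list G K v" \<tau>]
      by (simp add: run_simps del: aval.simps(5))
  qed
  have "run_within emit_list \<sigma> (3 + ((15 * L + 2) + 1)) (\<lambda>\<tau>. parsed G k \<tau> \<and>
      reg \<tau> vertex_reg = v \<and> ranked G K \<tau> \<and>
      written (ys @ length (out_list G K v) # out_list G K v) \<tau>)"
    using run_within_Seq[OF start run_within_Seq[OF loop finish]]
    unfolding emit_list_def run_Seq_assoc .
  then show ?thesis
    by (rule run_within_weaken) simp_all
qed

lemma run_emit_lists_prog:
  assumes "parsed G k \<sigma>" "ranked G K \<sigma>" "written ys \<sigma>"
  shows "run_within emit_lists_prog \<sigma> phase_time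
    (\<lambda>\<tau>. parsed G k \<tau> \<and> ranked G K \<tau> \<and> written (ys @ out_lists G K N) \<tau>)"
  unfolding emit_lists_prog_def
proof (rule run_within_phase)
  fix i \<tau>
  assume state: "i < N" "parsed G k \<tau>" "reg \<tau> vertex_reg = i"
    and invariant: "ranked G K \<tau> \<and> written (ys @ out_lists G K i) \<tau>"
  let ?guard = "Equal (Cell kept_arr (Reg vertex_reg)) (Const 1)"
  have guard: "bval ?guard \<tau> \<longleftrightarrow> i \<in> K"
    using state invariant by (simp add: ranked_def indicator_eq_Suc_0_iff)
  show "run_within (When ?guard emit_list) \<tau> (15 * L + 20) (\<lambda>\<tau>'. parsed G k \<tau>' \<and>
      reg \<tau>' vertex_reg = i \<and> ranked G K \<tau>' \<and> written (ys @ out_lists G K (Suc i)) \<tau>')"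
  proof (cases "i \<in> K")
    case True
    then show ?thesis
      using run_emit_list[OF state(2) _ _ state(3,1), of K "ys @ out_lists G K i"] invariant
      unfolding run_Cond guard by (auto simp: out_lists_Suc elim: run_mono)
  next
    case False
    then show ?thesis
      using state invariant unfolding run_Cond guard by (simp add: run_Skip out_lists_Suc)
  qed
qed (use assms num_vertices_le in \<open>auto simp: parsed_regs out_lists_def encode_lists_def\<close>)

lemma upt_num_vertices: "[0..<N] = [0..<n] @ map ((+) n) [0..<length (bpref G)]"
  using upt_add_eq_append[of 0 n "length (bpref G)"]
    map_add_upt[of n "length (bpref G)", unfolded add.commute[of _ n]]
  by (simp add: num_vertices_def)

lemma filter_vertices: "filter (\<lambda>v. v \<in> K) [0..<N] = filter (\<lambda>a. a \<in> agents_of G K) [0..<n] @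
    map ((+) n) (filter (\<lambda>b. b \<in> resources_of G K) [0..<length (bpref G)])"
  unfolding upt_num_vertices
  by (auto simp: filter_map agents_of_def resources_of_def comp_def intro!: filter_cong)

lemma out_lq_eq: "out_lq G K N = map of_bool (lq (induced_instance G K))"
proof -
  have "filter (\<lambda>v. n \<le> v \<and> v \<in> K) [0..<N] =
      map ((+) n) (filter (\<lambda>b. b \<in> resources_of G K) [0..<length (bpref G)])"
    unfolding upt_num_vertices
    by (auto simp: filter_map comp_def resources_of_def filter_empty_conv)
  then show ?thesis
    by (simp add: out_lq_def induced_instance_def sub_instance_def comp_def)
qed

lemma out_list_agent:
  "a < n \<Longrightarrow> out_list G K a =
    map (rank (resources_of G K)) (filter (\<lambda>b. b \<in> resources_of G K) (apref G ! a))"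
  by (simp add: out_list_def neighbours_def filter_map comp_def new_label_def rank_resources_of
      resources_of_def)

lemma out_list_resource:
  assumes "b < length (bpref G)"
  shows "out_list G K (n + b) =
    map (rank (agents_of G K)) (filter (\<lambda>a. a \<in> agents_of G K) (bpref G ! b))"
proof -
  have agents: "a < n" if "a \<in> set (bpref G ! b)" for a
    using wf_instance_resource(2)[OF wf, of b] assms that
    by (auto simp: resources_def agents_def num_agents_def)
  then have "filter (\<lambda>u. u \<in> K) (bpref G ! b) = filter (\<lambda>a. a \<in> agents_of G K) (bpref G ! b)"
    by (intro filter_cong) (auto simp: agents_of_def)
  then show ?thesis
    using agents
    by (auto simp: out_list_def neighbours_def new_label_def
        intro!: map_cong rank_agents_of[symmetric] less_imp_le)
qed

lemma out_lists_eq: "out_lists G K N =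
    encode_lists (apref (induced_instance G K)) @ encode_lists (bpref (induced_instance G K))"
proof -
  have "map (out_list G K) (filter (\<lambda>v. v \<in> K) [0..<N]) =
      apref (induced_instance G K) @ bpref (induced_instance G K)"
    unfolding filter_vertices
    by (auto simp: induced_instance_def sub_instance_def sub_lists_def
        out_list_agent out_list_resource simp flip: num_agents_def)
  then show ?thesis
    by (simp add: out_lists_def encode_lists_append)
qed

lemma encode_induced:
  "encode (induced_instance G K, min k (Suc (num_agents (induced_instance G K)))) =
    out_header K @ out_lq G K N @ out_lists G K N"
  unfolding encode_def out_lq_eq out_lists_eq
  by (simp add: out_header_def num_agents_induced length_bpref_induced flip: num_agents_def)

lemma run_write_kernel_prog:
  assumes "parsed G k \<sigma>" "ranked G K \<sigma>"
  defines "out \<equiv> encode (induced_instance G K, min k (Suc (num_agents (induced_instance G K))))"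
  shows "run_within write_kernel_prog \<sigma> (3 * phase_time + 3 * length out + 3)
    (\<lambda>\<tau>. output_word \<tau> = out)"
proof -
  let ?P = "\<lambda>ys \<tau>. parsed G k \<tau> \<and> ranked G K \<tau> \<and> written ys \<tau>"
  have out: "out = (out_header K @ out_lq G K N) @ out_lists G K N"
    by (simp add: out_def encode_induced)
  have lists: "run_within (emit_lists_prog ;; copy_prog) \<tau> (phase_time + (3 * length out + 3))
      (\<lambda>\<tau>. output_word \<tau> = out)" if "?P (out_header K @ out_lq G K N) \<tau>" for \<tau>
    using that unfolding out by (intro run_within_Seq[OF run_emit_lists_prog] run_copy_prog) auto
  have "run_within (emit_lq_prog ;; emit_lists_prog ;; copy_prog) \<tau>
      (phase_time + (phase_time + (3 * length out + 3))) (\<lambda>\<tau>. output_word \<tau> = out)"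
    if "?P (out_header K) \<tau>" for \<tau>
    using that by (intro run_within_Seq[OF run_emit_lq_prog] lists) auto
  then have "run_within write_kernel_prog \<sigma>
      (phase_time + (phase_time + (phase_time + (3 * length out + 3)))) (\<lambda>\<tau>. output_word \<tau> = out)"
    unfolding write_kernel_prog_def using assms(1,2)
    by (intro run_within_Seq[OF run_header_prog]) auto
  then show ?thesis
    by (rule run_within_weaken) simp_all
qed

end

section \<open>Polynomial kernels\<close>

definition kernel_prog :: "bexp \<Rightarrow> com" where
  "kernel_prog test = kernel_vertices_prog test ;; write_kernel_prog"

definition decides_membership :: "bexp \<Rightarrow> (lq_instance \<Rightarrow> nat set) \<Rightarrow> bool" where
  "decides_membership test S \<longleftrightarrow> (\<forall>G k \<sigma>. wf_instance G \<longrightarrow> parsed G k \<sigma> \<longrightarrow>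
     reg \<sigma> neighbour_reg < num_vertices G \<longrightarrow> (bval test \<sigma> \<longleftrightarrow> reg \<sigma> neighbour_reg \<in> S G))"

definition time_poly :: "nat poly" where
  "time_poly = smult 400 ([:2, 1:]\<^sup>2)"

lemma run_kernel_prog:
  assumes test: "decides_membership test S" and wf: "wf_instance G"
  shows "run_within (kernel_prog test) (initial (encode (G, k)))
    (poly time_poly (word_size (encode (G, k)))) (\<lambda>\<tau>. output_word \<tau> = encode (kernelize S (G, k)))"
proof (rule run_within_weaken)
  interpret marking_program G k test "S G"
    using test wf by unfold_locales (auto simp: decides_membership_def)
  let ?out = "encode (kernelize S (G, k))"
  show "run_within (kernel_prog test) (initial w)
      ((6 * phase_time + 2) + (3 * phase_time + 3 * length ?out + 3)) (\<lambda>\<tau>. output_word \<tau> = ?out)"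
    unfolding kernel_prog_def
  proof (rule run_within_Seq)
    show "run_within (kernel_vertices_prog test) (initial w) (6 * phase_time + 2)
        (\<lambda>\<tau>. parsed G k \<tau> \<and> ranked G (kernel_vertices S G) \<tau>)"
      unfolding kernel_vertices_def by (rule run_kernel_vertices_prog)
  qed (use run_write_kernel_prog[of _ "kernel_vertices S G"] in \<open>simp add: kernelize_eq\<close>)
  have "card (kernel_vertices S G) \<le> L"
    using card_mono[OF _ kernel_vertices_subset[OF wf, of S]] num_vertices_le by simp
  moreover have "length ?out \<le> (card (kernel_vertices S G) + 2)\<^sup>2"
    using length_encode_le[OF wf_kernel[OF wf]]
    by (simp add: kernelize_eq num_vertices_kernel[OF wf])
  ultimately have "length ?out \<le> (L + 2)\<^sup>2"
    by (meson add_le_mono1 order_trans power_mono zero_le)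
  then have "(6 * phase_time + 2) + (3 * phase_time + 3 * length ?out + 3) \<le> 400 * (L + 2)\<^sup>2"
    by (simp add: power2_eq_square algebra_simps)
  also have "\<dots> \<le> poly time_poly (word_size w)"
    using length_le_word_size[of w] by (simp add: time_poly_def poly_power)
  finally show "(6 * phase_time + 2) + (3 * phase_time + 3 * length ?out + 3)
      \<le> poly time_poly (word_size w)" .
qed

lemma poly_time_kernelize:
  assumes "decides_membership test S" "\<And>G k. (G, k) \<in> I \<Longrightarrow> wf_instance G"
  shows "poly_time_on encode I (kernelize S)"
  unfolding poly_time_on_def
proof (intro exI[of _ "kernel_prog test"] exI[of _ time_poly] ballI)
  fix x
  assume "x \<in> I"
  then obtain G k where "x = (G, k)" "wf_instance G"
    using assms(2) by (cases x) auto
  then show "\<exists>n \<tau>. exec (kernel_prog test) (initial (encode x)) n \<tau> \<and>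
      output_word \<tau> = encode (kernelize S x) \<and> n \<le> poly time_poly (word_size (encode x))"
    using run_kernel_prog[OF assms(1), of G k] unfolding run_def by auto
qed

definition shared_test :: bexp where
  "shared_test = Conj (Neg (Less (Reg neighbour_reg) (Reg agents_reg)))
     (Less (Const 1) (Cell word_arr (Cell offset_arr (Reg neighbour_reg))))"

lemma decides_membership_shared: "decides_membership shared_test shared_resources"
  unfolding decides_membership_def
proof (intro allI impI)
  fix G k \<sigma>
  assume wf: "wf_instance G" and \<sigma>: "parsed G k \<sigma>" "reg \<sigma> neighbour_reg < num_vertices G"
  interpret program_input G k
    by unfold_locales (rule wf)
  show "bval shared_test \<sigma> \<longleftrightarrow> reg \<sigma> neighbour_reg \<in> shared_resources G"
    using \<sigma> parsed_length_neighbours[OF \<sigma>]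
    by (auto simp: shared_test_def shared_resources_def parsed_regs)
qed

lemma decides_membership_empty: "decides_membership (Less (Const 0) (Const 0)) (\<lambda>_. {})"
  by (simp add: decides_membership_def)

lemma admits_poly_kernel_kernelize:
  assumes "decides_membership test S"
    and wf: "\<And>G k. (G, k) \<in> I \<Longrightarrow> wf_instance G"
    and equiv: "\<And>G k. (G, k) \<in> I \<Longrightarrow>
      kernelize S (G, k) \<in> I \<and> (kernelize S (G, k) \<in> Y \<longleftrightarrow> (G, k) \<in> Y)"
    and size: "\<And>G k. (G, k) \<in> I \<Longrightarrow> word_size (encode (kernelize S (G, k))) \<le> poly p (\<kappa> (G, k))"
  shows "admits_poly_kernel encode I Y \<kappa>"
  unfolding admits_poly_kernel_def
proof (intro exI[of _ "kernelize S"] exI[of _ p] conjI)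
  show "poly_time_on encode I (kernelize S)"
    using assms(1) wf by (rule poly_time_kernelize)
qed (use equiv size in auto)

theorem theorem2:
  shows "admits_poly_kernel encode efm_instances maxefm_yes
           (\<lambda>(G, k). stable_size G + max_common G)
       \<and> admits_poly_kernel encode stable_feasible_instances maxrsm_yes
           (\<lambda>(G, k). stable_size G)"
proof
  have efm_wf: "wf_instance G" if "(G, k) \<in> efm_instances" for G k
    using that by (simp add: efm_instances_def)
  then show "admits_poly_kernel encode efm_instances maxefm_yes
      (\<lambda>(G, k). stable_size G + max_common G)"
    by (rule admits_poly_kernel_kernelize[OF decides_membership_shared, where p = size_poly])
      (simp_all add: efm_wf kernelize_efm_instances kernelize_maxefm_iff word_size_kernelize_efm_le)
  have rsm_wf: "wf_instance G" if "(G, k) \<in> stable_feasible_instances" for G k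
    using that by (simp add: stable_feasible_instances_def)
  then show "admits_poly_kernel encode stable_feasible_instances maxrsm_yes
      (\<lambda>(G, k). stable_size G)"
    by (rule admits_poly_kernel_kernelize[OF decides_membership_empty, where p = size_poly])
      (simp_all add: rsm_wf kernelize_stable_feasible kernelize_maxrsm_iff
        word_size_kernelize_rsm_le)
qed

end
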